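(* Let $k$ be an arbitrary field, $R=k[x,y]$, let $I\subset R$ be a nonzero proper graded ideal, and let $H=H(R/I)$, so that $H=(1,2,\ldots,\mu,H_\mu,H_{\mu+1},\ldots)$ with $\mu=\min\{i\mid H_i<i+1\}$ and $\mu\ge H_\mu\ge H_{\mu+1}\ge\cdots$. For $i\ge\mu$ put $e_i=H_{i-1}-H_i$. Then $\nu_\mu(I)=e_\mu+1$, $\beta_i(I)=0$ for $i\le\mu$, $\tau(I_i)=0$ for $i<\mu$, and for every $i\ge\mu$: $$e_{i+1}\ \ge\ \nu_{i+1}(I)\ \ge\ (e_{i+1}-e_i)^+,\tag{a}$$ $$e_i\ \ge\ \beta_{i+1}(I)\ \ge\ (e_i-e_{i+1})^+,\tag{b}$$ $$\tau(I_i)=e_{i+1}+1-\nu_{i+1}(I)=e_i+1-\beta_{i+1}(I),$$ $$\tau(I_i)=\tau(I_{i-1})+\nu_i(I)-\beta_{i+1}(I),$$ $$1\ \le\ \tau(I_i)\ \le\ 1+\min\{e_i,e_{i+1}\}.\tag{c}$$ Moreover, for the ideals $I$ in an open dense subset of $G(H)$, the invariants $\nu(I)$, $\beta(I)$, $\tau(I)$ satisfy equality on the right-hand sides of (a), (b) and (c), respectively, for all $i\ge\mu$.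
   Context: $R=k[x,y]$ has the standard grading, $R_i$ its degree-$i$ part, and $H(R/I)_i=\dim_k(R/I)_i$; $n^+=\max\{0,n\}$. $\nu_i(I)=\dim_k\operatorname{Tor}_0^R(I,k)_i$ is the number of minimal generators of $I$ of degree $i$; $\beta_i(I)=\dim_k\operatorname{Tor}_1^R(I,k)_i$ is the number of minimal relations of $I$ of degree $i$. For a subspace $V\subset R_i$, $\tau(V)=\dim_kR_1V-\dim_kV$, where $R_1V\subset R_{i+1}$ is the span of the products $\ell v$, $\ell\in R_1$, $v\in V$. $G(H)$ is the projective variety parametrizing all graded ideals $J\subset R$ with $H(R/J)=H$, a closed subvariety of $\prod_{\mu\le i\le N}\mathrm{Grass}(i+1-H_i,R_i)$, $N\gg0$, defined by the conditions $R_1V_i\subset V_{i+1}$ on sequences $(V_i)$. *)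

theory Defs
  imports
    "HOL-Analysis.Analysis"
    "HOL-Library.Function_Algebras"
    "HOL-Library.Poly_Mapping"
    "HOL-Algebra.Algebraic_Closure_Type"
    "Jordan_Normal_Form.Determinant"
begin

section \<open>The graded ring k[x,y]\<close>

text \<open>
  k[x,y] is represented as \<^typ>\<open>'k poly poly\<close> over a type \<^typ>\<open>'k\<close> of class \<^class>\<open>field\<close>:
  the outer variable is y, the inner one is x.
\<close>

type_synonym 'k bipoly = "'k poly poly"

definition bcoeff :: "'k::field bipoly \<Rightarrow> nat \<Rightarrow> nat \<Rightarrow> 'k" where
  "bcoeff f a b = Polynomial.coeff (Polynomial.coeff f b) a"

definition kscale :: "'k::field \<Rightarrow> 'k bipoly \<Rightarrow> 'k bipoly" where
  "kscale c f = Polynomial.smult [:c:] f"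

global_interpretation bp: vector_space "kscale :: 'k::field \<Rightarrow> 'k bipoly \<Rightarrow> 'k bipoly"
  by standard (auto simp: kscale_def smult_add_right mult.commute simp flip: smult_add_left one_pCons)

definition forms :: "nat \<Rightarrow> 'k::field bipoly set" where
  "forms i = {f. \<forall>a b. bcoeff f a b \<noteq> 0 \<longrightarrow> a + b = i}"

definition hom_part :: "nat \<Rightarrow> 'k::field bipoly \<Rightarrow> 'k bipoly" where
  "hom_part i f =
     (\<Sum>b\<le>i. Polynomial.monom (Polynomial.monom (bcoeff f (i - b) b) (i - b)) b)"

definition is_ideal :: "'k::field bipoly set \<Rightarrow> bool" where
  "is_ideal I \<longleftrightarrow> 0 \<in> I \<and> (\<forall>f\<in>I. \<forall>g\<in>I. f + g \<in> I) \<and> (\<forall>r. \<forall>f\<in>I. r * f \<in> I)"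

definition graded_ideal :: "'k::field bipoly set \<Rightarrow> bool" where
  "graded_ideal I \<longleftrightarrow> is_ideal I \<and> (\<forall>f\<in>I. \<forall>i. hom_part i f \<in> I)"

definition piece :: "'k::field bipoly set \<Rightarrow> nat \<Rightarrow> 'k bipoly set" where
  "piece I i = I \<inter> forms i"

text \<open>The Hilbert function of R/I; the degree-i part of R/I is the quotient of R_i by I_i.\<close>

definition hilbert :: "'k::field bipoly set \<Rightarrow> nat \<Rightarrow> nat" where
  "hilbert I i = bp.dim (forms i :: 'k bipoly set) - bp.dim (piece I i)"

definition R1_mult :: "'k::field bipoly set \<Rightarrow> 'k bipoly set" where
  "R1_mult V = bp.span {l * v | l v. l \<in> forms 1 \<and> v \<in> V}"

definition tau :: "'k::field bipoly set \<Rightarrow> int" where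
  "tau V = int (bp.dim (R1_mult V)) - int (bp.dim V)"


section \<open>Tor of an ideal with the residue field\<close>

text \<open>
  A graded complex F of free modules of finite rank, with an augmentation to R.
  The p-th module is the direct sum of the R(-d), d ranging over the list \<open>degs F p\<close>; its elements
  are the functions vanishing at all positions \<open>\<ge> length (degs F p)\<close>.  \<open>diff F p\<close> is the matrix
  (row index first) of the differential from the (p+1)-st module to the p-th one, and \<open>aug F j\<close> is
  the image in R of the j-th basis element of the 0-th module.
\<close>

record 'r free_complex =
  degs :: "nat \<Rightarrow> nat list"
  diff :: "nat \<Rightarrow> nat \<Rightarrow> nat \<Rightarrow> 'r"
  aug :: "nat \<Rightarrow> 'r"

definition free_vecs :: "nat \<Rightarrow> (nat \<Rightarrow> 'a::zero) set" where
  "free_vecs n = {v. \<forall>j\<ge>n. v j = 0}"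

definition mat_app :: "nat \<Rightarrow> nat \<Rightarrow> (nat \<Rightarrow> nat \<Rightarrow> 'a::comm_ring_1) \<Rightarrow> (nat \<Rightarrow> 'a) \<Rightarrow> nat \<Rightarrow> 'a" where
  "mat_app m n A v = (\<lambda>r. if r < m then (\<Sum>c<n. A r c * v c) else 0)"

abbreviation rk :: "'r free_complex \<Rightarrow> nat \<Rightarrow> nat" where
  "rk F p \<equiv> length (degs F p)"

definition diff_map :: "'k::field bipoly free_complex \<Rightarrow> nat \<Rightarrow> (nat \<Rightarrow> 'k bipoly) \<Rightarrow> nat \<Rightarrow> 'k bipoly" where
  "diff_map F p = mat_app (rk F p) (rk F (Suc p)) (diff F p)"

definition aug_map :: "'k::field bipoly free_complex \<Rightarrow> (nat \<Rightarrow> 'k bipoly) \<Rightarrow> 'k bipoly" where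
  "aug_map F v = (\<Sum>c<rk F 0. v c * aug F c)"

definition graded_free_resolution :: "'k::field bipoly free_complex \<Rightarrow> 'k bipoly set \<Rightarrow> bool" where
  "graded_free_resolution F I \<longleftrightarrow>
     (\<forall>c<rk F 0. aug F c \<in> forms (degs F 0 ! c)) \<and>
     (\<forall>p. \<forall>r<rk F p. \<forall>c<rk F (Suc p).
        if degs F p ! r \<le> degs F (Suc p) ! c
        then diff F p r c \<in> forms (degs F (Suc p) ! c - degs F p ! r)
        else diff F p r c = 0) \<and>
     aug_map F ` free_vecs (rk F 0) = I \<and>
     {v \<in> free_vecs (rk F 0). aug_map F v = 0} = diff_map F 0 ` free_vecs (rk F 1) \<and>
     (\<forall>p. {v \<in> free_vecs (rk F (Suc p)). diff_map F p v = (\<lambda>_. 0)}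
            = diff_map F (Suc p) ` free_vecs (rk F (Suc (Suc p))))"

text \<open>
  Tensoring with k = R/(x,y) turns the p-th module into a graded k-space with one basis vector for
  each entry of \<open>degs F p\<close>, and replaces the entries of the differentials by their constant terms.
\<close>

global_interpretation kv: vector_space "(\<lambda>c v j. c * v j) :: 'k::field \<Rightarrow> (nat \<Rightarrow> 'k) \<Rightarrow> nat \<Rightarrow> 'k"
  by standard (auto simp: fun_eq_iff algebra_simps)

definition tensor_piece :: "'k::field bipoly free_complex \<Rightarrow> nat \<Rightarrow> nat \<Rightarrow> (nat \<Rightarrow> 'k) set" where
  "tensor_piece F p i = {v \<in> free_vecs (rk F p). \<forall>j<rk F p. v j \<noteq> 0 \<longrightarrow> degs F p ! j = i}"

definition tensor_diff :: "'k::field bipoly free_complex \<Rightarrow> nat \<Rightarrow> (nat \<Rightarrow> 'k) \<Rightarrow> nat \<Rightarrow> 'k" where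
  "tensor_diff F p = mat_app (rk F p) (rk F (Suc p)) (\<lambda>r c. bcoeff (diff F p r c) 0 0)"

definition tensor_cycles :: "'k::field bipoly free_complex \<Rightarrow> nat \<Rightarrow> nat \<Rightarrow> (nat \<Rightarrow> 'k) set" where
  "tensor_cycles F p i =
     (case p of 0 \<Rightarrow> tensor_piece F 0 i
      | Suc q \<Rightarrow> {v \<in> tensor_piece F (Suc q) i. tensor_diff F q v = (\<lambda>_. 0)})"

definition tensor_boundaries :: "'k::field bipoly free_complex \<Rightarrow> nat \<Rightarrow> nat \<Rightarrow> (nat \<Rightarrow> 'k) set" where
  "tensor_boundaries F p i = tensor_diff F p ` tensor_piece F (Suc p) i"

text \<open>
  The dimension of the degree-i part of Tor_p(I,k), computed from a graded free resolution of the
  ideal I.  As always for derived functors, the resolution is an arbitrary choice that does not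
  affect the value.
\<close>

definition tor_dim :: "nat \<Rightarrow> 'k::field bipoly set \<Rightarrow> nat \<Rightarrow> nat" where
  "tor_dim p I i =
     (let F = (SOME F. graded_free_resolution F I)
      in kv.dim (tensor_cycles F p i) - kv.dim (tensor_boundaries F p i))"

definition nu :: "'k::field bipoly set \<Rightarrow> nat \<Rightarrow> nat" where
  "nu I i = tor_dim 0 I i"

definition beta :: "'k::field bipoly set \<Rightarrow> nat \<Rightarrow> nat" where
  "beta I i = tor_dim 1 I i"


section \<open>The variety G(H)\<close>

definition init_deg :: "(nat \<Rightarrow> nat) \<Rightarrow> nat" where
  "init_deg H = (LEAST i. H i < i + 1)"

definition GH :: "(nat \<Rightarrow> nat) \<Rightarrow> 'k::field bipoly set set" where
  "GH H = {J. graded_ideal J \<and> hilbert J = H}"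

text \<open>
  Pluecker coordinates.  The variables are indexed by pairs (i,S): for a point V of
  Grass(i + 1 - H i, R_i), the coordinate (i,S) is the maximal minor on the columns S of a matrix
  whose rows express a basis of V in the monomials \<open>x^(i-s) y^s\<close>, \<open>s = 0..i\<close>.
\<close>

type_synonym plucker_var = "nat \<times> nat set"

definition plucker_vars :: "nat \<Rightarrow> (nat \<Rightarrow> nat) \<Rightarrow> plucker_var set" where
  "plucker_vars N H =
     {(i, S). init_deg H \<le> i \<and> i \<le> N \<and> S \<subseteq> {0..i} \<and> card S = i + 1 - H i}"

definition is_basis :: "nat \<Rightarrow> (nat \<Rightarrow> 'k::field bipoly) \<Rightarrow> 'k bipoly set \<Rightarrow> bool" where
  "is_basis d b V \<longleftrightarrow> inj_on b {..<d} \<and> bp.independent (b ` {..<d}) \<and> bp.span (b ` {..<d}) = V"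

definition plucker :: "(nat \<Rightarrow> nat) \<Rightarrow> (nat \<Rightarrow> nat \<Rightarrow> 'k::field bipoly) \<Rightarrow> plucker_var \<Rightarrow> 'k" where
  "plucker H B = (\<lambda>(i, S).
     Determinant.det (Matrix.mat (i + 1 - H i) (i + 1 - H i)
       (\<lambda>(r, c). let s = sorted_list_of_set S ! c in bcoeff (B i r) (i - s) s)))"

text \<open>
  Polynomials over k in the Pluecker variables, homogeneous in each group of variables separately,
  so that their (non-)vanishing at a point of a product of Grassmannians does not depend on the
  bases.
\<close>

type_synonym 'k plucker_poly = "(plucker_var \<Rightarrow>\<^sub>0 nat) \<Rightarrow>\<^sub>0 'k"

definition multihomogeneous :: "nat \<Rightarrow> (nat \<Rightarrow> nat) \<Rightarrow> 'k::field plucker_poly \<Rightarrow> bool" where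
  "multihomogeneous N H P \<longleftrightarrow>
     (\<forall>m\<in>Poly_Mapping.keys P. Poly_Mapping.keys m \<subseteq> plucker_vars N H) \<and>
     (\<exists>D. \<forall>m\<in>Poly_Mapping.keys P. \<forall>i.
        (\<Sum>v\<in>{v \<in> Poly_Mapping.keys m. fst v = i}. Poly_Mapping.lookup m v) = D i)"

definition eval_at :: "'k::field plucker_poly \<Rightarrow> (plucker_var \<Rightarrow> 'k alg_closure) \<Rightarrow> 'k alg_closure" where
  "eval_at P z = (\<Sum>m\<in>Poly_Mapping.keys P. to_ac (Poly_Mapping.lookup P m) *
                    (\<Prod>v\<in>Poly_Mapping.keys m. z v ^ Poly_Mapping.lookup m v))"

definition principal_open ::
    "nat \<Rightarrow> (nat \<Rightarrow> nat) \<Rightarrow> 'k::field plucker_poly \<Rightarrow> 'k alg_closure bipoly set set" where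
  "principal_open N H P =
     {J \<in> GH H. \<forall>B. (\<forall>i\<in>{init_deg H..N}. is_basis (i + 1 - H i) (B i) (piece J i))
                    \<longrightarrow> eval_at P (plucker H B) \<noteq> 0}"

text \<open>
  The k-variety G(H) is represented by its geometric points, the graded ideals of K[x,y] for K the
  algebraic closure of k (over a finite k, say, the k-rational points alone do not see the variety).
  Its topology is the k-Zariski topology, induced by the embedding
  \<open>J \<mapsto> (J_i)\<close>, \<open>init_deg H \<le> i \<le> N\<close>, into a product of Grassmannians.  The type argument fixes k.
\<close>

definition GH_zariski :: "'k::field itself \<Rightarrow> nat \<Rightarrow> (nat \<Rightarrow> nat) \<Rightarrow> 'k alg_closure bipoly set topology" where
  "GH_zariski _ N H =
     topology_generated_by {principal_open N H (P :: 'k plucker_poly) | P. multihomogeneous N H P}"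

text \<open>The ideal of K[x,y] generated by I, that is, the geometric point underlying a k-rational one.\<close>

definition base_change :: "'k::field bipoly set \<Rightarrow> 'k alg_closure bipoly set" where
  "base_change I = \<Inter>{J. is_ideal J \<and> map_poly (map_poly to_ac) ` I \<subseteq> J}"


section \<open>The extremal values\<close>

definition hdiff :: "(nat \<Rightarrow> nat) \<Rightarrow> nat \<Rightarrow> int" where
  "hdiff H i = int (H (i - 1)) - int (H i)"

definition pos_part :: "int \<Rightarrow> int" where
  "pos_part n = max 0 n"

definition extremal_invariants :: "'k::field bipoly set \<Rightarrow> (nat \<Rightarrow> nat) \<Rightarrow> bool" where
  "extremal_invariants J H \<longleftrightarrow>
     (\<forall>i\<ge>init_deg H.
        int (nu J (i + 1)) = pos_part (hdiff H (i + 1) - hdiff H i) \<and>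
        int (beta J (i + 1)) = pos_part (hdiff H i - hdiff H (i + 1)) \<and>
        tau (piece J i) = 1 + min (hdiff H i) (hdiff H (i + 1)))"

end

theory Submission
  imports Defs
begin

text \<open>
  Counting dimensions of graded pieces in a resolution expresses \<open>\<nu>\<close> and \<open>\<beta>\<close> through the numbers
  dim \<open>I\<^sub>i\<close> and dim \<open>R\<^sub>1I\<^sub>i\<close>; the bounds follow from Hopf's inequality dim \<open>VW \<ge>\<close> dim \<open>V +\<close> dim \<open>W - 1\<close> and
  from \<open>xyI\<^sub>i\<^sub>-\<^sub>1 \<subseteq> xI\<^sub>i \<inter> yI\<^sub>i\<close>.

  For the density, deform the syzygy matrix \<open>B\<close> of a minimal resolution to \<open>B + tC\<close>, where the 0/1
  matrix \<open>C\<close> pairs as many generators as possible with relations of the same degree.  The dual of \<open>B\<close>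
  is onto, so the vector of generators extends to a polynomial family \<open>v(t)\<close> annihilating \<open>B + tC\<close>;
  for almost all \<open>t\<close> the ideal generated by \<open>v(t)\<close> has the same Hilbert function, and no generator
  paired by \<open>C\<close> is needed any more.  Equality is an open condition because it is a lower bound for
  dim \<open>R\<^sub>1J\<^sub>i\<close>, the rank of a matrix with entries linear in the Pluecker coordinates.
\<close>


section \<open>Finite-dimensional subspaces\<close>

text \<open>Equality in (a), (b) and (c) is a single condition, because \<tau> determines \<nu> and
  \<beta> once H is fixed. Beyond a fixed degree all e_i vanish and the condition is automatic, so
  finitely many degrees decide it. As \<open>tor_dim\<close> refers to an unspecified resolution,
  Tor is computed from an arbitrary one; the resolution of length one shows that the choice is not
  void and supplies the matrix to be deformed. Changing the generators freely would change the
  Hilbert function, so the syzygies are changed first and the generators follow. Constancy of the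
  Hilbert function is semicontinuity from two sides: independent syzygies stay independent, and so
  do independent elements of J_i. This is generic degree by degree, and only finitely many degrees
  can be imposed at once; beyond them the two bounds on dim R_1 J_i force the growth. Density needs
  no irreducibility of G(H): every J starts a curve of which all but finitely many members lie in U
  and in any given neighbourhood of J, and an algebraically closed field is infinite.\<close>

locale linear_space = vector_space scale
  for scale :: "'a::field \<Rightarrow> 'b::ab_group_add \<Rightarrow> 'b"
begin

text \<open>\<open>dim\<close> is 0 on a subspace of infinite dimension, and the ambient spaces are
  infinite-dimensional, so finiteness is carried along as a property of sets.\<close>

definition fin_dim :: "'b set \<Rightarrow> bool" where
  "fin_dim V \<longleftrightarrow> (\<exists>W. finite W \<and> V \<subseteq> span W)"

text \<open>Independence of an indexed family rather than of a set: members of a family depending on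
  a parameter may collide at special parameters.\<close>

definition lin_indep :: "nat \<Rightarrow> (nat \<Rightarrow> 'b) \<Rightarrow> bool" where
  "lin_indep q u \<longleftrightarrow> (\<forall>c. (\<Sum>l<q. scale (c l) (u l)) = 0 \<longrightarrow> (\<forall>l<q. c l = 0))"

lemma fin_dim_mono: "A \<subseteq> B \<Longrightarrow> fin_dim B \<Longrightarrow> fin_dim A"
  unfolding fin_dim_def by blast

lemma fin_dim_span_finite: "finite W \<Longrightarrow> fin_dim (span W)"
  unfolding fin_dim_def by blast

lemma indep_card_le:
  assumes "fin_dim V" "B \<subseteq> V" "independent B"
  shows "finite B \<and> card B \<le> dim V"
proof -
  obtain W where W: "finite W" "V \<subseteq> span W" using assms(1) by (auto simp: fin_dim_def)
  obtain C where C: "B \<subseteq> C" "C \<subseteq> V" "independent C" "V \<subseteq> span C"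
    using maximal_independent_subset_extend[OF assms(2,3)] .
  have "finite C" using independent_span_bound[OF W(1) C(3)] C(2) W(2) by blast
  moreover have "card C = dim V" by (rule basis_card_eq_dim[OF C(2,4,3)])
  ultimately show ?thesis using C(1) by (metis card_mono finite_subset)
qed

lemma fin_dim_basis:
  assumes "fin_dim V"
  obtains B where "finite B" "B \<subseteq> V" "independent B" "V \<subseteq> span B" "card B = dim V"
  using basis_exists[of V] indep_card_le[OF assms] by metis

lemma dim_mono_fd:
  assumes "A \<subseteq> B" "fin_dim B" shows "dim A \<le> dim B"
proof -
  obtain C where "finite C" "B \<subseteq> span C" "card C = dim B" using fin_dim_basis[OF assms(2)] by metis
  then show ?thesis using dim_le_card[of A C] assms(1) by auto
qed

lemma subspace_eq_fd:
  assumes "subspace A" "A \<subseteq> B" "fin_dim B" "dim B \<le> dim A" shows "A = B"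
proof (rule ccontr)
  assume "A \<noteq> B"
  then obtain b where b: "b \<in> B" "b \<notin> A" using assms(2) by blast
  obtain C where C: "finite C" "C \<subseteq> A" "independent C" "A \<subseteq> span C" "card C = dim A"
    using fin_dim_basis[OF fin_dim_mono[OF assms(2,3)]] .
  have "b \<notin> span C" using b(2) span_minimal[OF C(2) assms(1)] by blast
  then have "independent (insert b C)" "b \<notin> C" using C(3) independent_insertI span_base by blast+
  with indep_card_le[OF assms(3), of "insert b C"] C b assms show False by auto
qed

lemma dim_eq_0_fd: "fin_dim V \<Longrightarrow> dim V = 0 \<longleftrightarrow> V \<subseteq> {0}"
proof
  assume f: "fin_dim V" and 0: "dim V = 0"
  obtain B where "finite B" "V \<subseteq> span B" "card B = dim V" using fin_dim_basis[OF f] by metis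
  with 0 show "V \<subseteq> {0}" by auto
next
  assume "V \<subseteq> {0}"
  then show "dim V = 0" using dim_le_card[of V "{}"] by auto
qed

lemma independent_Un_disjoint:
  assumes "independent A" "independent B" "span A \<inter> span B \<subseteq> {0}"
  shows "independent (A \<union> B)" "A \<inter> B = {}"
proof -
  have "A \<inter> B \<subseteq> {0}" using assms(3) span_superset by blast
  moreover have "0 \<notin> A" using assms(1) dependent_zero by blast
  ultimately show dis: "A \<inter> B = {}" by auto
  show "independent (A \<union> B)"
    unfolding independent_explicit_finite_subsets
  proof (intro allI impI ballI)
    fix S u v assume S: "S \<subseteq> A \<union> B" "finite S" and z: "(\<Sum>v\<in>S. scale (u v) v) = 0" and v: "v \<in> S"
    have "(S \<inter> A) \<union> (S \<inter> B) = S" "(S \<inter> A) \<inter> (S \<inter> B) = {}" using S dis by auto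
    then have "(\<Sum>v\<in>S. scale (u v) v) = (\<Sum>v\<in>S \<inter> A. scale (u v) v) + (\<Sum>v\<in>S \<inter> B. scale (u v) v)"
      using sum.union_disjoint[of "S \<inter> A" "S \<inter> B" "\<lambda>v. scale (u v) v"] S(2) by simp
    then have e: "(\<Sum>v\<in>S \<inter> A. scale (u v) v) = - (\<Sum>v\<in>S \<inter> B. scale (u v) v)"
      using z by (simp add: eq_neg_iff_add_eq_0)
    have a: "(\<Sum>v\<in>S \<inter> A. scale (u v) v) \<in> span A" by (intro span_sum span_scale span_base) auto
    have b: "(\<Sum>v\<in>S \<inter> B. scale (u v) v) \<in> span B" by (intro span_sum span_scale span_base) auto
    have "(\<Sum>v\<in>S \<inter> A. scale (u v) v) = 0" using a b e span_neg[OF b] assms(3) by auto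
    then have "(\<Sum>v\<in>S \<inter> A. scale (u v) v) = 0" "(\<Sum>v\<in>S \<inter> B. scale (u v) v) = 0" using e by simp_all
    then have "\<forall>v\<in>S \<inter> A. u v = 0" "\<forall>v\<in>S \<inter> B. u v = 0"
      using independentD[OF assms(1), of "S \<inter> A" u] independentD[OF assms(2), of "S \<inter> B" u] S(2) by blast+
    then show "u v = 0" using v S by blast
  qed
qed

lemma independent_span_Int:
  assumes "independent (A \<union> B)" "A \<inter> B = {}" shows "span A \<inter> span B \<subseteq> {0}"
proof
  fix x assume x: "x \<in> span A \<inter> span B"
  have i: "independent A" "independent B" using assms(1) independent_mono by blast+
  have "representation A x = representation (A \<union> B) x" "representation B x = representation (A \<union> B) x"
    using x assms(1) by (auto intro!: representation_extend[symmetric])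
  then have e: "representation A x = representation B x" by simp
  have "representation A x v = 0" for v
    using representation_ne_zero[of A x v] representation_ne_zero[of B x v] e assms(2) by auto
  then have "x = 0" using sum_nonzero_representation_eq[OF i(1)] x by fastforce
  then show "x \<in> {0}" by simp
qed

text \<open>Grassmann's formula. A basis \<open>I\<close> of the intersection is extended to a basis
  \<open>C\<close> of \<open>A\<close>; an element of the span of \<open>C - I\<close> that lies in
  \<open>B\<close> is in the span of \<open>I\<close>, hence 0. So \<open>C - I\<close> and a basis
  of \<open>B\<close> form a basis of the sum.\<close>

lemma dim_sum_Int:
  assumes "subspace A" "subspace B" "fin_dim A" "fin_dim B"
  shows "dim {a + b | a b. a \<in> A \<and> b \<in> B} + dim (A \<inter> B) = dim A + dim B"
proof -
  obtain I where I: "finite I" "I \<subseteq> A \<inter> B" "independent I" "A \<inter> B \<subseteq> span I" "card I = dim (A \<inter> B)"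
    using fin_dim_basis[OF fin_dim_mono[OF Int_lower1 assms(3)]] .
  obtain C where C: "I \<subseteq> C" "C \<subseteq> A" "independent C" "A \<subseteq> span C"
    using maximal_independent_subset_extend[of I A] I by blast
  have C': "finite C" "card C = dim A" using indep_card_le[OF assms(3) C(2,3)] basis_card_eq_dim[OF C(2,4,3)] by auto
  obtain D where D: "finite D" "D \<subseteq> B" "independent D" "B \<subseteq> span D" "card D = dim B"
    using fin_dim_basis[OF assms(4)] .
  have sC: "span C = A" "span D = B" using span_minimal[OF C(2) assms(1)] span_minimal[OF D(2) assms(2)] C(4) D(4) by blast+
  have "span (C - I) \<inter> span D \<subseteq> {0}"
  proof -
    have "span (C - I) \<subseteq> A" using sC span_mono by (metis Diff_subset)
    then have "span (C - I) \<inter> span D \<subseteq> span (C - I) \<inter> span I" using I sC by blast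
    also have "\<dots> \<subseteq> {0}" by (rule independent_span_Int) (use C in \<open>auto simp: Un_absorb2\<close>)
    finally show ?thesis .
  qed
  then have u: "independent ((C - I) \<union> D)" "(C - I) \<inter> D = {}"
    using independent_Un_disjoint[of "C - I" D] independent_mono[OF C(3)] D(3) by auto
  let ?S = "{a + b | a b. a \<in> A \<and> b \<in> B}"
  have "span ((C - I) \<union> D) = span (C \<union> D)"
  proof (rule span_eq[THEN iffD2], intro conjI)
    show "(C - I) \<union> D \<subseteq> span (C \<union> D)" using span_superset[of "C \<union> D"] by blast
    have "I \<subseteq> span D" using I sC by blast
    then have "I \<subseteq> span (C - I \<union> D)" using span_mono[of D "C - I \<union> D"] by blast
    then show "C \<union> D \<subseteq> span (C - I \<union> D)" using span_superset[of "C - I \<union> D"] by blast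
  qed
  also have "\<dots> = ?S" unfolding span_Un sC by auto
  finally have "?S = span ((C - I) \<union> D)" by simp
  then have "dim ?S = card ((C - I) \<union> D)" using u(1) by (simp add: dim_span_eq_card_independent dim_eq_card_independent)
  also have "\<dots> = card (C - I) + card D" using C' D u by (simp add: card_Un_disjoint)
  also have "card (C - I) = card C - card I" using C I by (simp add: card_Diff_subset)
  finally show ?thesis using C'(2) D(5) I(5) card_mono[OF C'(1) C(1)] by linarith
qed

lemma lin_indep_inj: assumes "lin_indep q u" shows "inj_on u {..<q}"
proof (rule inj_onI)
  fix k l assume kl: "k \<in> {..<q}" "l \<in> {..<q}" "u k = u l"
  show "k = l"
  proof (rule ccontr)
    assume n: "k \<noteq> l"
    define c where "c = (\<lambda>j. if j = k then (1::'a) else if j = l then -1 else 0)"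
    have "(\<Sum>j<q. scale (c j) (u j)) = (\<Sum>j\<in>{k,l}. scale (c j) (u j))"
      by (rule sum.mono_neutral_right) (use kl in \<open>auto simp: c_def\<close>)
    also have "\<dots> = 0" using n kl by (simp add: c_def)
    finally have "c k = 0" using assms kl unfolding lin_indep_def by blast
    then show False by (simp add: c_def)
  qed
qed

lemma lin_indep_independent: assumes "lin_indep q u" shows "independent (u ` {..<q})"
proof (rule independent_if_scalars_zero)
  fix f x assume z: "(\<Sum>x\<in>u ` {..<q}. scale (f x) x) = 0" and x: "x \<in> u ` {..<q}"
  have "(\<Sum>l<q. scale (f (u l)) (u l)) = 0"
    using z unfolding sum.reindex[OF lin_indep_inj[OF assms]] o_def .
  then have "\<forall>l<q. f (u l) = 0" using assms[unfolded lin_indep_def, THEN spec[of _ "\<lambda>l. f (u l)"]] by blast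
  then show "f x = 0" using x by auto
qed simp

lemma independent_lin_indep: assumes "inj_on u {..<q}" "independent (u ` {..<q})" shows "lin_indep q u"
  unfolding lin_indep_def
proof (intro allI impI)
  fix c l assume z: "(\<Sum>l<q. scale (c l) (u l)) = 0" and l: "l < q"
  define d where "d x = c (the_inv_into {..<q} u x)" for x
  have d: "d (u j) = c j" if "j < q" for j unfolding d_def using the_inv_into_f_f[OF assms(1)] that by simp
  have "(\<Sum>x\<in>u ` {..<q}. scale (d x) x) = (\<Sum>l<q. scale (c l) (u l))"
    using sum.reindex[OF assms(1), of "\<lambda>x. scale (d x) x"] d by simp
  then have "d (u l) = 0" using assms(2) z l independentD[of "u ` {..<q}" "u ` {..<q}" d "u l"] by auto
  then show "c l = 0" using d l by simp
qed

lemma lin_indep_le_dim: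
  assumes "fin_dim V" "lin_indep q u" "\<And>l. l < q \<Longrightarrow> u l \<in> V" shows "q \<le> dim V"
  using indep_card_le[OF assms(1) _ lin_indep_independent[OF assms(2)]] assms(3)
    card_image[OF lin_indep_inj[OF assms(2)]] by auto

lemma lin_indep_span:
  assumes "fin_dim V" "subspace V" "lin_indep q u" "\<And>l. l < q \<Longrightarrow> u l \<in> V" "q = dim V"
  shows "span (u ` {..<q}) = V"
proof (rule subspace_eq_fd)
  show "span (u ` {..<q}) \<subseteq> V" using assms by (intro span_minimal) auto
  show "dim V \<le> dim (span (u ` {..<q}))"
    using dim_span_eq_card_independent[OF lin_indep_independent[OF assms(3)]]
      card_image[OF lin_indep_inj[OF assms(3)]] assms(5) by simp
qed (use assms in auto)

lemma lin_indep_exists: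
  assumes "fin_dim S" "q \<le> dim S"
  obtains u where "lin_indep q u" "\<And>l. l < q \<Longrightarrow> u l \<in> S"
proof -
  obtain B where B: "finite B" "B \<subseteq> S" "independent B" "S \<subseteq> span B" "card B = dim S"
    using fin_dim_basis[OF assms(1)] .
  obtain C where C: "C \<subseteq> B" "card C = q" using obtain_subset_with_card_n assms(2) B(5) by metis
  then have fC: "finite C" using B finite_subset by blast
  obtain u where u: "bij_betw u {..<q} C" using ex_bij_betw_nat_finite[OF fC] C(2) by (auto simp: atLeast0LessThan)
  have "lin_indep q u" by (rule independent_lin_indep)
      (use u B C independent_mono in \<open>auto simp: bij_betw_def\<close>)
  moreover have "u l \<in> S" if "l < q" for l using u B(2) C(1) that by (auto simp: bij_betw_def)
  ultimately show ?thesis using that by blast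
qed

end

section \<open>Linear maps restricted to finite-dimensional subspaces\<close>

locale linear_space_pair = vs1: linear_space s1 + vs2: linear_space s2
  for s1 :: "'a::field \<Rightarrow> 'b::ab_group_add \<Rightarrow> 'b"
  and s2 :: "'a::field \<Rightarrow> 'c::ab_group_add \<Rightarrow> 'c"
begin

sublocale vector_space_pair s1 s2 ..


text \<open>Stated for a subspace \<open>V\<close> of the source: the maps of free modules act on
  infinite-dimensional spaces, of which only the graded pieces are finite. A basis of the kernel is
  extended to \<open>V\<close>, and \<open>f\<close> is injective on the span of the added
  vectors.\<close>

lemma rank_nullity:
  assumes f: "Vector_Spaces.linear s1 s2 f" and V: "vs1.subspace V" "vs1.fin_dim V"
  shows "vs1.dim V = vs2.dim (f ` V) + vs1.dim {v \<in> V. f v = 0}"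
proof -
  interpret f: Vector_Spaces.linear s1 s2 f by fact
  let ?K = "{v \<in> V. f v = 0}"
  have Kf: "vs1.fin_dim ?K" by (rule vs1.fin_dim_mono[OF _ V(2)]) auto
  obtain I where I: "finite I" "I \<subseteq> ?K" "vs1.independent I" "?K \<subseteq> vs1.span I" "card I = vs1.dim ?K"
    using vs1.fin_dim_basis[OF Kf] .
  obtain C where C: "I \<subseteq> C" "C \<subseteq> V" "vs1.independent C" "V \<subseteq> vs1.span C"
    using vs1.maximal_independent_subset_extend[of I V] I by blast
  have C': "finite C" "card C = vs1.dim V"
    using vs1.indep_card_le[OF V(2) C(2,3)] vs1.basis_card_eq_dim[OF C(2,4,3)] by auto
  have sC: "vs1.span C = V" using C V vs1.span_minimal by blast
  have sub: "vs1.span (C - I) \<subseteq> V" using sC vs1.span_mono by (metis Diff_subset)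
  have int: "vs1.span (C - I) \<inter> vs1.span I \<subseteq> {0}"
    by (rule vs1.independent_span_Int) (use C in \<open>auto simp: Un_absorb2\<close>)
  have inj: "inj_on f (vs1.span (C - I))"
    unfolding f.inj_on_iff_eq_0[OF vs1.subspace_span] using sub int I(4) by blast
  then have ind: "vs2.independent (f ` (C - I))"
    using linear_independent_injective_image[OF f vs1.independent_mono[OF C(3)]] by blast
  have fI: "f x = 0" if "x \<in> I" for x using that I(2) by auto
  have "f ` V = vs2.span (f ` C)" using sC linear_span_image[OF f, of C] by simp
  also have "\<dots> = vs2.span (f ` (C - I))"
  proof (rule vs2.span_eq[THEN iffD2], intro conjI)
    show "f ` C \<subseteq> vs2.span (f ` (C - I))"
    proof
      fix y assume "y \<in> f ` C"
      then obtain x where "x \<in> C" "y = f x" by blast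
      show "y \<in> vs2.span (f ` (C - I))"
      proof (cases "x \<in> I")
        case True
        then show ?thesis using fI \<open>y = f x\<close> vs2.span_zero by simp
      next
        case False
        then show ?thesis using \<open>x \<in> C\<close> \<open>y = f x\<close> by (intro vs2.span_base) blast
      qed
    qed
    show "f ` (C - I) \<subseteq> vs2.span (f ` C)" using vs2.span_superset[of "f ` C"] by blast
  qed
  finally have "vs2.dim (f ` V) = card (f ` (C - I))" using vs2.dim_span_eq_card_independent[OF ind] by simp
  also have "\<dots> = card (C - I)" by (rule card_image[OF inj_on_subset[OF inj vs1.span_superset]])
  also have "\<dots> = card C - card I" using C I by (simp add: card_Diff_subset)
  finally show ?thesis using C'(2) I(5) card_mono[OF C'(1) C(1)] by linarith
qed

lemma fin_dim_image:
  assumes "Vector_Spaces.linear s1 s2 f" "vs1.fin_dim V" shows "vs2.fin_dim (f ` V)"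
proof -
  obtain W where "finite W" "V \<subseteq> vs1.span W" using assms(2) unfolding vs1.fin_dim_def by blast
  then have "f ` V \<subseteq> vs2.span (f ` W)" using linear_span_image[OF assms(1), of W] by blast
  then show ?thesis unfolding vs2.fin_dim_def using \<open>finite W\<close> by blast
qed

lemma dim_image_inj:
  assumes "Vector_Spaces.linear s1 s2 f" "vs1.subspace V" "vs1.fin_dim V" "\<And>v. v \<in> V \<Longrightarrow> f v = 0 \<Longrightarrow> v = 0"
  shows "vs2.dim (f ` V) = vs1.dim V"
proof -
  have "{v \<in> V. f v = 0} \<subseteq> {0}" using assms(4) by blast
  then have "vs1.dim {v \<in> V. f v = 0} = 0" using vs1.dim_le_card[of _ "{}"] by auto
  then show ?thesis using rank_nullity[OF assms(1-3)] by simp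
qed

end


section \<open>The vector spaces in use, and coefficients of polynomials in x and y\<close>

definition vscale :: "'k::field \<Rightarrow> (nat \<Rightarrow> 'k bipoly) \<Rightarrow> nat \<Rightarrow> 'k bipoly" where
  "vscale c v = (\<lambda>j. kscale c (v j))"

global_interpretation bp: linear_space "kscale :: 'k::field \<Rightarrow> 'k bipoly \<Rightarrow> 'k bipoly" ..

global_interpretation fv: linear_space "vscale :: 'k::field \<Rightarrow> (nat \<Rightarrow> 'k bipoly) \<Rightarrow> nat \<Rightarrow> 'k bipoly"
  by unfold_locales (simp_all add: vscale_def fun_eq_iff bp.scale_right_distrib bp.scale_left_distrib)

global_interpretation kv: linear_space "(\<lambda>c v j. c * v j) :: 'k::field \<Rightarrow> (nat \<Rightarrow> 'k) \<Rightarrow> nat \<Rightarrow> 'k" ..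

lemma bcoeff_simps [simp]:
  "bcoeff 0 a b = 0"
  "bcoeff (f + g) a b = bcoeff f a b + bcoeff g a b"
  "bcoeff (f - g) a b = bcoeff f a b - bcoeff g a b"
  "bcoeff (- f) a b = - bcoeff f a b"
  "bcoeff (kscale c f) a b = c * bcoeff f a b"
  by (simp_all add: bcoeff_def kscale_def)

lemma bcoeff_sum: "bcoeff (\<Sum>x\<in>A. f x) a b = (\<Sum>x\<in>A. bcoeff (f x) a b)"
  by (induction A rule: infinite_finite_induct) auto

lemma bipoly_eqI: "(\<And>a b. bcoeff f a b = bcoeff g a b) \<Longrightarrow> f = g"
  by (auto simp: bcoeff_def poly_eq_iff)

lemma bcoeff_mult:
  "bcoeff (f * g) a b = (\<Sum>b'\<le>b. \<Sum>a'\<le>a. bcoeff f a' b' * bcoeff g (a - a') (b - b'))"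
  by (simp add: bcoeff_def coeff_mult Polynomial.coeff_sum)

definition bimonom :: "nat \<Rightarrow> nat \<Rightarrow> 'k::field bipoly" where
  "bimonom a b = Polynomial.monom (Polynomial.monom 1 a) b"

lemma bcoeff_bimonom [simp]: "bcoeff (bimonom p q) a b = (if p = a \<and> q = b then 1 else 0)"
  by (simp add: bcoeff_def bimonom_def)

lemma bcoeff_bimonom_mult [simp]:
  "bcoeff (bimonom p q * f) a b = (if p \<le> a \<and> q \<le> b then bcoeff f (a - p) (b - q) else 0)"
  by (auto simp: bcoeff_def bimonom_def coeff_monom_mult)

lemma bimonom_nonzero [simp]: "bimonom p q \<noteq> 0"
  by (metis bcoeff_bimonom bcoeff_simps(1) zero_neq_one)

lemma kscale_mult: "kscale c f * g = kscale c (f * g)" "f * kscale c g = kscale c (f * g)"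
  by (simp_all add: kscale_def)

lemma kscale_eq_mult: "kscale c f = kscale c 1 * f"
  by (simp add: kscale_mult)

lemma bp_subspaceI:
  assumes "0 \<in> V" "\<And>f g. f \<in> V \<Longrightarrow> g \<in> V \<Longrightarrow> f + g \<in> V" "\<And>c f. f \<in> V \<Longrightarrow> kscale c f \<in> V"
  shows "bp.subspace V"
  using assms by (auto simp: bp.subspace_def)

lemma bp_linearI:
  assumes "\<And>f g. h (f + g) = h f + h g" "\<And>c f. h (kscale c f) = kscale c (h f)"
  shows "Vector_Spaces.linear kscale kscale h"
  by (simp add: Vector_Spaces.linear_iff bp.vector_space_axioms assms)


section \<open>Forms\<close>

lemma subspace_forms: "bp.subspace (forms i)"
  by (rule bp_subspaceI) (auto simp: forms_def, metis add.right_neutral add_eq_0_iff)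

lemma formsD: "f \<in> forms i \<Longrightarrow> a + b \<noteq> i \<Longrightarrow> bcoeff f a b = 0"
  by (auto simp: forms_def)

lemma forms_mult: assumes "f \<in> forms i" "g \<in> forms j" shows "f * g \<in> forms (i + j)"
  unfolding forms_def
proof (intro CollectI allI impI)
  fix a b assume "bcoeff (f * g) a b \<noteq> 0"
  then obtain b' where b': "b' \<in> {..b}" "(\<Sum>a'\<le>a. bcoeff f a' b' * bcoeff g (a - a') (b - b')) \<noteq> 0"
    unfolding bcoeff_mult by (rule sum.not_neutral_contains_not_neutral)
  then obtain a' where "a' \<in> {..a}" "bcoeff f a' b' * bcoeff g (a - a') (b - b') \<noteq> 0"
    by (meson sum.not_neutral_contains_not_neutral)
  with b'(1) assms show "a + b = i + j" by (fastforce simp: forms_def)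
qed

lemma bimonom_forms: "p + q = i \<Longrightarrow> bimonom p q \<in> forms i"
  by (auto simp: forms_def split: if_splits)

lemma kscale_one_forms: "kscale c 1 \<in> forms 0"
  by (auto simp: forms_def kscale_def bcoeff_def one_pCons coeff_pCons split: nat.splits)

lemma forms_expand:
  assumes "f \<in> forms i" shows "f = (\<Sum>b\<le>i. kscale (bcoeff f (i - b) b) (bimonom (i - b) b))"
proof (rule bipoly_eqI)
  fix a b
  have "bcoeff (\<Sum>b\<le>i. kscale (bcoeff f (i - b) b) (bimonom (i - b) b)) a b
      = (\<Sum>b'\<le>i. if b' = b then (if i - b = a then bcoeff f a b else 0) else 0)"
    unfolding bcoeff_sum by (rule sum.cong) auto
  also have "\<dots> = bcoeff f a b" using formsD[OF assms, of a b] by auto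
  finally show "bcoeff f a b = bcoeff (\<Sum>b\<le>i. kscale (bcoeff f (i - b) b) (bimonom (i - b) b)) a b" ..
qed

lemma fin_dim_forms: "bp.fin_dim (forms i)"
  unfolding bp.fin_dim_def
proof (intro exI conjI subsetI)
  show "finite ((\<lambda>b. bimonom (i - b) b :: 'a bipoly) ` {..i})" by simp
  fix f :: "'a bipoly" assume "f \<in> forms i"
  from forms_expand[OF this] show "f \<in> bp.span ((\<lambda>b. bimonom (i - b) b) ` {..i})"
    by (metis (no_types, lifting) bp.span_sum bp.span_scale bp.span_base imageI)
qed

lemma bcoeff_hom_part [simp]: "bcoeff (hom_part i f) a b = (if a + b = i then bcoeff f a b else 0)"
proof -
  have "bcoeff (hom_part i f) a b = (\<Sum>b'\<le>i. if b' = b then (if i - b = a then bcoeff f a b else 0) else 0)"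
    unfolding hom_part_def bcoeff_sum by (rule sum.cong) (auto simp: bcoeff_def)
  also have "\<dots> = (if a + b = i then bcoeff f a b else 0)" by auto
  finally show ?thesis .
qed

lemma hom_part_forms: "hom_part i f \<in> forms i"
  by (auto simp: forms_def split: if_splits)

lemma hom_part_of_form: "f \<in> forms j \<Longrightarrow> hom_part i f = (if i = j then f else 0)"
  by (rule bipoly_eqI) (auto dest: formsD)

lemma hom_part_add: "hom_part i (f + g) = hom_part i f + hom_part i g"
  by (rule bipoly_eqI) simp

lemma hom_part_zero [simp]: "hom_part i 0 = 0"
  by (rule bipoly_eqI) simp

lemma hom_part_kscale: "hom_part i (kscale c f) = kscale c (hom_part i f)"
  by (rule bipoly_eqI) simp

lemma hom_part_sum: "hom_part i (\<Sum>x\<in>A. f x) = (\<Sum>x\<in>A. hom_part i (f x))"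
  by (induction A rule: infinite_finite_induct) (auto simp: hom_part_add)

lemma hom_part_mult_form:
  assumes g: "g \<in> forms d"
  shows "hom_part i (f * g) = (if d \<le> i then hom_part (i - d) f * g else 0)"
proof (rule bipoly_eqI)
  fix a b
  show "bcoeff (hom_part i (f * g)) a b = bcoeff (if d \<le> i then hom_part (i - d) f * g else 0) a b"
  proof (cases "a + b = i \<and> d \<le> i")
    case True
    have "bcoeff f a' b' * bcoeff g (a - a') (b - b') = bcoeff (hom_part (i - d) f) a' b' * bcoeff g (a - a') (b - b')"
      if "a' \<le> a" "b' \<le> b" for a' b'
      using formsD[OF g, of "a - a'" "b - b'"] that True by auto
    then show ?thesis using True by (auto simp: bcoeff_mult intro!: sum.cong)
  next
    case False
    show ?thesis
    proof (cases "d \<le> i")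
      case True
      then have "hom_part (i - d) f * g \<in> forms i" using forms_mult[OF hom_part_forms g, of "i - d" f] by simp
      then show ?thesis using False True formsD by auto
    next
      case d: False
      have "bcoeff g (a - a') (b - b') = 0" if "a + b = i" for a' b'
        by (rule formsD[OF g]) (use that d in auto)
      then show ?thesis using d by (auto simp: bcoeff_mult)
    qed
  qed
qed

text \<open>Any bound beyond the total degree works; the form for all large \<open>n\<close> lets
  finitely many polynomials share one bound.\<close>

lemma hom_part_decomp: "\<exists>B. \<forall>n\<ge>B. f = (\<Sum>i<n. hom_part i f)"
proof -
  let ?da = "Max ((\<lambda>b. Polynomial.degree (Polynomial.coeff f b)) ` {..Polynomial.degree f})"
  have "a + b \<le> ?da + Polynomial.degree f" if "bcoeff f a b \<noteq> 0" for a b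
  proof -
    have b: "b \<le> Polynomial.degree f" using that unfolding bcoeff_def by (metis coeff_0 le_degree)
    have "a \<le> Polynomial.degree (Polynomial.coeff f b)" using that unfolding bcoeff_def by (rule le_degree)
    also have "\<dots> \<le> ?da" using b by (intro Max_ge) auto
    finally show ?thesis using b by simp
  qed
  then have "f = (\<Sum>i<n. hom_part i f)" if "n \<ge> Suc (?da + Polynomial.degree f)" for n
  proof -
    have "bcoeff f a b = (\<Sum>i<n. if i = a + b then bcoeff f a b else 0)" for a b
      using that \<open>\<And>a b. bcoeff f a b \<noteq> 0 \<Longrightarrow> a + b \<le> ?da + Polynomial.degree f\<close>[of a b]
      by (cases "bcoeff f a b = 0") auto
    moreover have "bcoeff (\<Sum>i<n. hom_part i f) a b = (\<Sum>i<n. if i = a + b then bcoeff f a b else 0)" for a b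
      unfolding bcoeff_sum by (rule sum.cong) auto
    ultimately show ?thesis by (metis bipoly_eqI)
  qed
  then show ?thesis by blast
qed

text \<open>\<open>degree\<close> is the degree in y, the outer variable: a nonzero form of degree i
  and y-degree d is led by a scalar multiple of x^(i-d) y^d.\<close>

lemma form_degree:
  assumes "f \<in> forms i" "f \<noteq> 0"
  shows "Polynomial.degree f \<le> i" "bcoeff f (i - Polynomial.degree f) (Polynomial.degree f) \<noteq> 0"
proof -
  have "Polynomial.coeff f (Polynomial.degree f) \<noteq> 0" using assms(2) by simp
  then obtain a where "bcoeff f a (Polynomial.degree f) \<noteq> 0"
    unfolding bcoeff_def by (metis leading_coeff_0_iff)
  moreover then have "a + Polynomial.degree f = i" using assms(1) by (auto simp: forms_def)
  ultimately show "Polynomial.degree f \<le> i" "bcoeff f (i - Polynomial.degree f) (Polynomial.degree f) \<noteq> 0" by auto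
qed

lemma bcoeff_above_degree: "Polynomial.degree f < b \<Longrightarrow> bcoeff f a b = 0"
  by (simp add: bcoeff_def coeff_eq_0)

lemma form_degree_less:
  assumes "f \<in> forms i" "\<And>b. b \<ge> d \<Longrightarrow> bcoeff f (i - b) b = 0" "f \<noteq> 0"
  shows "Polynomial.degree f < d"
  using form_degree[OF assms(1,3)] assms(2) by (meson not_le)

text \<open>Gaussian elimination: members of \<open>V\<close> of equal y-degree have proportional
  leading terms, so one member for each occurring y-degree gives a basis.\<close>

lemma dim_eq_card_degrees:
  assumes V: "bp.subspace V" "V \<subseteq> forms i"
  shows "bp.dim V = card (Polynomial.degree ` (V - {0}))"
proof -
  let ?D = "Polynomial.degree ` (V - {0})"
  have D: "finite ?D" by (rule finite_subset[of _ "{..i}"]) (use V form_degree in auto)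
  have "\<forall>d\<in>?D. \<exists>v. v \<in> V - {0} \<and> Polynomial.degree v = d" by auto
  then obtain v where v: "\<And>d. d \<in> ?D \<Longrightarrow> v d \<in> V - {0} \<and> Polynomial.degree (v d) = d" by metis
  have inj: "inj_on v ?D" by (metis inj_onI v)
  have lc: "bcoeff (v d) (i - d) d \<noteq> 0" if "d \<in> ?D" for d
    using form_degree(2)[of "v d" i] v[OF that] V(2) by auto
  have ind: "bp.independent (v ` ?D)"
  proof (rule bp.independent_if_scalars_zero)
    fix c x assume z: "(\<Sum>x\<in>v ` ?D. kscale (c x) x) = 0" and x: "x \<in> v ` ?D"
    show "c x = 0"
    proof (rule ccontr)
      assume nz: "c x \<noteq> 0"
      let ?E = "{d \<in> ?D. c (v d) \<noteq> 0}"
      have E: "finite ?E" "?E \<noteq> {}" using D x nz by auto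
      \<comment> \<open>At the largest y-degree that carries a nonzero scalar, only one summand
        contributes to the leading coefficient.\<close>
      define d0 where "d0 = Max ?E"
      have d0: "d0 \<in> ?E" using Max_in[OF E] by (simp add: d0_def)
      have "0 = bcoeff (\<Sum>d\<in>?D. kscale (c (v d)) (v d)) (i - d0) d0"
        using z sum.reindex[OF inj, of "\<lambda>x. kscale (c x) x"] by (simp add: o_def)
      also have "\<dots> = (\<Sum>d\<in>?D. c (v d) * bcoeff (v d) (i - d0) d0)" by (simp add: bcoeff_sum)
      also have "\<dots> = (\<Sum>d\<in>{d0}. c (v d) * bcoeff (v d) (i - d0) d0)"
      proof (rule sum.mono_neutral_right[OF D])
        show "\<forall>d\<in>?D - {d0}. c (v d) * bcoeff (v d) (i - d0) d0 = 0"
        proof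
          fix d assume d: "d \<in> ?D - {d0}"
          show "c (v d) * bcoeff (v d) (i - d0) d0 = 0"
          proof (cases "c (v d) = 0")
            case False
            then have "d \<le> d0" using d E Max_ge by (simp add: d0_def)
            then have "Polynomial.degree (v d) < d0" using d v by auto
            then show ?thesis by (simp add: bcoeff_above_degree)
          qed simp
        qed
      qed (use d0 in auto)
      also have "\<dots> \<noteq> 0" using d0 lc by simp
      finally show False by simp
    qed
  qed (use D in simp)
  have sp: "f = 0 \<or> Polynomial.degree f < n \<Longrightarrow> f \<in> V \<Longrightarrow> f \<in> bp.span (v ` ?D)" for n f
  proof (induction n arbitrary: f)
    case (Suc n)
    show ?case
    proof (cases "f = 0")
      case False
      let ?d = "Polynomial.degree f"
      have d: "?d \<in> ?D" using False Suc.prems by auto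
      \<comment> \<open>The scalar that cancels the leading term, so that \<open>g\<close> is 0 or
        has smaller y-degree.\<close>
      define c where "c = bcoeff f (i - ?d) ?d / bcoeff (v ?d) (i - ?d) ?d"
      define g where "g = f - kscale c (v ?d)"
      have gV: "g \<in> V" unfolding g_def using Suc.prems v[OF d] V(1) by (simp add: bp.subspace_diff bp.subspace_scale)
      have "bcoeff g (i - b) b = 0" if "b \<ge> ?d" for b
        using lc[OF d] bcoeff_above_degree[of f b] bcoeff_above_degree[of "v ?d" b] v[OF d] that
        by (cases "b = ?d") (auto simp: g_def c_def)
      then have "g = 0 \<or> Polynomial.degree g < ?d" using form_degree_less[of g i ?d] gV V(2) by blast
      then have "g \<in> bp.span (v ` ?D)" using Suc.IH[of g] gV Suc.prems False by auto
      moreover have "f = g + kscale c (v ?d)" by (simp add: g_def)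
      ultimately show ?thesis using d by (metis bp.span_add bp.span_scale bp.span_base imageI)
    qed (simp add: bp.span_zero)
  qed (simp add: bp.span_zero)
  have "bp.dim V = card (v ` ?D)"
    by (rule bp.basis_card_eq_dim[symmetric]) (use v sp ind in \<open>auto intro: lessI\<close>)
  then show ?thesis by (simp add: card_image[OF inj])
qed

lemma dim_forms: "bp.dim (forms i :: 'k::field bipoly set) = Suc i"
proof -
  have "Polynomial.degree ` (forms i - {0 :: 'k bipoly}) = {..i}"
  proof
    show "Polynomial.degree ` (forms i - {0 :: 'k bipoly}) \<subseteq> {..i}" using form_degree by auto
    show "{..i} \<subseteq> Polynomial.degree ` (forms i - {0 :: 'k bipoly})"
    proof
      fix b assume "b \<in> {..i}"
      then have "bimonom (i - b) b \<in> forms i - {0 :: 'k bipoly}" by (simp add: bimonom_forms)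
      moreover have "Polynomial.degree (bimonom (i - b) b :: 'k bipoly) = b" by (simp add: bimonom_def degree_monom_eq)
      ultimately show "b \<in> Polynomial.degree ` (forms i - {0 :: 'k bipoly})" by force
    qed
  qed
  then show ?thesis by (subst dim_eq_card_degrees[OF subspace_forms order_refl]) simp
qed

text \<open>The translates Min A + B and A + Max B both lie in the sumset and meet only in Min A +
  Max B.\<close>

lemma card_sumset:
  fixes A B :: "nat set"
  assumes "finite A" "finite B" "A \<noteq> {}" "B \<noteq> {}" "finite C" "\<And>a b. a \<in> A \<Longrightarrow> b \<in> B \<Longrightarrow> a + b \<in> C"
  shows "card A + card B \<le> Suc (card C)"
proof -
  let ?L = "(+) (Min A) ` B" and ?R = "(\<lambda>a. a + Max B) ` A"
  have "?L \<inter> ?R \<subseteq> {Min A + Max B}"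
  proof
    fix x assume "x \<in> ?L \<inter> ?R"
    then obtain a b where "a \<in> A" "b \<in> B" "x = Min A + b" "x = a + Max B" by blast
    moreover have "Min A \<le> a" "b \<le> Max B" using calculation assms(1,2) by simp_all
    ultimately show "x \<in> {Min A + Max B}" by simp
  qed
  then have "card (?L \<inter> ?R) \<le> 1" using card_mono[of "{Min A + Max B}" "?L \<inter> ?R"] by simp
  moreover have sub: "?L \<union> ?R \<subseteq> C" using assms(6) Min_in[OF assms(1,3)] Max_in[OF assms(2,4)] by blast
  moreover have "card (?L \<union> ?R) \<le> card C"
    by (rule card_mono[OF assms(5) sub])
  moreover have "card ?L = card B" "card ?R = card A" by (auto intro!: card_image)
  moreover have "card ?L + card ?R = card (?L \<union> ?R) + card (?L \<inter> ?R)" by (rule card_Un_Int) (use assms in auto)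
  ultimately show ?thesis by simp
qed

text \<open>Hopf's inequality, read off the sets of \<open>y\<close>-degrees.\<close>

lemma dim_product_ge:
  assumes V: "bp.subspace V" "V \<subseteq> forms i" "V \<noteq> {0}"
    and W: "bp.subspace W" "W \<subseteq> forms j" "W \<noteq> {0}"
    and P: "bp.subspace P" "P \<subseteq> forms l" "\<And>v w. v \<in> V \<Longrightarrow> w \<in> W \<Longrightarrow> v * w \<in> P"
  shows "bp.dim V + bp.dim W \<le> Suc (bp.dim P)"
proof -
  have fin: "finite (Polynomial.degree ` (U - {0 :: 'a bipoly}))" if "U \<subseteq> forms m" for U m
    by (rule finite_subset[of _ "{..m}"]) (use that form_degree in auto)
  have ne: "Polynomial.degree ` (U - {0 :: 'a bipoly}) \<noteq> {}" if "bp.subspace U" "U \<noteq> {0}" for U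
    using that bp.subspace_0 by blast
  show ?thesis
    unfolding dim_eq_card_degrees[OF V(1,2)] dim_eq_card_degrees[OF W(1,2)] dim_eq_card_degrees[OF P(1,2)]
  proof (rule card_sumset)
    fix a b assume "a \<in> Polynomial.degree ` (V - {0})" "b \<in> Polynomial.degree ` (W - {0})"
    then obtain v w where "v \<in> V - {0}" "w \<in> W - {0}" "a = Polynomial.degree v" "b = Polynomial.degree w" by auto
    then show "a + b \<in> Polynomial.degree ` (P - {0})"
      using P(3) degree_mult_eq[of v w] by (auto intro!: image_eqI[of _ _ "v * w"])
  qed (use fin ne V W P in blast)+
qed


section \<open>Graded pieces of free modules\<close>

text \<open>The degree-i piece of R(-d); the case distinction keeps the truncated difference
  \<open>i - d\<close> from producing constants when d > i.\<close>

definition shifted_forms :: "nat \<Rightarrow> nat \<Rightarrow> 'k::field bipoly set" where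
  "shifted_forms d i = (if d \<le> i then forms (i - d) else {0})"

definition free_part :: "nat list \<Rightarrow> nat \<Rightarrow> (nat \<Rightarrow> 'k::field bipoly) set" where
  "free_part ds i = {v. (\<forall>j<length ds. v j \<in> shifted_forms (ds ! j) i) \<and> (\<forall>j\<ge>length ds. v j = 0)}"

text \<open>A homomorphism of degree 0 from the free module with generator degrees \<open>es\<close>
  to the one with generator degrees \<open>ds\<close>.\<close>

definition hom_matrix :: "nat list \<Rightarrow> nat list \<Rightarrow> (nat \<Rightarrow> nat \<Rightarrow> 'k::field bipoly) \<Rightarrow> bool" where
  "hom_matrix ds es A \<longleftrightarrow> (\<forall>r<length ds. \<forall>c<length es. A r c \<in> shifted_forms (ds ! r) (es ! c))"

definition smul :: "'k::field bipoly \<Rightarrow> (nat \<Rightarrow> 'k bipoly) \<Rightarrow> nat \<Rightarrow> 'k bipoly" where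
  "smul p v = (\<lambda>j. p * v j)"

text \<open>R_1 V for a subspace V of a free module: since x and y span R_1, the sums xa + yb
  already form a subspace.\<close>

definition R1v :: "(nat \<Rightarrow> 'k::field bipoly) set \<Rightarrow> (nat \<Rightarrow> 'k bipoly) set" where
  "R1v V = {smul (bimonom 1 0) a + smul (bimonom 0 1) b | a b. a \<in> V \<and> b \<in> V}"

text \<open>The piece of degree i - 1, taken to be zero below degree 0, so that formulas hold
  uniformly at i = 0.\<close>

definition prev_part :: "(nat \<Rightarrow> 'a::zero set) \<Rightarrow> nat \<Rightarrow> 'a set" where
  "prev_part M i = (case i of 0 \<Rightarrow> {0} | Suc j \<Rightarrow> M j)"

definition tensor_part :: "nat list \<Rightarrow> nat \<Rightarrow> (nat \<Rightarrow> 'k::field) set" where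
  "tensor_part ds i = {u \<in> free_vecs (length ds). \<forall>j<length ds. u j \<noteq> 0 \<longrightarrow> ds ! j = i}"

definition const_terms :: "(nat \<Rightarrow> 'k::field bipoly) \<Rightarrow> nat \<Rightarrow> 'k" where
  "const_terms v = (\<lambda>j. bcoeff (v j) 0 0)"

text \<open>The degree-i component for the grading in which the j-th basis vector has degree
  \<open>ds ! j\<close>.\<close>

definition hom_comp :: "nat list \<Rightarrow> nat \<Rightarrow> (nat \<Rightarrow> 'k::field bipoly) \<Rightarrow> nat \<Rightarrow> 'k bipoly" where
  "hom_comp ds i v = (\<lambda>j. if j < length ds \<and> ds ! j \<le> i then hom_part (i - ds ! j) (v j) else 0)"

lemma prev_part_simps [simp]: "prev_part M 0 = {0}" "prev_part M (Suc i) = M i"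
  by (simp_all add: prev_part_def)

lemma zero_forms [simp]: "0 \<in> forms i"
  by (simp add: forms_def)

lemma dim_zero_space [simp]: "bp.dim {0} = 0" "fv.dim {0} = 0" "kv.dim {0} = 0"
  using bp.dim_eq_0_fd[OF bp.fin_dim_span_finite[of "{}"]] fv.dim_eq_0_fd[OF fv.fin_dim_span_finite[of "{}"]]
    kv.dim_eq_0_fd[OF kv.fin_dim_span_finite[of "{}"]] by simp_all

lemma subspace_shifted_forms: "bp.subspace (shifted_forms d i)"
  by (simp add: shifted_forms_def subspace_forms bp.subspace_single_0)

lemma fin_dim_shifted_forms: "bp.fin_dim (shifted_forms d i :: 'k::field bipoly set)"
  using bp.fin_dim_span_finite[of "{} :: 'k bipoly set"] by (simp add: shifted_forms_def fin_dim_forms)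

lemma dim_shifted_forms: "bp.dim (shifted_forms d i :: 'k::field bipoly set) = Suc i - d"
  using bp.dim_le_card[of "{0 :: 'k bipoly}" "{}"] by (auto simp: shifted_forms_def dim_forms)

lemma zero_shifted_forms [simp]: "0 \<in> shifted_forms d i"
  by (rule bp.subspace_0[OF subspace_shifted_forms])

lemma shifted_forms_mult:
  assumes "p \<in> shifted_forms d e" "q \<in> shifted_forms e i" shows "p * q \<in> shifted_forms d i"
proof (cases "d \<le> e \<and> e \<le> i")
  case True
  then show ?thesis using forms_mult[of p "e - d" q "i - e"] assms by (simp add: shifted_forms_def)
next
  case False
  then have "p * q = 0" using assms by (auto simp: shifted_forms_def split: if_splits)
  then show ?thesis by (simp del: mult_eq_0_iff)
qed

lemma shifted_forms_mult_form:
  assumes "p \<in> forms k" "q \<in> shifted_forms d i" shows "p * q \<in> shifted_forms d (i + k)"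
  using forms_mult[of p k q "i - d"] assms by (auto simp: shifted_forms_def add.commute split: if_splits)

lemma fv_subspaceI:
  assumes "0 \<in> V" "\<And>f g. f \<in> V \<Longrightarrow> g \<in> V \<Longrightarrow> f + g \<in> V" "\<And>c f. f \<in> V \<Longrightarrow> vscale c f \<in> V"
  shows "fv.subspace V"
  using assms by (auto simp: fv.subspace_def)

lemma free_part_zero [simp]: "0 \<in> free_part ds i"
  by (simp add: free_part_def)

lemma subspace_free_part: "fv.subspace (free_part ds i)"
  by (rule fv_subspaceI)
    (auto simp: free_part_def vscale_def intro: bp.subspace_add[OF subspace_shifted_forms] bp.subspace_scale[OF subspace_shifted_forms])

global_interpretation fb: linear_space_pair "vscale :: 'k::field \<Rightarrow> _" "kscale :: 'k \<Rightarrow> _" ..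
global_interpretation ff: linear_space_pair "vscale :: 'k::field \<Rightarrow> _" "vscale :: 'k \<Rightarrow> _" ..
global_interpretation bf: linear_space_pair "kscale :: 'k::field \<Rightarrow> _" "vscale :: 'k \<Rightarrow> _" ..
global_interpretation bb: linear_space_pair "kscale :: 'k::field \<Rightarrow> _" "kscale :: 'k \<Rightarrow> _" ..
global_interpretation fk: linear_space_pair "vscale :: 'k::field \<Rightarrow> _" "(\<lambda>c v j. c * v j) :: 'k \<Rightarrow> (nat \<Rightarrow> 'k) \<Rightarrow> _" ..
global_interpretation kk: linear_space_pair "(\<lambda>c v j. c * v j) :: 'k::field \<Rightarrow> (nat \<Rightarrow> 'k) \<Rightarrow> _" "(\<lambda>c v j. c * v j) :: 'k \<Rightarrow> (nat \<Rightarrow> 'k) \<Rightarrow> _" ..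

lemmas lin_iff = Vector_Spaces.linear_iff bp.vector_space_axioms fv.vector_space_axioms kv.vector_space_axioms

lemma linear_proj: "Vector_Spaces.linear vscale kscale (\<lambda>v. v n)"
  by (simp add: lin_iff vscale_def)

text \<open>The kernel of the last coordinate: pieces of free modules are measured by induction on
  the rank.\<close>

lemma free_part_snoc:
  "{v \<in> free_part (ds @ [d]) i. v (length ds) = 0} = free_part ds i"
  by (auto simp: free_part_def nth_append) (metis le_neq_implies_less Suc_leI nat_neq_iff)+

lemma free_part_snoc_image: "(\<lambda>v. v (length ds)) ` free_part (ds @ [d]) i = shifted_forms d i"
proof
  show "shifted_forms d i \<subseteq> (\<lambda>v. v (length ds)) ` free_part (ds @ [d]) i"
  proof
    fix f assume "f \<in> shifted_forms d i"
    then have "(\<lambda>j. if j = length ds then f else 0) \<in> free_part (ds @ [d]) i"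
      by (auto simp: free_part_def nth_append)
    then show "f \<in> (\<lambda>v. v (length ds)) ` free_part (ds @ [d]) i" by (rule image_eqI[rotated]) simp
  qed
qed (auto simp: free_part_def nth_append)

lemma free_part_split:
  assumes "v \<in> free_part (ds @ [d]) i"
  shows "\<exists>w\<in>free_part ds i. \<exists>f\<in>shifted_forms d i. v = w + (\<lambda>j. if j = length ds then f else 0)"
proof (intro bexI)
  show "v = (\<lambda>j. if j < length ds then v j else 0) + (\<lambda>j. if j = length ds then v (length ds) else 0)"
    using assms by (auto simp: free_part_def fun_eq_iff)
  show "v (length ds) \<in> shifted_forms d i" using assms by (auto simp: free_part_def nth_append)
  have "v j \<in> shifted_forms (ds ! j) i" if "j < length ds" for j
    using assms that unfolding free_part_def by (auto simp: nth_append dest!: spec[of _ j])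
  then show "(\<lambda>j. if j < length ds then v j else 0) \<in> free_part ds i" by (auto simp: free_part_def)
qed

lemma fin_dim_free_part: "fv.fin_dim (free_part ds i :: (nat \<Rightarrow> 'k::field bipoly) set)"
proof (induction ds rule: rev_induct)
  case Nil
  have "free_part [] i \<subseteq> fv.span ({} :: (nat \<Rightarrow> 'k bipoly) set)" by (auto simp: free_part_def)
  then show ?case unfolding fv.fin_dim_def by (metis finite.emptyI)
next
  case (snoc d ds)
  let ?e = "\<lambda>f :: 'k bipoly. (\<lambda>j. if j = length ds then f else 0)"
  have le: "Vector_Spaces.linear kscale vscale ?e" by (auto simp: lin_iff vscale_def fun_eq_iff)
  obtain W1 :: "(nat \<Rightarrow> 'k bipoly) set" where W1: "finite W1" "free_part ds i \<subseteq> fv.span W1" using snoc unfolding fv.fin_dim_def by blast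
  obtain W2 where W2: "finite W2" "?e ` shifted_forms d i \<subseteq> fv.span W2"
    using bf.fin_dim_image[OF le fin_dim_shifted_forms] unfolding fv.fin_dim_def by blast
  have "free_part (ds @ [d]) i \<subseteq> fv.span (W1 \<union> W2)"
  proof
    fix v :: "nat \<Rightarrow> 'k bipoly" assume "v \<in> free_part (ds @ [d]) i"
    from free_part_split[OF this] obtain w f where wf: "w \<in> free_part ds i" "f \<in> shifted_forms d i" "v = w + ?e f" by blast
    then have "w \<in> fv.span W1" "?e f \<in> fv.span W2" using W1 W2 by blast+
    then show "v \<in> fv.span (W1 \<union> W2)" unfolding wf(3)
      by (meson fv.span_add fv.span_mono sup_ge1 sup_ge2 subsetD)
  qed
  then show ?case unfolding fv.fin_dim_def using W1 W2 by (metis finite_Un)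
qed

lemma dim_free_part: "fv.dim (free_part ds i :: (nat \<Rightarrow> 'k::field bipoly) set) = (\<Sum>d\<leftarrow>ds. Suc i - d)"
proof (induction ds rule: rev_induct)
  case Nil
  have "free_part [] i \<subseteq> {0 :: nat \<Rightarrow> 'k bipoly}" by (auto simp: free_part_def)
  then show ?case using fv.dim_le_card[of "free_part [] i" "{}"] by auto
next
  case (snoc d ds)
  show ?case
    by (subst fb.rank_nullity[OF linear_proj subspace_free_part fin_dim_free_part, of _ _ "length ds"])
      (simp add: free_part_snoc free_part_snoc_image dim_shifted_forms snoc)
qed

text \<open>The truncated \<open>Suc i - d\<close> is dim R(-d)_i, and its second difference in i is
  1 at i = d and 0 elsewhere; so the dimensions of the pieces of a free module recover its generator
  degrees.\<close>

lemma sum_list_second_diff: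
  "int (\<Sum>d\<leftarrow>ds. Suc i - d) - 2 * int (\<Sum>d\<leftarrow>ds. i - d) + int (\<Sum>d\<leftarrow>ds. i - 1 - d) = int (count_list ds i)"
  by (induction ds) auto

lemma dim_prev_part_free_part: "fv.dim (prev_part (free_part ds) i :: (nat \<Rightarrow> 'k::field bipoly) set) = (\<Sum>d\<leftarrow>ds. i - d)"
  by (cases i) (auto simp: dim_free_part)

lemma dim_prev_part_prev_part_free_part: "fv.dim (prev_part (prev_part (free_part ds)) i :: (nat \<Rightarrow> 'k::field bipoly) set) = (\<Sum>d\<leftarrow>ds. i - 1 - d)"
  by (cases i) (auto simp: dim_prev_part_free_part)


section \<open>Multiplication by linear forms\<close>

lemma smul_simps [simp]:
  "smul p 0 = 0" "smul p (v + w) = smul p v + smul p w" "smul p (v - w) = smul p v - smul p w"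
  "smul p (vscale c v) = vscale c (smul p v)" "smul p (smul q v) = smul (p * q) v"
  by (auto simp: smul_def vscale_def fun_eq_iff algebra_simps kscale_mult)

lemma linear_smul: "Vector_Spaces.linear vscale vscale (smul p)"
  by (simp add: lin_iff)

lemma smul_eq_0: "p \<noteq> 0 \<Longrightarrow> smul p v = 0 \<longleftrightarrow> v = 0"
  by (auto simp: smul_def fun_eq_iff)

lemma smul_free_part: "p \<in> forms k \<Longrightarrow> v \<in> free_part ds i \<Longrightarrow> smul p v \<in> free_part ds (i + k)"
  by (auto simp: free_part_def smul_def shifted_forms_mult_form)

lemma bimonom_10_forms: "bimonom (Suc 0) 0 \<in> forms (Suc 0)" and bimonom_01_forms: "bimonom 0 (Suc 0) \<in> forms (Suc 0)"
  by (auto intro: bimonom_forms)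

lemma R1v_as_sums:
  "R1v V = {x + y | x y. x \<in> smul (bimonom 1 0) ` V \<and> y \<in> smul (bimonom 0 1) ` V}"
  by (auto simp: R1v_def)

lemma subspace_R1v: "fv.subspace V \<Longrightarrow> fv.subspace (R1v V)"
  unfolding R1v_as_sums by (intro fv.subspace_sums ff.linear_subspace_image[OF linear_smul])

lemma fin_dim_R1v:
  assumes "fv.fin_dim (V :: (nat \<Rightarrow> 'k::field bipoly) set)" shows "fv.fin_dim (R1v V)"
proof -
  have "fv.fin_dim (smul p ` V)" for p by (rule ff.fin_dim_image[OF linear_smul assms])
  then have "\<forall>p. \<exists>W. finite W \<and> smul p ` V \<subseteq> fv.span W" unfolding fv.fin_dim_def by simp
  then obtain W where W: "\<And>p. finite (W p) \<and> smul p ` V \<subseteq> fv.span (W p)" by metis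
  have "R1v V \<subseteq> fv.span (W (bimonom 1 0) \<union> W (bimonom 0 1))"
  proof
    fix v assume "v \<in> R1v V"
    then obtain x y where "x \<in> smul (bimonom 1 0) ` V" "y \<in> smul (bimonom 0 1) ` V" "v = x + y"
      unfolding R1v_as_sums by blast
    then have "v = x + y" "x \<in> fv.span (W (bimonom 1 0))" "y \<in> fv.span (W (bimonom 0 1))" using W by blast+
    then show "v \<in> fv.span (W (bimonom 1 0) \<union> W (bimonom 0 1))" unfolding fv.span_Un by blast
  qed
  moreover have "finite (W (bimonom 1 0) \<union> W (bimonom 0 1))" using W by blast
  ultimately show ?thesis unfolding fv.fin_dim_def by blast
qed

lemma R1v_zero [simp]: "R1v {0} = {0}"
  by (auto simp: R1v_def)

text \<open>Grassmann's formula for xV + yV: both summands have the dimension of V, and their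
  intersection contains xyV', with equality when every solution of xa = yb in V has a in
  yV'.\<close>

lemma dim_R1v:
  assumes V: "fv.subspace V" "fv.fin_dim V" and V': "fv.subspace V'" "fv.fin_dim V'"
    and sub: "smul (bimonom 1 0) ` V' \<subseteq> V" "smul (bimonom 0 1) ` V' \<subseteq> V"
  shows dim_R1v_le: "fv.dim (R1v V) + fv.dim V' \<le> 2 * fv.dim V"
    and dim_R1v_eq: "(\<And>a b. a \<in> V \<Longrightarrow> b \<in> V \<Longrightarrow> smul (bimonom 1 0) a = smul (bimonom 0 1) b \<Longrightarrow> \<exists>c\<in>V'. a = smul (bimonom 0 1) c)
      \<Longrightarrow> fv.dim (R1v V) + fv.dim V' = 2 * fv.dim V"
proof -
  let ?X = "smul (bimonom 1 0) :: _ \<Rightarrow> nat \<Rightarrow> 'a bipoly" and ?Y = "smul (bimonom 0 1) :: _ \<Rightarrow> nat \<Rightarrow> 'a bipoly"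
  have d: "fv.dim (smul p ` U) = fv.dim U" if "fv.subspace U" "fv.fin_dim U" "p \<noteq> 0" for p and U :: "(nat \<Rightarrow> 'a bipoly) set"
    by (rule ff.dim_image_inj[OF linear_smul that(1,2)]) (use smul_eq_0[OF that(3)] in auto)
  have s: "fv.dim (R1v V) + fv.dim (?X ` V \<inter> ?Y ` V) = 2 * fv.dim V"
    using fv.dim_sum_Int[of "?X ` V" "?Y ` V"] V
    by (simp add: R1v_as_sums ff.linear_subspace_image[OF linear_smul] ff.fin_dim_image[OF linear_smul] d)
  have i: "smul (bimonom 1 0 * bimonom 0 1) ` V' \<subseteq> ?X ` V \<inter> ?Y ` V"
  proof
    fix x assume "x \<in> smul (bimonom 1 0 * bimonom 0 1) ` V'"
    then obtain c where c: "c \<in> V'" "x = smul (bimonom 1 0 * bimonom 0 1) c" by blast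
    then have "x = ?X (?Y c)" "x = ?Y (?X c)" by (simp_all add: mult.commute)
    then show "x \<in> ?X ` V \<inter> ?Y ` V" using sub c(1) by blast
  qed
  have f: "fv.fin_dim (?X ` V \<inter> ?Y ` V)"
    by (rule fv.fin_dim_mono[OF Int_lower1 ff.fin_dim_image[OF linear_smul V(2)]])
  have m: "fv.dim (smul (bimonom 1 0 * bimonom 0 1) ` V') = fv.dim V'" by (rule d[OF V']) simp
  show "fv.dim (R1v V) + fv.dim V' \<le> 2 * fv.dim V"
    using s fv.dim_mono_fd[OF i f] m by simp
  assume k: "\<And>a b. a \<in> V \<Longrightarrow> b \<in> V \<Longrightarrow> ?X a = ?Y b \<Longrightarrow> \<exists>c\<in>V'. a = ?Y c"
  have "?X ` V \<inter> ?Y ` V \<subseteq> smul (bimonom 1 0 * bimonom 0 1) ` V'"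
  proof
    fix x assume "x \<in> ?X ` V \<inter> ?Y ` V"
    then obtain a b where "a \<in> V" "b \<in> V" "x = ?X a" "x = ?Y b" by auto
    moreover then obtain c where "c \<in> V'" "a = ?Y c" using k by metis
    ultimately show "x \<in> smul (bimonom 1 0 * bimonom 0 1) ` V'" by auto
  qed
  then show "fv.dim (R1v V) + fv.dim V' = 2 * fv.dim V" using s i m by (metis subset_antisym)
qed

text \<open>The Koszul relation of x and y. The y-free part of p vanishes, because its product with
  x would occur in the multiple yq of y; so y divides p, and it can be cancelled.\<close>

lemma bimonom_syzygy:
  assumes "bimonom 1 0 * p = bimonom 0 1 * (q :: 'k::field bipoly)"
  shows "\<exists>c. p = bimonom 0 1 * c \<and> q = bimonom 1 0 * c"
proof -
  have e: "bcoeff (bimonom 1 0 * p) a b = bcoeff (bimonom 0 1 * q) a b" for a b by (simp only: assms)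
  have p0: "bcoeff p a 0 = 0" for a using e[of "Suc a" 0] by simp
  obtain c0 c where pc: "p = pCons c0 c" by (cases p) auto
  have c0: "c0 = 0" using p0 by (simp add: pc bcoeff_def poly_eq_iff)
  have Y: "bimonom 0 1 * c = pCons 0 c" by (simp add: bimonom_def monom_Suc monom_0 flip: one_pCons)
  then have "p = bimonom 0 1 * c" using pc c0 by simp
  moreover then have "bimonom 0 1 * q = bimonom 0 1 * (bimonom 1 0 * c)" using assms by (simp add: mult.left_commute)
  then have "q = bimonom 1 0 * c" by simp
  ultimately show ?thesis by blast
qed

lemma shifted_forms_bimonom_cancel: "bimonom 0 1 * c \<in> shifted_forms d (Suc i) \<Longrightarrow> c \<in> shifted_forms d i"
  and shifted_forms_bimonom_cancel_0: "bimonom 0 1 * c \<in> shifted_forms d 0 \<Longrightarrow> c = 0"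
proof -
  have b: "bcoeff (bimonom 0 1 * c) a (Suc b) = bcoeff c a b" for a b by simp
  show "c \<in> shifted_forms d i" if m: "bimonom 0 1 * c \<in> shifted_forms d (Suc i)"
  proof (cases "d \<le> i")
    case True
    then have "bimonom 0 1 * c \<in> forms (Suc (i - d))" using m by (simp add: shifted_forms_def Suc_diff_le)
    then have "a + b = i - d" if "bcoeff c a b \<noteq> 0" for a b
      using formsD[of "bimonom 0 1 * c" "Suc (i - d)" a "Suc b"] that by (auto simp: b)
    then show ?thesis using True by (auto simp: shifted_forms_def forms_def)
  next
    case False
    then have "bimonom 0 1 * c \<in> forms 0 \<or> bimonom 0 1 * c = 0" using m by (auto simp: shifted_forms_def split: if_splits)
    then have "bcoeff c a b = 0" for a b
      using formsD[of "bimonom 0 1 * c" 0 a "Suc b"] by (auto simp: b)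
    then have "c = 0" by (intro bipoly_eqI) simp
    then show ?thesis by simp
  qed
  show "c = 0" if m: "bimonom 0 1 * c \<in> shifted_forms d 0"
  proof (rule bipoly_eqI)
    fix a b'
    have "bimonom 0 1 * c \<in> forms 0 \<or> bimonom 0 1 * c = 0" using m by (auto simp: shifted_forms_def split: if_splits)
    then show "bcoeff c a b' = bcoeff 0 a b'"
      using formsD[of "bimonom 0 1 * c" 0 a "Suc b'"] by (auto simp: b)
  qed
qed

text \<open>The Koszul relation in every coordinate. The common factor lives in degree i - 1, which
  for i = 0 forces it to be 0.\<close>

lemma free_part_syzygy:
  assumes "a \<in> free_part ds i" "smul (bimonom 1 0) a = smul (bimonom 0 1) b"
  shows "\<exists>c\<in>prev_part (free_part ds) i. a = smul (bimonom 0 1) c \<and> b = smul (bimonom 1 0) c"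
proof -
  have "\<forall>j. \<exists>c. a j = bimonom 0 1 * c \<and> b j = bimonom 1 0 * c"
    using assms(2) bimonom_syzygy unfolding smul_def fun_eq_iff by blast
  then obtain c where c: "\<And>j. a j = bimonom 0 1 * c j \<and> b j = bimonom 1 0 * c j" by metis
  have z: "c j = 0" if "j \<ge> length ds" for j using assms(1) that c[of j] by (auto simp: free_part_def)
  have m: "bimonom 0 1 * c j \<in> shifted_forms (ds ! j) i" if "j < length ds" for j
    using assms(1) c[of j] that by (auto simp: free_part_def)
  have "c \<in> prev_part (free_part ds) i"
  proof (cases i)
    case 0
    then have "c j = 0" for j using z m shifted_forms_bimonom_cancel_0 by (cases "j < length ds") auto
    then show ?thesis using 0 by (auto simp: fun_eq_iff)
  next
    case (Suc i')
    have "c j \<in> shifted_forms (ds ! j) i'" if "j < length ds" for j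
      using m[OF that] unfolding Suc by (rule shifted_forms_bimonom_cancel)
    then show ?thesis using z Suc by (auto simp: free_part_def)
  qed
  then show ?thesis using c by (auto simp: smul_def fun_eq_iff)
qed


section \<open>Homogeneous matrices\<close>

lemma mat_app_linear: "Vector_Spaces.linear vscale vscale (mat_app m n A)"
  by (auto simp: lin_iff mat_app_def vscale_def fun_eq_iff kscale_mult distrib_left sum.distrib bp.scale_sum_right)

lemma mat_app_smul: "mat_app m n A (smul p v) = smul p (mat_app m n A v)"
  by (auto simp: mat_app_def smul_def fun_eq_iff sum_distrib_left algebra_simps)

lemma mat_app_zero [simp]: "mat_app m n A 0 = 0"
  by (auto simp: mat_app_def fun_eq_iff)

lemma mat_app_add: "mat_app m n A (v + w) = mat_app m n A v + mat_app m n (A :: _ \<Rightarrow> _ \<Rightarrow> 'k::field bipoly) w"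
  by (rule ff.linear_add[OF mat_app_linear])

lemma mat_app_free_part:
  assumes "hom_matrix ds es A" "v \<in> free_part es i" shows "mat_app (length ds) (length es) A v \<in> free_part ds i"
  unfolding free_part_def mat_app_def
  using assms by (auto simp: hom_matrix_def free_part_def intro!: bp.subspace_sum[OF subspace_shifted_forms] shifted_forms_mult)

lemma hom_comp_free_part: "hom_comp ds i v \<in> free_part ds i"
  by (auto simp: hom_comp_def free_part_def shifted_forms_def hom_part_forms)

lemma hom_comp_id: assumes "v \<in> free_part ds i" shows "hom_comp ds i v = v"
proof (rule ext)
  fix j
  show "hom_comp ds i v j = v j"
  proof (cases "j < length ds")
    case True
    then have "v j \<in> shifted_forms (ds ! j) i" using assms by (simp add: free_part_def)
    then show ?thesis using hom_part_of_form[of "v j" "i - ds ! j" "i - ds ! j"] True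
      by (auto simp: hom_comp_def shifted_forms_def)
  qed (use assms in \<open>simp add: hom_comp_def free_part_def\<close>)
qed

text \<open>A homogeneous matrix maps components to components; entries whose degree would be
  negative are 0, which covers the truncated differences.\<close>

lemma hom_comp_mat_app:
  assumes "hom_matrix ds es A"
  shows "hom_comp ds i (mat_app (length ds) (length es) A v) = mat_app (length ds) (length es) A (hom_comp es i v)"
proof (rule ext)
  fix r
  have "hom_part (i - ds ! r) (A r c * v c) = A r c * hom_comp es i v c"
    if "ds ! r \<le> i" "c < length es" "r < length ds" for c
  proof -
    have A: "A r c \<in> shifted_forms (ds ! r) (es ! c)" using assms that by (auto simp: hom_matrix_def)
    show ?thesis
    proof (cases "ds ! r \<le> es ! c")
      case True
      then have "A r c \<in> forms (es ! c - ds ! r)" using A by (simp add: shifted_forms_def)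
      from hom_part_mult_form[OF this, of "i - ds ! r" "v c"] True that show ?thesis
        by (auto simp: hom_comp_def mult.commute)
    next
      case False
      then show ?thesis using A by (simp add: shifted_forms_def)
    qed
  qed
  moreover have "A r c * hom_comp es i v c = 0" if "\<not> ds ! r \<le> i" "c < length es" "r < length ds" for c
  proof (cases "es ! c \<le> i")
    case True
    have "A r c \<in> shifted_forms (ds ! r) (es ! c)" using assms that by (simp add: hom_matrix_def)
    then show ?thesis using True that by (simp add: shifted_forms_def)
  qed (simp add: hom_comp_def)
  then have "(\<Sum>c<length es. A r c * hom_comp es i v c) = 0" if "\<not> ds ! r \<le> i" "r < length ds"
    using that by (intro sum.neutral) simp
  ultimately show "hom_comp ds i (mat_app (length ds) (length es) A v) r = mat_app (length ds) (length es) A (hom_comp es i v) r"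
    by (auto simp: hom_comp_def[of ds] mat_app_def hom_part_sum intro!: sum.cong)
qed

lemma hom_comp_decomp:
  assumes "v \<in> free_vecs (length ds)"
  shows "\<exists>n. v = (\<Sum>i<n. hom_comp ds i v)"
proof -
  have "\<forall>j. \<exists>B. \<forall>n\<ge>B. v j = (\<Sum>i<n. hom_part i (v j))" using hom_part_decomp by blast
  then obtain B where B: "\<And>j n. n \<ge> B j \<Longrightarrow> v j = (\<Sum>i<n. hom_part i (v j))" by metis
  \<comment> \<open>\<open>hom_comp\<close> delays the degree-k part of the j-th entry to index
    \<open>k + ds ! j\<close>, so the common bound is enlarged by the generator degrees.\<close>
  define N where "N = Max (insert 0 ((\<lambda>j. B j + ds ! j) ` {..<length ds}))"
  have "v j = (\<Sum>i<N. hom_comp ds i v) j" for j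
  proof (cases "j < length ds")
    case True
    have N: "B j + ds ! j \<le> N" unfolding N_def by (rule Max_ge) (use True in auto)
    have "(\<Sum>i<N. hom_comp ds i v) j = (\<Sum>i<N. hom_comp ds i v j)" by (induction N) auto
    also have "\<dots> = (\<Sum>i\<in>{ds ! j..<N}. hom_part (i - ds ! j) (v j))"
      by (rule sum.mono_neutral_cong_right) (use True in \<open>auto simp: hom_comp_def\<close>)
    also have "\<dots> = (\<Sum>i<N - ds ! j. hom_part i (v j))"
      by (rule sum.reindex_bij_witness[of _ "\<lambda>i. i + ds ! j" "\<lambda>i. i - ds ! j"]) (use N in auto)
    also have "\<dots> = v j" using B[of j "N - ds ! j"] N by simp
    finally show ?thesis by simp
  next
    case False
    have "(\<Sum>i<N. hom_comp ds i v) j = (\<Sum>i<N. hom_comp ds i v j)" by (induction N) auto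
    then show ?thesis using assms False by (simp add: free_vecs_def hom_comp_def)
  qed
  then show ?thesis by blast
qed

lemma free_part_free_vecs: "v \<in> free_part ds i \<Longrightarrow> v \<in> free_vecs (length ds)"
  by (auto simp: free_part_def free_vecs_def)

lemma const_terms_linear: "Vector_Spaces.linear vscale (\<lambda>c v j. c * v j) const_terms"
  by (auto simp: lin_iff const_terms_def vscale_def fun_eq_iff)

lemma const_terms_image: "const_terms ` free_part ds i = (tensor_part ds i :: (nat \<Rightarrow> 'a::field) set)"
proof
  show "const_terms ` free_part ds i \<subseteq> (tensor_part ds i :: (nat \<Rightarrow> 'a) set)"
  proof
    fix u assume "u \<in> const_terms ` free_part ds i"
    then obtain v where v: "v \<in> free_part ds i" "u = const_terms v" by blast
    have "bcoeff (v j) 0 0 = 0" if "j < length ds" "ds ! j \<noteq> i" for j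
      using v(1) that formsD[of "v j" "i - ds ! j" 0 0] by (auto simp: free_part_def shifted_forms_def split: if_splits)
    then show "u \<in> tensor_part ds i" using v by (auto simp: tensor_part_def const_terms_def free_vecs_def free_part_def)
  qed
  show "(tensor_part ds i :: (nat \<Rightarrow> 'a) set) \<subseteq> const_terms ` free_part ds i"
  proof
    fix u :: "nat \<Rightarrow> 'a" assume u: "u \<in> tensor_part ds i"
    have k1: "bcoeff (1 :: 'a bipoly) 0 0 = 1" by (simp add: bcoeff_def)
    have "const_terms (\<lambda>j. kscale (u j) 1) = u" by (auto simp: const_terms_def k1)
    moreover have "(\<lambda>j. kscale (u j) 1) \<in> free_part ds i"
      using u by (force simp: free_part_def tensor_part_def free_vecs_def shifted_forms_def kscale_one_forms)
    ultimately show "u \<in> const_terms ` free_part ds i" by force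
  qed
qed

text \<open>y^(k+1) is the only monomial of degree k + 1 not divisible by x; it alone goes to the
  second summand.\<close>

lemma forms_Suc_split:
  assumes "f \<in> forms (Suc k)"
  shows "\<exists>a\<in>forms k. \<exists>b\<in>forms k. f = bimonom 1 0 * a + bimonom 0 1 * (b :: 'k::field bipoly)"
proof (intro bexI)
  let ?a = "\<Sum>b\<le>k. kscale (bcoeff f (Suc k - b) b) (bimonom (k - b) b) :: 'k bipoly"
  let ?b = "kscale (bcoeff f 0 (Suc k)) (bimonom 0 k) :: 'k bipoly"
  have m: "bimonom p q * bimonom r s = (bimonom (p + r) (q + s) :: 'k bipoly)" for p q r s by (simp add: bimonom_def mult_monom)
  have "bimonom 1 0 * ?a = (\<Sum>b\<le>k. kscale (bcoeff f (Suc k - b) b) (bimonom (Suc k - b) b))"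
    unfolding sum_distrib_left kscale_mult m by (rule sum.cong) (auto simp: Suc_diff_le)
  moreover have "bimonom 0 1 * ?b = kscale (bcoeff f 0 (Suc k)) (bimonom 0 (Suc k))" by (simp add: kscale_mult m)
  ultimately show "f = bimonom 1 0 * ?a + bimonom 0 1 * ?b" using forms_expand[OF assms] by simp
  show "?a \<in> forms k" by (intro bp.subspace_sum[OF subspace_forms] bp.subspace_scale[OF subspace_forms] bimonom_forms) auto
  show "?b \<in> forms k" by (intro bp.subspace_scale[OF subspace_forms] bimonom_forms) auto
qed

lemma forms_0_const: assumes "f \<in> forms 0" "bcoeff f 0 0 = 0" shows "f = 0"
  by (rule bipoly_eqI) (use assms formsD[OF assms(1)] in \<open>metis add_is_0 bcoeff_simps(1)\<close>)

text \<open>Degree i of (x, y)F is R_1 F_(i-1): an entry without constant term has positive degree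
  over its generator and splits as xa + yb.\<close>

lemma const_terms_kernel: "{v \<in> free_part ds i. const_terms v = 0} = R1v (prev_part (free_part ds) i :: (nat \<Rightarrow> 'a::field bipoly) set)"
proof
  show "{v \<in> free_part ds i. const_terms v = 0} \<subseteq> R1v (prev_part (free_part ds) i :: (nat \<Rightarrow> 'a bipoly) set)"
  proof
    fix v :: "nat \<Rightarrow> 'a bipoly" assume "v \<in> {v \<in> free_part ds i. const_terms v = 0}"
    then have v: "v \<in> free_part ds i" and c: "\<And>j. bcoeff (v j) 0 0 = 0" by (auto simp: const_terms_def fun_eq_iff)
    have "\<exists>a b. a \<in> prev_part (shifted_forms (ds ! j)) i \<and> b \<in> prev_part (shifted_forms (ds ! j)) i \<and> v j = bimonom 1 0 * a + bimonom 0 1 * b" if j: "j < length ds" for j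
    proof (cases "v j = 0")
      case False
      have vj: "v j \<in> shifted_forms (ds ! j) i" using v j by (auto simp: free_part_def)
      with False have le: "ds ! j \<le> i" by (auto simp: shifted_forms_def split: if_splits)
      then have f: "v j \<in> forms (i - ds ! j)" using vj by (simp add: shifted_forms_def)
      have "i \<noteq> ds ! j" using f forms_0_const[of "v j"] c False by auto
      then obtain k where k: "i = Suc (ds ! j + k)" using le by (metis le_neq_implies_less less_imp_Suc_add)
      then have "v j \<in> forms (Suc k)" using f by simp
      from forms_Suc_split[OF this] show ?thesis using k by (auto simp: shifted_forms_def)
    qed (auto intro!: exI[of _ 0] simp: prev_part_def split: nat.splits)
    then obtain a b where ab: "\<And>j. j < length ds \<Longrightarrow> a j \<in> prev_part (shifted_forms (ds ! j)) i \<and> b j \<in> prev_part (shifted_forms (ds ! j)) i \<and> v j = bimonom 1 0 * a j + bimonom 0 1 * b j"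
      by metis
    let ?a = "\<lambda>j. if j < length ds then a j else 0" and ?b = "\<lambda>j. if j < length ds then b j else 0"
    have "?a \<in> prev_part (free_part ds) i" "?b \<in> prev_part (free_part ds) i"
      using ab by (cases i; fastforce simp: free_part_def fun_eq_iff)+
    moreover have "v = smul (bimonom 1 0) ?a + smul (bimonom 0 1) ?b"
      using ab v by (auto simp: smul_def fun_eq_iff free_part_def)
    ultimately show "v \<in> R1v (prev_part (free_part ds) i)" unfolding R1v_def by blast
  qed
  show "R1v (prev_part (free_part ds) i :: (nat \<Rightarrow> 'a bipoly) set) \<subseteq> {v \<in> free_part ds i. const_terms v = 0}"
  proof
    fix v :: "nat \<Rightarrow> 'a bipoly" assume "v \<in> R1v (prev_part (free_part ds) i)"
    then obtain a b where ab: "a \<in> prev_part (free_part ds) i" "b \<in> prev_part (free_part ds) i" "v = smul (bimonom 1 0) a + smul (bimonom 0 1) b"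
      unfolding R1v_def by blast
    have "v \<in> free_part ds i"
    proof (cases i)
      case (Suc k)
      then show ?thesis using ab smul_free_part[OF bimonom_10_forms, of a ds k] smul_free_part[OF bimonom_01_forms, of b ds k]
        by (simp add: fv.subspace_add[OF subspace_free_part])
    qed (use ab in simp)
    moreover have "const_terms v = 0" by (auto simp: ab(3) const_terms_def smul_def fun_eq_iff)
    ultimately show "v \<in> {v \<in> free_part ds i. const_terms v = 0}" by simp
  qed
qed

lemma mat_app_R1v: "mat_app m n A ` R1v V = R1v (mat_app m n A ` V)"
proof
  show "mat_app m n A ` R1v V \<subseteq> R1v (mat_app m n A ` V)"
  proof
    fix y assume "y \<in> mat_app m n A ` R1v V"
    then obtain a b where "a \<in> V" "b \<in> V" "y = mat_app m n A (smul (bimonom 1 0) a + smul (bimonom 0 1) b)"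
      unfolding R1v_def by blast
    then show "y \<in> R1v (mat_app m n A ` V)" unfolding R1v_def mat_app_add mat_app_smul by blast
  qed
  show "R1v (mat_app m n A ` V) \<subseteq> mat_app m n A ` R1v V"
  proof
    fix y assume "y \<in> R1v (mat_app m n A ` V)"
    then obtain a b where "a \<in> V" "b \<in> V" "y = smul (bimonom 1 0) (mat_app m n A a) + smul (bimonom 0 1) (mat_app m n A b)"
      unfolding R1v_def by blast
    moreover have "smul (bimonom 1 0) a + smul (bimonom 0 1) b \<in> R1v V" unfolding R1v_def using calculation by blast
    ultimately show "y \<in> mat_app m n A ` R1v V" unfolding mat_app_smul[symmetric] mat_app_add[symmetric] by blast
  qed
qed

lemma mat_app_prev_part: "mat_app m n A ` prev_part M i = prev_part (\<lambda>i. mat_app m n A ` M i) i"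
  by (cases i) auto

lemma subspace_prev_part_free_part: "fv.subspace (prev_part (free_part ds) i)"
  by (cases i) (auto simp: subspace_free_part fv.subspace_single_0)

lemma fin_dim_prev_part_free_part: "fv.fin_dim (prev_part (free_part ds) i :: (nat \<Rightarrow> 'k::field bipoly) set)"
  using fv.fin_dim_span_finite[of "{} :: (nat \<Rightarrow> 'k bipoly) set"] by (cases i) (auto simp: fin_dim_free_part)

text \<open>The degree-\<open>i\<close> part of the image tensored with \<open>k\<close>, computed in two ways.\<close>

lemma dim_tensor_image:
  fixes m :: nat and es :: "nat list" and A :: "nat \<Rightarrow> nat \<Rightarrow> 'k::field bipoly"
  defines "f \<equiv> mat_app m (length es) A"
  shows "int (kv.dim (tensor_part es i :: (nat \<Rightarrow> 'k) set)) - int (kv.dim (const_terms ` {v \<in> free_part es i. f v = 0}))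
    = int (fv.dim (f ` free_part es i)) - int (fv.dim (R1v (prev_part (\<lambda>i. f ` free_part es i) i)))"
proof -
  have lf: "Vector_Spaces.linear vscale vscale f" unfolding f_def by (rule mat_app_linear)
  let ?Z = "{v \<in> free_part es i. f v = 0}" and ?m = "R1v (prev_part (free_part es) i)"
  have sZ: "fv.subspace ?Z" using fv.subspace_inter[OF subspace_free_part[of es i] ff.linear_subspace_kernel[OF lf]]
    by (simp add: Collect_conj_eq)
  have fZ: "fv.fin_dim ?Z" by (rule fv.fin_dim_mono[OF _ fin_dim_free_part[of es i]]) auto
  have 1: "fv.dim (free_part es i :: (nat \<Rightarrow> 'k bipoly) set) = kv.dim (tensor_part es i :: (nat \<Rightarrow> 'k) set) + fv.dim (?m :: (nat \<Rightarrow> 'k bipoly) set)"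
    by (subst fk.rank_nullity[OF const_terms_linear subspace_free_part fin_dim_free_part]) (simp add: const_terms_image const_terms_kernel)
  have 2: "fv.dim (free_part es i :: (nat \<Rightarrow> 'k bipoly) set) = fv.dim (f ` free_part es i) + fv.dim ?Z"
    by (rule ff.rank_nullity[OF lf subspace_free_part fin_dim_free_part])
  have 3: "fv.dim (?m :: (nat \<Rightarrow> 'k bipoly) set) = fv.dim (R1v (prev_part (\<lambda>i. f ` free_part es i) i)) + fv.dim {v \<in> ?m. f v = 0}"
    using ff.rank_nullity[OF lf subspace_R1v[OF subspace_prev_part_free_part] fin_dim_R1v[OF fin_dim_prev_part_free_part], of es i]
    unfolding f_def mat_app_R1v mat_app_prev_part .
  have 4: "fv.dim ?Z = kv.dim (const_terms ` ?Z) + fv.dim {v \<in> ?Z. const_terms v = 0}"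
    by (rule fk.rank_nullity[OF const_terms_linear sZ fZ])
  \<comment> \<open>\<open>f\<close> on (x, y)F and reduction modulo (x, y) on the kernel of
    \<open>f\<close> have the same kernel, the intersection of the two submodules; its dimension
    cancels.\<close>
  have "{v \<in> ?Z. const_terms v = 0} = {v \<in> ?m. f v = 0}" unfolding const_terms_kernel[symmetric] by auto
  then show ?thesis using 1 2 3 4 by simp
qed


section \<open>Second differences\<close>

text \<open>The numerical counterpart of \<open>prev_part\<close>. Functions count as 0 below 0,
  which makes \<open>second_diff\<close> injective.\<close>

definition pred_shift :: "(nat \<Rightarrow> int) \<Rightarrow> nat \<Rightarrow> int" where
  "pred_shift F i = (if i = 0 then 0 else F (i - 1))"

definition second_diff :: "(nat \<Rightarrow> int) \<Rightarrow> nat \<Rightarrow> int" where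
  "second_diff F i = F i - 2 * pred_shift F i + pred_shift (pred_shift F) i"

lemma pred_shift_0 [simp]: "pred_shift F 0 = 0" and pred_shift_Suc [simp]: "pred_shift F (Suc i) = F i"
  by (simp_all add: pred_shift_def)

lemma second_diff_inject: assumes "\<And>i. second_diff F i = second_diff G i" shows "F i = G i"
proof (induction i rule: less_induct)
  case (less i)
  then have "pred_shift F i = pred_shift G i" "pred_shift (pred_shift F) i = pred_shift (pred_shift G) i"
    by (auto simp: pred_shift_def)
  then show ?case using assms[of i] by (simp add: second_diff_def)
qed

lemma second_diff_diff: "second_diff (\<lambda>i. F i - G i) i = second_diff F i - second_diff G i"
  by (simp add: second_diff_def pred_shift_def)

lemma fv_dim_prev_part: "int (fv.dim (prev_part M i)) = pred_shift (\<lambda>i. int (fv.dim (M i))) i"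
  by (cases i) simp_all

lemma fv_dim_prev_part_prev_part: "int (fv.dim (prev_part (prev_part M) i)) = pred_shift (pred_shift (\<lambda>i. int (fv.dim (M i)))) i"
  by (cases i) (simp_all add: fv_dim_prev_part)

lemma bp_dim_prev_part: "int (bp.dim (prev_part M i)) = pred_shift (\<lambda>i. int (bp.dim (M i))) i"
  by (cases i) simp_all

lemma second_diff_dim_free_part: "second_diff (\<lambda>i. int (fv.dim (free_part ds i :: (nat \<Rightarrow> 'k::field bipoly) set))) i = int (count_list ds i)"
  using sum_list_second_diff[of i ds]
  unfolding second_diff_def fv_dim_prev_part[symmetric] fv_dim_prev_part_prev_part[symmetric] unfolding dim_prev_part_free_part dim_prev_part_prev_part_free_part dim_free_part[of ds i] .


section \<open>Kernels of homogeneous maps\<close>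

lemma subspace_kernel: "fv.subspace {v \<in> free_part es i. mat_app m n A v = 0}"
  using fv.subspace_inter[OF subspace_free_part[of es i] ff.linear_subspace_kernel[OF mat_app_linear[of m n A]]]
  by (simp add: Collect_conj_eq)

lemma fin_dim_kernel: "fv.fin_dim {v \<in> free_part es i. mat_app m n A v = 0}"
  by (rule fv.fin_dim_mono[OF _ fin_dim_free_part[of es i]]) auto

lemma subspace_prev_part: "(\<And>i. fv.subspace (M i)) \<Longrightarrow> fv.subspace (prev_part M i)"
  by (cases i) (simp_all add: fv.subspace_single_0)

lemma fin_dim_prev_part:
  fixes M :: "nat \<Rightarrow> (nat \<Rightarrow> 'k::field bipoly) set"
  shows "(\<And>i. fv.fin_dim (M i)) \<Longrightarrow> fv.fin_dim (prev_part M i)"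
  using fv.fin_dim_span_finite[of "{} :: (nat \<Rightarrow> 'k bipoly) set"] by (cases i) simp_all

text \<open>The kernel Z of a map f of free modules attains the bound of \<open>dim_R1v\<close>: if
  xa = yb in Z, then a = yc, and y f(c) = 0 forces f(c) = 0. So Z behaves like a free module: its
  number of new generators in degree i is a second difference.\<close>

lemma dim_R1v_kernel:
  fixes m :: nat and es :: "nat list" and A :: "nat \<Rightarrow> nat \<Rightarrow> 'k::field bipoly"
  defines "Z \<equiv> \<lambda>i. {v \<in> free_part es i. mat_app m (length es) A v = 0}"
  shows "int (fv.dim (Z i)) - int (fv.dim (R1v (prev_part Z i))) = second_diff (\<lambda>i. int (fv.dim (Z i))) i"
proof -
  have s: "fv.subspace (Z i)" "fv.fin_dim (Z i)" for i unfolding Z_def by (rule subspace_kernel fin_dim_kernel)+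
  have "fv.dim (R1v (prev_part Z i)) + fv.dim (prev_part (prev_part Z) i) = 2 * fv.dim (prev_part Z i)"
  proof (rule dim_R1v_eq)
    have m: "smul p v \<in> Z (Suc i)" if "v \<in> Z i" "p \<in> forms (Suc 0)" for p v i
      using that smul_free_part[of p "Suc 0" v es i] by (auto simp: Z_def mat_app_smul)
    have c: "smul p ` prev_part (prev_part Z) i \<subseteq> prev_part Z i" if "p \<in> forms (Suc 0)" for p
    proof (cases i)
      case (Suc k)
      have "0 \<in> Z 0" by (rule fv.subspace_0[OF s(1)])
      then show ?thesis using Suc m that by (cases k) auto
    qed simp
    show "smul (bimonom 1 0) ` prev_part (prev_part Z) i \<subseteq> prev_part Z i" "smul (bimonom 0 1) ` prev_part (prev_part Z) i \<subseteq> prev_part Z i"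
      by (rule c, rule bimonom_forms, simp)+
    fix a b assume ab: "a \<in> prev_part Z i" "b \<in> prev_part Z i" "smul (bimonom 1 0) a = smul (bimonom 0 1) b"
    show "\<exists>c\<in>prev_part (prev_part Z) i. a = smul (bimonom 0 1) c"
    proof (cases i)
      case 0
      then show ?thesis using ab by (intro bexI[of _ 0]) auto
    next
      case (Suc k)
      then have a: "a \<in> free_part es k" "mat_app m (length es) A a = 0" using ab by (auto simp: Z_def)
      from free_part_syzygy[OF a(1) ab(3)] obtain c where c: "c \<in> prev_part (free_part es) k" "a = smul (bimonom 0 1) c" by blast
      then have "smul (bimonom 0 1) (mat_app m (length es) A c) = 0" using a(2) by (simp add: mat_app_smul)
      then have "mat_app m (length es) A c = 0" by (simp add: smul_eq_0)
      then have "c \<in> prev_part Z k" using c(1) by (cases k) (auto simp: Z_def)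
      then show ?thesis using c Suc by auto
    qed
  qed (intro subspace_prev_part fin_dim_prev_part s)+
  then show ?thesis
    unfolding second_diff_def fv_dim_prev_part[symmetric] fv_dim_prev_part_prev_part[symmetric] by linarith
qed

lemma dim_tensor_part: "kv.dim (tensor_part ds i :: (nat \<Rightarrow> 'k::field) set) = count_list ds i"
proof -
  \<comment> \<open>A matrix without rows kills everything, so the kernel formula applies to the
    free module itself.\<close>
  have z: "mat_app 0 n A v = 0" for n and A :: "nat \<Rightarrow> nat \<Rightarrow> 'k bipoly" and v by (auto simp: mat_app_def fun_eq_iff)
  have "fv.dim (free_part ds i :: (nat \<Rightarrow> 'k bipoly) set) = kv.dim (tensor_part ds i :: (nat \<Rightarrow> 'k) set)
      + fv.dim (R1v (prev_part (free_part ds) i) :: (nat \<Rightarrow> 'k bipoly) set)"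
    by (subst fk.rank_nullity[OF const_terms_linear subspace_free_part fin_dim_free_part]) (simp add: const_terms_image const_terms_kernel)
  moreover have "int (fv.dim (free_part ds i :: (nat \<Rightarrow> 'k bipoly) set)) - int (fv.dim (R1v (prev_part (free_part ds) i) :: (nat \<Rightarrow> 'k bipoly) set))
      = int (count_list ds i)"
    using dim_R1v_kernel[where m = 0 and es = ds and i = i and A = "\<lambda>_ _. 0 :: 'k bipoly"] by (simp add: z second_diff_dim_free_part)
  ultimately show ?thesis by linarith
qed

lemma dim_kernel:
  fixes A :: "nat \<Rightarrow> nat \<Rightarrow> 'k::field bipoly"
  shows "int (fv.dim {v \<in> free_part es i. mat_app m n A v = 0})
    = int (fv.dim (free_part es i :: (nat \<Rightarrow> 'k bipoly) set)) - int (fv.dim (mat_app m n A ` free_part es i))"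
  using ff.rank_nullity[OF mat_app_linear[of m n A] subspace_free_part[of es i] fin_dim_free_part[of es i]] by linarith

text \<open>Homogeneous components commute with homogeneous matrices, so exactness passes to each
  degree; \<open>exact_of_pieces\<close> leads back.\<close>

lemma exact_pieces:
  assumes A: "hom_matrix ds es A" and B: "hom_matrix es gs B"
    and ex: "{v \<in> free_vecs (length es). mat_app (length ds) (length es) A v = 0}
      = mat_app (length es) (length gs) B ` free_vecs (length gs)"
  shows "{v \<in> free_part es i. mat_app (length ds) (length es) A v = 0} = mat_app (length es) (length gs) B ` free_part gs i"
proof
  show "{v \<in> free_part es i. mat_app (length ds) (length es) A v = 0} \<subseteq> mat_app (length es) (length gs) B ` free_part gs i"
  proof
    fix v assume v: "v \<in> {v \<in> free_part es i. mat_app (length ds) (length es) A v = 0}"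
    then obtain w where "v = mat_app (length es) (length gs) B w" using ex free_part_free_vecs by blast
    moreover have "hom_comp es i v = v" using v hom_comp_id by blast
    ultimately have "v = mat_app (length es) (length gs) B (hom_comp gs i w)" using hom_comp_mat_app[OF B] by metis
    then show "v \<in> mat_app (length es) (length gs) B ` free_part gs i" using hom_comp_free_part by blast
  qed
  show "mat_app (length es) (length gs) B ` free_part gs i \<subseteq> {v \<in> free_part es i. mat_app (length ds) (length es) A v = 0}"
    using mat_app_free_part[OF B] free_part_free_vecs ex by blast
qed

lemma free_vecs_subspace: "fv.subspace (free_vecs n)"
  by (rule fv_subspaceI) (auto simp: free_vecs_def vscale_def)

lemma hom_comp_zero: "hom_comp ds i 0 = 0"
  by (auto simp: hom_comp_def fun_eq_iff)

lemma exact_of_pieces: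
  assumes A: "hom_matrix ds es A"
    and ex: "\<And>i. {v \<in> free_part es i. mat_app (length ds) (length es) A v = 0} = mat_app (length es) (length gs) B ` free_part gs i"
  shows "{v \<in> free_vecs (length es). mat_app (length ds) (length es) A v = 0}
      = mat_app (length es) (length gs) B ` free_vecs (length gs)"
proof
  let ?B = "mat_app (length es) (length gs) B"
  have s: "fv.subspace (?B ` free_vecs (length gs))"
    by (rule ff.linear_subspace_image[OF mat_app_linear free_vecs_subspace])
  have sk: "fv.subspace {v. mat_app (length ds) (length es) A v = 0}"
    by (rule ff.linear_subspace_kernel[OF mat_app_linear])
  show "{v \<in> free_vecs (length es). mat_app (length ds) (length es) A v = 0} \<subseteq> ?B ` free_vecs (length gs)"
  proof
    fix v assume v: "v \<in> {v \<in> free_vecs (length es). mat_app (length ds) (length es) A v = 0}"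
    then obtain n where n: "v = (\<Sum>i<n. hom_comp es i v)" using hom_comp_decomp by blast
    have "hom_comp es i v \<in> ?B ` free_vecs (length gs)" for i
    proof -
      have "mat_app (length ds) (length es) A (hom_comp es i v) = 0"
        using v hom_comp_mat_app[OF A, of i v] hom_comp_zero by (metis (mono_tags, lifting) mem_Collect_eq)
      then have "hom_comp es i v \<in> ?B ` free_part gs i" using hom_comp_free_part ex[of i] by blast
      then show ?thesis using free_part_free_vecs by blast
    qed
    then have "(\<Sum>i<n. hom_comp es i v) \<in> ?B ` free_vecs (length gs)" by (intro fv.subspace_sum[OF s])
    then show "v \<in> ?B ` free_vecs (length gs)" using n by simp
  qed
  show "?B ` free_vecs (length gs) \<subseteq> {v \<in> free_vecs (length es). mat_app (length ds) (length es) A v = 0}"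
  proof
    fix v assume "v \<in> ?B ` free_vecs (length gs)"
    then obtain w where w: "w \<in> free_vecs (length gs)" "v = ?B w" by blast
    then obtain n where n: "w = (\<Sum>i<n. hom_comp gs i w)" using hom_comp_decomp by blast
    have "?B (hom_comp gs i w) \<in> {v. mat_app (length ds) (length es) A v = 0}" for i
      using ex[of i] hom_comp_free_part by blast
    then have "(\<Sum>i<n. ?B (hom_comp gs i w)) \<in> {v. mat_app (length ds) (length es) A v = 0}"
      by (intro fv.subspace_sum[OF sk])
    then have "?B (\<Sum>i<n. hom_comp gs i w) \<in> {v. mat_app (length ds) (length es) A v = 0}"
      by (simp only: ff.linear_sum[OF mat_app_linear])
    then have "mat_app (length ds) (length es) A v = 0" using n w by simp
    moreover have "v \<in> free_vecs (length es)" using w by (auto simp: mat_app_def free_vecs_def)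
    ultimately show "v \<in> {v \<in> free_vecs (length es). mat_app (length ds) (length es) A v = 0}" by blast
  qed
qed


section \<open>Ideals as vectors of length one\<close>

text \<open>Places an ideal in the free module of rank one, so that results on free modules serve
  ideals and syzygies alike.\<close>

definition vec_of :: "'k::field bipoly \<Rightarrow> nat \<Rightarrow> 'k bipoly" where
  "vec_of f = (\<lambda>j. if j = 0 then f else 0)"

lemma vec_of_linear: "Vector_Spaces.linear kscale vscale vec_of"
  by (auto simp: lin_iff vec_of_def vscale_def fun_eq_iff)

lemma vec_of_eq_iff [simp]: "vec_of f = vec_of g \<longleftrightarrow> f = g" and vec_of_0 [simp]: "vec_of 0 = 0"
  and vec_of_eq_0_iff [simp]: "vec_of f = 0 \<longleftrightarrow> f = 0"
  by (auto simp: vec_of_def fun_eq_iff dest: spec[of _ 0])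

lemma vec_of_add: "vec_of (f + g) = vec_of f + vec_of g" and vec_of_smul: "smul p (vec_of f) = vec_of (p * f)"
  by (auto simp: vec_of_def smul_def fun_eq_iff)

lemma dim_vec_of: "bp.subspace V \<Longrightarrow> bp.fin_dim V \<Longrightarrow> fv.dim (vec_of ` V) = bp.dim V"
  by (rule bf.dim_image_inj[OF vec_of_linear]) auto

lemma subspace_piece: assumes "is_ideal I" shows "bp.subspace (piece I i)"
proof (rule bp_subspaceI)
  have "kscale c f \<in> I" if "f \<in> I" for c f
    using assms that kscale_eq_mult[of c f] by (simp add: is_ideal_def)
  then show "kscale c f \<in> piece I i" if "f \<in> piece I i" for c f
    using that bp.subspace_scale[OF subspace_forms] by (auto simp: piece_def)
qed (use assms bp.subspace_add[OF subspace_forms] in \<open>auto simp: piece_def is_ideal_def\<close>)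

lemma fin_dim_piece: "bp.fin_dim (piece I i)"
  by (rule bp.fin_dim_mono[OF _ fin_dim_forms]) (auto simp: piece_def)

lemma piece_mult: "is_ideal I \<Longrightarrow> p \<in> forms k \<Longrightarrow> f \<in> piece I i \<Longrightarrow> p * f \<in> piece I (i + k)"
  using forms_mult[of p k f i] by (auto simp: piece_def is_ideal_def add.commute)

lemma R1_mult_eq:
  assumes V: "bp.subspace V"
  shows "R1_mult V = {bimonom 1 0 * a + bimonom 0 1 * b | a b. a \<in> V \<and> b \<in> (V :: 'k::field bipoly set)}" (is "_ = ?R")
proof
  have X: "Vector_Spaces.linear kscale kscale ((*) p)" for p :: "'k bipoly"
    by (rule bp_linearI) (simp_all add: algebra_simps kscale_mult)
  have R: "?R = {x + y | x y. x \<in> (*) (bimonom 1 0) ` V \<and> y \<in> (*) (bimonom 0 1) ` V}" by auto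
  have sub: "bp.subspace ?R" unfolding R
    by (intro bp.subspace_sums bb.linear_subspace_image[OF X] V)
  show "R1_mult V \<subseteq> ?R" unfolding R1_mult_def
  proof (rule bp.span_minimal[OF _ sub], clarify)
    fix l v :: "'k bipoly" assume l: "l \<in> forms 1" and v: "v \<in> V"
    from l have "l \<in> forms (Suc 0)" by simp
    then have "l = (\<Sum>b\<le>Suc 0. kscale (bcoeff l (Suc 0 - b) b) (bimonom (Suc 0 - b) b))" by (rule forms_expand)
    then have "l = kscale (bcoeff l 1 0) (bimonom 1 0) + kscale (bcoeff l 0 1) (bimonom 0 1)" by simp
    moreover have "(kscale c p + kscale d q) * v = p * kscale c v + q * kscale d v" for c d and p q :: "'k bipoly"
      by (simp add: kscale_mult distrib_right)
    ultimately have "l * v = bimonom 1 0 * kscale (bcoeff l 1 0) v + bimonom 0 1 * kscale (bcoeff l 0 1) v" by metis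
    then show "\<exists>a b. l * v = bimonom 1 0 * a + bimonom 0 1 * b \<and> a \<in> V \<and> b \<in> V"
      using bp.subspace_scale[OF V v] by blast
  qed
  show "?R \<subseteq> R1_mult V"
  proof clarify
    fix a b assume ab: "a \<in> V" "b \<in> V"
    have "bimonom 1 0 * a \<in> R1_mult V" "bimonom 0 1 * b \<in> R1_mult V"
      unfolding R1_mult_def using ab bimonom_10_forms bimonom_01_forms by (auto intro!: bp.span_base)
    then show "bimonom 1 0 * a + bimonom 0 1 * b \<in> R1_mult V" unfolding R1_mult_def by (rule bp.span_add)
  qed
qed

lemma vec_of_R1_mult: assumes "bp.subspace V" shows "vec_of ` R1_mult V = R1v (vec_of ` V)"
proof -
  have "vec_of ` R1_mult V = {vec_of (bimonom 1 0 * a + bimonom 0 1 * b) | a b. a \<in> V \<and> b \<in> V}"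
    unfolding R1_mult_eq[OF assms] by blast
  also have "\<dots> = R1v (vec_of ` V)" unfolding R1v_def vec_of_add vec_of_smul[symmetric] by blast
  finally show ?thesis .
qed

lemma subspace_R1_mult: "bp.subspace (R1_mult V)"
  by (simp add: R1_mult_def)

lemma fin_dim_vec_of_D:
  assumes "fv.fin_dim (vec_of ` V)" shows "bp.fin_dim (V :: 'k::field bipoly set)"
proof -
  have "bp.fin_dim ((\<lambda>v. v 0) ` vec_of ` V)" by (rule fb.fin_dim_image[OF linear_proj assms])
  moreover have "(\<lambda>v. v 0) ` vec_of ` V = V" by (auto simp: vec_of_def image_image)
  ultimately show ?thesis by simp
qed

lemma fin_dim_R1_mult: "bp.subspace V \<Longrightarrow> bp.fin_dim V \<Longrightarrow> bp.fin_dim (R1_mult V)"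
  by (rule fin_dim_vec_of_D) (simp add: vec_of_R1_mult fin_dim_R1v bf.fin_dim_image[OF vec_of_linear])

lemma dim_R1v_vec_of: "bp.subspace V \<Longrightarrow> bp.fin_dim V \<Longrightarrow> fv.dim (R1v (vec_of ` V)) = bp.dim (R1_mult V)"
  by (simp add: dim_vec_of fin_dim_R1_mult subspace_R1_mult flip: vec_of_R1_mult)

lemma subspace_vec_of: "bp.subspace V \<Longrightarrow> fv.subspace (vec_of ` V)"
  by (rule bf.linear_subspace_image[OF vec_of_linear])

lemma R1_mult_piece_sub:
  assumes "is_ideal (I :: 'a::field bipoly set)" shows "R1_mult (piece I i) \<subseteq> piece I (Suc i)"
  unfolding R1_mult_def
proof (rule bp.span_minimal[OF _ subspace_piece[OF assms]], clarify)
  fix l v :: "'a bipoly" assume "l \<in> forms 1" "v \<in> piece I i"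
  then show "l * v \<in> piece I (Suc i)" using piece_mult[OF assms, of l 1 v i] by simp
qed

lemma dim_R1_mult_le:
  assumes "is_ideal I" shows "bp.dim (R1_mult (piece I i)) \<le> bp.dim (piece I (Suc i))"
  by (rule bp.dim_mono_fd[OF R1_mult_piece_sub[OF assms] fin_dim_piece])

lemma R1_mult_forms:
  assumes "V \<subseteq> (forms i :: 'a::field bipoly set)" shows "R1_mult V \<subseteq> forms (Suc i)"
  unfolding R1_mult_def
proof (rule bp.span_minimal[OF _ subspace_forms], clarify)
  fix l v :: "'a bipoly" assume "l \<in> forms 1" "v \<in> V"
  then show "l * v \<in> forms (Suc i)" using forms_mult[of l 1 v i] assms by auto
qed

text \<open>Hopf's inequality with the space R_1, which has dimension 2, as one factor.\<close>

lemma dim_R1_mult_gt: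
  assumes "bp.subspace V" "V \<subseteq> forms i" "V \<noteq> {0}"
  shows "bp.dim V + 1 \<le> bp.dim (R1_mult V)"
proof -
  have "forms 1 \<noteq> {0 :: 'a bipoly}" using bimonom_nonzero bimonom_10_forms by (metis One_nat_def empty_iff insert_iff)
  moreover have "l * v \<in> R1_mult V" if "l \<in> forms 1" "v \<in> V" for l v
    unfolding R1_mult_def by (rule bp.span_base) (use that in blast)
  ultimately have "bp.dim (forms 1 :: 'a bipoly set) + bp.dim V \<le> Suc (bp.dim (R1_mult V))"
    by (intro dim_product_ge[OF subspace_forms order_refl _ assms subspace_R1_mult[of V] R1_mult_forms[OF assms(2)]])
  then show ?thesis by (simp add: dim_forms)
qed

text \<open>xyW lies in both xV and yV. The application is V = I_i and W = I_(i-1).\<close>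

lemma dim_R1_mult_upper:
  assumes "bp.subspace V" "bp.fin_dim V" "bp.subspace W" "bp.fin_dim W" "R1_mult W \<subseteq> V"
  shows "bp.dim (R1_mult V) + bp.dim W \<le> 2 * bp.dim (V :: 'k::field bipoly set)"
proof -
  have W: "p * w \<in> V" if "w \<in> W" "p \<in> forms 1" for p w
    using assms(5) that bp.span_base[of "p * w" "{l * v | l v. l \<in> forms 1 \<and> v \<in> W}"] unfolding R1_mult_def by blast
  have "fv.dim (R1v (vec_of ` V)) + fv.dim (vec_of ` W) \<le> 2 * fv.dim (vec_of ` V)"
  proof (rule dim_R1v_le)
    have "bimonom 1 0 \<in> (forms 1 :: 'k bipoly set)" "bimonom 0 1 \<in> (forms 1 :: 'k bipoly set)" by (auto intro: bimonom_forms)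
    then show "smul (bimonom 1 0) ` vec_of ` W \<subseteq> vec_of ` V" "smul (bimonom 0 1) ` vec_of ` W \<subseteq> vec_of ` V"
      using W by (auto simp del: One_nat_def simp: vec_of_smul)
  qed (use assms in \<open>auto simp: subspace_vec_of bf.fin_dim_image[OF vec_of_linear]\<close>)
  then show ?thesis using assms by (simp add: dim_vec_of dim_R1v_vec_of)
qed


section \<open>Tor from an arbitrary resolution\<close>

definition row_mat :: "(nat \<Rightarrow> 'a) \<Rightarrow> nat \<Rightarrow> nat \<Rightarrow> 'a" where
  "row_mat g = (\<lambda>_ c. g c)"

definition pdim :: "'k::field bipoly set \<Rightarrow> nat \<Rightarrow> int" where
  "pdim I i = int (bp.dim (piece I i))"

definition rdim :: "'k::field bipoly set \<Rightarrow> nat \<Rightarrow> int" where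
  "rdim I i = int (bp.dim (R1_mult (piece I i)))"

text \<open>The formula of \<open>tor_dim\<close> at a given resolution in place of the chosen
  one.\<close>

definition torF :: "'k::field bipoly free_complex \<Rightarrow> nat \<Rightarrow> nat \<Rightarrow> nat" where
  "torF F p i = kv.dim (tensor_cycles F p i) - kv.dim (tensor_boundaries F p i)"

lemma fun_sum_apply: "(\<Sum>x\<in>A. f x) j = (\<Sum>x\<in>A. f x j)"
  by (induction A rule: infinite_finite_induct) auto

lemma shifted_forms_0 [simp]: "shifted_forms 0 i = forms i"
  by (simp add: shifted_forms_def)

lemma mat_app_row_mat: "mat_app (Suc 0) n (row_mat g) v = vec_of (\<Sum>c<n. v c * g c)"
  by (auto simp: mat_app_def row_mat_def vec_of_def fun_eq_iff mult.commute)

lemma hom_matrix_row_mat: "hom_matrix [0] a (row_mat g) \<longleftrightarrow> (\<forall>c<length a. g c \<in> forms (a ! c))"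
  by (auto simp: hom_matrix_def row_mat_def)

lemma vec_of_free_part: "vec_of f \<in> free_part [0] i \<longleftrightarrow> f \<in> forms i"
  by (auto simp: free_part_def vec_of_def)

lemma pred_shift_rdim:
  assumes "is_ideal I"
  shows "int (fv.dim (R1v (prev_part (\<lambda>i. vec_of ` piece I i) i))) = pred_shift (rdim I) i"
  by (cases i) (simp_all add: rdim_def dim_R1v_vec_of subspace_piece[OF assms] fin_dim_piece)

lemma dim_vec_of_piece: "is_ideal I \<Longrightarrow> int (fv.dim (vec_of ` piece I i)) = pdim I i"
  by (simp add: pdim_def dim_vec_of subspace_piece fin_dim_piece)

lemma tensor_piece_eq: "tensor_piece F p i = tensor_part (degs F p) i"
  by (simp add: tensor_piece_def tensor_part_def)

text \<open>Taking the constant term is a ring homomorphism.\<close>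

lemma tensor_diff_const_terms: "tensor_diff F p (const_terms w) = const_terms (diff_map F p w)"
  by (auto simp: tensor_diff_def diff_map_def mat_app_def const_terms_def fun_eq_iff bcoeff_sum bcoeff_mult)

lemma tensor_boundaries_eq: "tensor_boundaries F p i = const_terms ` diff_map F p ` free_part (degs F (Suc p)) i"
  by (simp add: tensor_boundaries_def tensor_piece_eq image_image tensor_diff_const_terms flip: const_terms_image)

lemma tensor_diff_linear:
  "Vector_Spaces.linear (\<lambda>c v j. c * v j) (\<lambda>c v j. c * v j) (tensor_diff F p)"
  by (auto simp: lin_iff tensor_diff_def mat_app_def fun_eq_iff distrib_left sum.distrib sum_distrib_left mult.left_commute)

lemma subspace_tensor_part: "kv.subspace (tensor_part ds i)"
  unfolding const_terms_image[symmetric] by (rule fk.linear_subspace_image[OF const_terms_linear subspace_free_part])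

lemma fin_dim_tensor_part: "kv.fin_dim (tensor_part ds i)"
  unfolding const_terms_image[symmetric] by (rule fk.fin_dim_image[OF const_terms_linear fin_dim_free_part])

lemma R1_mult_zero: "R1_mult {0} = {0 :: 'k::field bipoly}"
  unfolding R1_mult_eq[OF bp.subspace_single_0] by auto

lemma rdim_upper:
  assumes "is_ideal I" shows "rdim I i + pred_shift (pdim I) i \<le> 2 * pdim I i"
proof -
  have "bp.dim (R1_mult (piece I i)) + bp.dim (prev_part (piece I) i) \<le> 2 * bp.dim (piece I i)"
  proof (rule dim_R1_mult_upper[OF subspace_piece[OF assms] fin_dim_piece])
    show "bp.subspace (prev_part (piece I) i)"
      by (cases i) (simp_all add: subspace_piece[OF assms] bp.subspace_single_0)
    show "R1_mult (prev_part (piece I) i) \<subseteq> piece I i"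
      using R1_mult_piece_sub[OF assms] bp.subspace_0[OF subspace_piece[OF assms]] by (cases i) (simp_all add: R1_mult_zero)
    show "bp.fin_dim (prev_part (piece I) i)"
      using bp.fin_dim_span_finite[of "{} :: 'a bipoly set"] by (cases i) (simp_all add: fin_dim_piece)
  qed
  then show ?thesis unfolding rdim_def pdim_def bp_dim_prev_part[symmetric] by linarith
qed

text \<open>Tor_0 is I/(x, y)I. For Tor_1 let Z be the kernel of the augmentation: F_1 tensored with
  k, modulo boundaries, is Z/(x, y)Z, whose dimension is the second difference of dim Z = dim F_0 -
  dim I; from it the rank of the reduced differential to F_0 is subtracted. The generator degrees of
  F_0 cancel, so the outcome depends on I alone.\<close>

lemma tor_resolution:
  fixes I :: "'k::field bipoly set"
  assumes I: "graded_ideal I" and F: "graded_free_resolution F I"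
  shows tor0_resolution: "int (torF F 0 i) = pdim I i - pred_shift (rdim I) i"
    and tor1_resolution: "int (torF F 1 i) = int (torF F 0 i) - second_diff (pdim I) i"
proof -
  define a where "a = degs F 0"
  define b where "b = degs F 1"
  define e where "e = mat_app (Suc 0) (length a) (row_mat (aug F))"
  have id: "is_ideal I" using I by (simp add: graded_ideal_def)
  have ha: "hom_matrix [0] a (row_mat (aug F))"
    using F by (simp add: graded_free_resolution_def hom_matrix_row_mat a_def)
  have hm: "hom_matrix (degs F p) (degs F (Suc p)) (diff F p)" for p
    unfolding hom_matrix_def shifted_forms_def
  proof (intro allI impI)
    fix r c assume "r < rk F p" "c < rk F (Suc p)"
    then show "diff F p r c \<in> (if degs F p ! r \<le> degs F (Suc p) ! c
         then forms (degs F (Suc p) ! c - degs F p ! r) else {0})"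
      using F unfolding graded_free_resolution_def by (metis (no_types, lifting) singletonI)
  qed
  have e_aug: "e v = vec_of (aug_map F v)" for v
    by (simp add: e_def mat_app_row_mat aug_map_def a_def)
  have im: "e ` free_part a i = vec_of ` piece I i" for i
  proof
    show "e ` free_part a i \<subseteq> vec_of ` piece I i"
    proof
      fix y assume "y \<in> e ` free_part a i"
      then obtain v where v: "v \<in> free_part a i" "y = e v" by blast
      have "aug_map F v \<in> I" using F free_part_free_vecs[OF v(1)] unfolding graded_free_resolution_def a_def by blast
      moreover have "e v \<in> free_part [0] i" using mat_app_free_part[OF ha v(1)] by (simp add: e_def)
      ultimately show "y \<in> vec_of ` piece I i" by (auto simp: v(2) e_aug vec_of_free_part piece_def)
    qed
    show "vec_of ` piece I i \<subseteq> e ` free_part a i"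
    proof
      fix y assume "y \<in> vec_of ` piece I i"
      then obtain f where f: "f \<in> I" "f \<in> forms i" "y = vec_of f" by (auto simp: piece_def)
      then obtain v where v: "f = aug_map F v"
        using F unfolding graded_free_resolution_def by blast
      have "y = hom_comp [0] i y" using f hom_comp_id vec_of_free_part by metis
      also have "\<dots> = hom_comp [0] i (e v)" using f v e_aug by simp
      also have "\<dots> = e (hom_comp a i v)" using hom_comp_mat_app[OF ha, of i v] by (simp add: e_def)
      finally show "y \<in> e ` free_part a i" using hom_comp_free_part by blast
    qed
  qed
  have "{v \<in> free_vecs (length a). e v = 0} = diff_map F 0 ` free_vecs (rk F 1)"
    using F by (simp add: graded_free_resolution_def e_aug a_def)
  then have Z: "{v \<in> free_part a i. e v = 0} = diff_map F 0 ` free_part b i" for i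
    using exact_pieces[OF ha hm[of 0, folded a_def], of i] by (simp add: diff_map_def e_def a_def b_def)
  have "{v \<in> free_vecs (rk F (Suc 0)). diff_map F 0 v = 0} = diff_map F (Suc 0) ` free_vecs (rk F (Suc (Suc 0)))"
    using F unfolding graded_free_resolution_def zero_fun_def by blast
  then have Z1: "{v \<in> free_part b i. diff_map F 0 v = 0} = diff_map F 1 ` free_part (degs F 2) i" for i
    using exact_pieces[OF hm[of 0] hm[of "Suc 0"], of i] by (simp add: diff_map_def b_def numeral_2_eq_2)
  have B0: "tensor_boundaries F 0 i = const_terms ` {v \<in> free_part a i. e v = 0}" for i
    by (simp add: tensor_boundaries_eq Z b_def)
  have B1: "tensor_boundaries F 1 i = const_terms ` {v \<in> free_part b i. diff_map F 0 v = 0}" for i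
    by (simp add: tensor_boundaries_eq Z1 numeral_2_eq_2)
  have t0: "int (kv.dim (tensor_part a i :: (nat \<Rightarrow> 'k) set)) - int (kv.dim (tensor_boundaries F 0 i))
      = pdim I i - pred_shift (rdim I) i" for i
    using dim_tensor_image[where m = "Suc 0" and es = a and A = "row_mat (aug F)" and i = i]
    unfolding e_def[symmetric] B0[symmetric] im pred_shift_rdim[OF id] dim_vec_of_piece[OF id] .
  \<comment> \<open>Nonnegativity turns the truncated difference in \<open>torF\<close> into an
    integer difference.\<close>
  have nn: "0 \<le> pdim I i - pred_shift (rdim I) i" for i
    using dim_R1_mult_le[OF id] by (cases i) (simp_all add: pdim_def rdim_def)
  have c0: "tensor_cycles F 0 i = tensor_part a i" for i
    by (simp add: tensor_cycles_def tensor_piece_eq a_def)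
  show nu: "int (torF F 0 i) = pdim I i - pred_shift (rdim I) i"
    using t0[of i] nn[of i] by (simp add: torF_def c0)
  let ?z = "\<lambda>i. int (fv.dim {v \<in> free_part a i. e v = 0})"
  have t1: "int (kv.dim (tensor_part b i :: (nat \<Rightarrow> 'k) set)) - int (kv.dim (tensor_boundaries F 1 i)) = second_diff ?z i" for i
  proof -
    have "int (kv.dim (tensor_part b i :: (nat \<Rightarrow> 'k) set)) - int (kv.dim (tensor_boundaries F 1 i))
      = int (fv.dim (diff_map F 0 ` free_part b i)) - int (fv.dim (R1v (prev_part (\<lambda>i. diff_map F 0 ` free_part b i) i)))"
      using dim_tensor_image[where m = "rk F 0" and es = b and A = "diff F 0" and i = i]
      unfolding B1 by (simp add: diff_map_def b_def)
    then show ?thesis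
      using dim_R1v_kernel[where m = "Suc 0" and es = a and A = "row_mat (aug F)" and i = i]
      unfolding Z[symmetric] by (simp add: e_def)
  qed
  have "?z i = int (fv.dim (free_part a i :: (nat \<Rightarrow> 'k bipoly) set)) - pdim I i" for i
    using dim_kernel[where m = "Suc 0" and n = "length a" and es = a and i = i and A = "row_mat (aug F)"]
    unfolding e_def[symmetric] im dim_vec_of_piece[OF id] .
  then have sz: "second_diff ?z i = int (count_list a i) - second_diff (pdim I) i" for i
    by (simp add: second_diff_diff second_diff_dim_free_part)
  have c1: "tensor_cycles F 1 i = {u \<in> tensor_part b i. tensor_diff F 0 u = 0}"
    by (simp add: tensor_cycles_def tensor_piece_eq b_def zero_fun_def)
  have "kv.dim (tensor_part b i :: (nat \<Rightarrow> 'k) set) = kv.dim (tensor_diff F 0 ` tensor_part b i) + kv.dim (tensor_cycles F 1 i)"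
    unfolding c1 by (rule kk.rank_nullity[OF tensor_diff_linear subspace_tensor_part fin_dim_tensor_part])
  moreover have "tensor_diff F 0 ` tensor_part b i = tensor_boundaries F 0 i"
    by (simp add: tensor_boundaries_def tensor_piece_eq b_def)
  ultimately have "int (kv.dim (tensor_cycles F 1 i)) - int (kv.dim (tensor_boundaries F 1 i))
      = pdim I i - pred_shift (rdim I) i - second_diff (pdim I) i"
    using t0[of i] t1[of i] sz[of i] by (simp add: dim_tensor_part)
  \<comment> \<open>The same for Tor_1, where nonnegativity is \<open>rdim_upper\<close> one degree
    lower.\<close>
  moreover have "0 \<le> pdim I i - pred_shift (rdim I) i - second_diff (pdim I) i"
  proof (cases i)
    case (Suc k)
    have "rdim I k + pred_shift (pdim I) k \<le> 2 * pdim I k" by (rule rdim_upper[OF id])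
    then show ?thesis using Suc by (simp add: second_diff_def)
  qed (simp add: second_diff_def)
  ultimately have "int (torF F 1 i) = pdim I i - pred_shift (rdim I) i - second_diff (pdim I) i"
    by (simp add: torF_def)
  then show "int (torF F 1 i) = int (torF F 0 i) - second_diff (pdim I) i"
    using nu by linarith
qed


section \<open>Minimal generators\<close>

lemma forms_0_kscale: assumes "p \<in> forms 0" shows "p = kscale (bcoeff p 0 0) 1"
proof -
  have "bimonom 0 0 = (1 :: 'a bipoly)" by (simp add: bimonom_def monom_0 flip: one_pCons)
  then show ?thesis using forms_expand[OF assms] by simp
qed

lemma one_forms [simp]: "1 \<in> forms 0"
  using kscale_one_forms[of 1] by simp

lemma smul_add_left: "smul (p + q) v = smul p v + smul q v"
  by (auto simp: smul_def fun_eq_iff algebra_simps)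

lemma smul_zero_left [simp]: "smul 0 v = 0"
  by (auto simp: smul_def fun_eq_iff)

lemma smul_one [simp]: "smul 1 v = v"
  by (auto simp: smul_def fun_eq_iff)

lemma smul_kscale: "smul (kscale c p) v = vscale c (smul p v)"
  by (auto simp: smul_def vscale_def kscale_mult fun_eq_iff)

text \<open>Forms are built from linear ones through xa + yb, so closure under R_1 suffices.\<close>

lemma smul_form_closed:
  fixes M :: "nat \<Rightarrow> (nat \<Rightarrow> 'k::field bipoly) set"
  assumes sub: "\<And>i. fv.subspace (M i)"
    and cl: "\<And>i p v. p \<in> forms (Suc 0) \<Longrightarrow> v \<in> M i \<Longrightarrow> smul p v \<in> M (Suc i)"
  shows "p \<in> forms k \<Longrightarrow> v \<in> M i \<Longrightarrow> smul p v \<in> M (i + k)"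
proof (induction k arbitrary: p)
  case 0
  then have "smul p v = vscale (bcoeff p 0 0) v" using forms_0_kscale[of p] smul_kscale[of _ 1 v] by (metis smul_one)
  then show ?case using 0 fv.subspace_scale[OF sub] by simp
next
  case (Suc k)
  from forms_Suc_split[OF Suc.prems(1)] obtain a b where ab: "a \<in> forms k" "b \<in> forms k" "p = bimonom 1 0 * a + bimonom 0 1 * b" by blast
  have m: "bimonom 1 0 \<in> (forms (Suc 0) :: 'k bipoly set)" "bimonom 0 1 \<in> (forms (Suc 0) :: 'k bipoly set)" by (auto intro: bimonom_forms)
  have "smul p v = smul (bimonom 1 0) (smul a v) + smul (bimonom 0 1) (smul b v)" by (simp add: ab(3) smul_add_left)
  moreover have "smul (bimonom 1 0) (smul a v) \<in> M (Suc (i + k))" "smul (bimonom 0 1) (smul b v) \<in> M (Suc (i + k))"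
    using cl m Suc.IH ab Suc.prems by blast+
  ultimately show ?case using fv.subspace_add[OF sub] by (metis add_Suc_right)
qed

lemma count_list_const: "count_list (map (\<lambda>_. n) l) i = (if i = n then length l else 0)"
  by (induction l) auto

text \<open>The generators of degree i are a basis of M_i modulo R_1 M_(i-1), and none are added
  beyond degree N. Their number is therefore exactly this codimension.\<close>

lemma minimal_generators:
  fixes M :: "nat \<Rightarrow> (nat \<Rightarrow> 'k::field bipoly) set"
  assumes sub: "\<And>i. fv.subspace (M i)" and fpM: "\<And>i. M i \<subseteq> free_part ds i"
    and cl: "\<And>i p v. p \<in> forms (Suc 0) \<Longrightarrow> v \<in> M i \<Longrightarrow> smul p v \<in> M (Suc i)"
    and gen: "\<And>i. i \<ge> N \<Longrightarrow> M (Suc i) \<subseteq> R1v (M i)"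
  obtains es A where "hom_matrix ds es A" "\<And>i. mat_app (length ds) (length es) A ` free_part es i = M i"
    "\<And>i. int (count_list es i) = int (fv.dim (M i)) - int (fv.dim (R1v (prev_part M i)))"
proof -
  have mf: "bimonom 1 0 \<in> (forms (Suc 0) :: 'k bipoly set)" "bimonom 0 1 \<in> (forms (Suc 0) :: 'k bipoly set)" by (auto intro: bimonom_forms)
  have finM: "fv.fin_dim (M i)" for i by (rule fv.fin_dim_mono[OF fpM fin_dim_free_part])
  have Rsub: "R1v (prev_part M i) \<subseteq> M i" for i
  proof (cases i)
    case 0
    then show ?thesis using fv.subspace_0[OF sub] by simp
  next
    case (Suc k)
    show ?thesis
    proof
      fix v assume "v \<in> R1v (prev_part M i)"
      then obtain a b where "a \<in> M k" "b \<in> M k" "v = smul (bimonom 1 0) a + smul (bimonom 0 1) b" unfolding R1v_def Suc by auto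
      then show "v \<in> M i" using cl mf fv.subspace_add[OF sub] Suc by blast
    qed
  qed
  have "\<exists>l. set l \<subseteq> M i \<and> length l + fv.dim (R1v (prev_part M i)) = fv.dim (M i) \<and> M i \<subseteq> fv.span (set l \<union> R1v (prev_part M i))" for i
  proof -
    obtain J where J: "finite J" "J \<subseteq> R1v (prev_part M i)" "fv.independent J" "R1v (prev_part M i) \<subseteq> fv.span J" "card J = fv.dim (R1v (prev_part M i))"
      using fv.fin_dim_basis[OF fv.fin_dim_mono[OF Rsub finM]] .
    obtain C where C: "J \<subseteq> C" "C \<subseteq> M i" "fv.independent C" "M i \<subseteq> fv.span C"
      using fv.maximal_independent_subset_extend[of J "M i"] J Rsub[of i] by blast
    have C': "finite C" "card C = fv.dim (M i)" using fv.indep_card_le[OF finM C(2,3)] fv.basis_card_eq_dim[OF C(2,4,3)] by auto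
    obtain l where l: "set l = C - J" "distinct l" using finite_distinct_list[of "C - J"] C' by blast
    have "length l = card (C - J)" using distinct_card[OF l(2)] l(1) by simp
    also have "\<dots> = card C - card J" by (rule card_Diff_subset[OF J(1) C(1)])
    finally have "length l + card J = card C" using card_mono[OF C'(1) C(1)] by simp
    moreover have "C \<subseteq> set l \<union> R1v (prev_part M i)" using l J by blast
    then have "M i \<subseteq> fv.span (set l \<union> R1v (prev_part M i))" using C(4) fv.span_mono[of C "set l \<union> R1v (prev_part M i)"] by blast
    moreover have "set l \<subseteq> M i" using l C by blast
    ultimately show ?thesis using J C' by auto
  qed
  then obtain L where L: "\<And>i. set (L i) \<subseteq> M i" "\<And>i. length (L i) + fv.dim (R1v (prev_part M i)) = fv.dim (M i)"
    "\<And>i. M i \<subseteq> fv.span (set (L i) \<union> R1v (prev_part M i))" by metis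
  \<comment> \<open>The chosen vectors of degree below \<open>n\<close>, tagged with their
    degrees.\<close>
  define Gn where "Gn n = concat (map (\<lambda>i. map (Pair i) (L i)) [0..<n])" for n
  define G where "G = Gn (Suc N)"
  have setG: "set G = {(i, v). i \<le> N \<and> v \<in> set (L i)}" by (auto simp: G_def Gn_def image_iff less_Suc_eq_le simp del: upt_Suc)
  define es where "es = map fst G"
  define A where "A = (\<lambda>r c. snd (G ! c) r)"
  have len: "length es = length G" by (simp add: es_def)
  have G1: "es ! c \<le> N" "snd (G ! c) \<in> set (L (es ! c))" "snd (G ! c) \<in> M (es ! c)" if "c < length G" for c
    using nth_mem[OF that] L(1) that by (auto simp: setG es_def split: prod.splits)
  have cnt: "count_list (map fst (Gn n)) i = (if i < n then length (L i) else 0)" for n i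
  proof (induction n)
    case (Suc n)
    have "map fst (map (Pair n) (L n)) = map (\<lambda>_. n) (L n)" by simp
    moreover have "Gn (Suc n) = Gn n @ map (Pair n) (L n)" by (simp add: Gn_def)
    ultimately show ?case using Suc by (simp only: map_append count_list_append count_list_const) auto
  qed (simp add: Gn_def)
  have Lz: "length (L i) = 0" if i: "i > N" for i
  proof -
    obtain k where k: "i = Suc k" "k \<ge> N" using i by (cases i) auto
    then have "M i = R1v (prev_part M i)" using gen[of k] Rsub[of i] by auto
    then have "fv.dim (M i) = fv.dim (R1v (prev_part M i))" by simp
    then show ?thesis using L(2)[of i] by simp
  qed
  have count: "int (count_list es i) = int (fv.dim (M i)) - int (fv.dim (R1v (prev_part M i)))" for i
    using cnt[of "Suc N" i] Lz[of i] L(2)[of i] by (auto simp: es_def G_def)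
  have hm: "hom_matrix ds es A"
    unfolding hom_matrix_def
  proof (intro allI impI)
    fix r c assume "r < length ds" "c < length es"
    then show "A r c \<in> shifted_forms (ds ! r) (es ! c)" using G1(3)[of c] fpM[of "es ! c"] by (auto simp: A_def len free_part_def)
  qed
  let ?f = "mat_app (length ds) (length es) A"
  have f: "?f v = (\<Sum>c<length G. smul (v c) (snd (G ! c)))" for v
  proof (rule ext)
    fix r
    have "snd (G ! c) r = 0" if "c < length G" "\<not> r < length ds" for c
      using G1(3)[OF that(1)] fpM[of "es ! c"] that(2) by (auto simp: free_part_def)
    then show "?f v r = (\<Sum>c<length G. smul (v c) (snd (G ! c))) r"
      by (auto simp: mat_app_def fun_sum_apply A_def smul_def len mult.commute)
  qed
  have Im_sub: "?f ` free_part es i \<subseteq> M i" for i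
  proof
    fix y assume "y \<in> ?f ` free_part es i"
    then obtain v where v: "v \<in> free_part es i" "y = ?f v" by blast
    show "y \<in> M i" unfolding v(2) f
    proof (rule fv.subspace_sum[OF sub])
      fix c assume c: "c \<in> {..<length G}"
      then have vc: "v c \<in> shifted_forms (es ! c) i" using v(1) len by (auto simp: free_part_def)
      show "smul (v c) (snd (G ! c)) \<in> M i"
      proof (cases "es ! c \<le> i")
        case True
        then show ?thesis
          using smul_form_closed[of M "v c" "i - es ! c" "snd (G ! c)" "es ! c"] sub cl G1(3)[of c] c vc by (simp add: shifted_forms_def)
      next
        case False
        then show ?thesis using vc fv.subspace_0[OF sub] by (simp add: shifted_forms_def)
      qed
    qed
  qed
  have Im_space: "fv.subspace (?f ` free_part es i)" for i by (rule ff.linear_subspace_image[OF mat_app_linear subspace_free_part])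
  \<comment> \<open>Induction on the degree: what is not new in a degree is R_1 times the piece
    before, and the image is closed under R_1.\<close>
  have Im_sup: "M i \<subseteq> ?f ` free_part es i" for i
  proof (induction i)
    case 0
    show ?case
    proof (rule order_trans[OF L(3)[of 0]], rule fv.span_minimal[OF _ Im_space])
      have "set (L 0) \<subseteq> ?f ` free_part es 0"
      proof
        fix v assume "v \<in> set (L 0)"
        then have "(0, v) \<in> set G" by (simp add: setG)
        then obtain c where c: "c < length G" "G ! c = (0, v)" by (auto simp: in_set_conv_nth)
        let ?w = "\<lambda>j. if j = c then (1 :: 'k bipoly) else 0"
        have "?w \<in> free_part es 0" using c by (auto simp: free_part_def len es_def)
        moreover have "?f ?w = (\<Sum>j<length G. if j = c then v else 0)" unfolding f by (rule sum.cong) (use c in auto)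
        then have "?f ?w = v" using c(1) by simp
        ultimately show "v \<in> ?f ` free_part es 0" by force
      qed
      then show "set (L 0) \<union> R1v (prev_part M 0) \<subseteq> ?f ` free_part es 0" using fv.subspace_0[OF Im_space] by auto
    qed
  next
    case (Suc k)
    have R: "R1v (M k) \<subseteq> ?f ` free_part es (Suc k)"
    proof
      fix y assume "y \<in> R1v (M k)"
      then obtain a b where "a \<in> M k" "b \<in> M k" "y = smul (bimonom 1 0) a + smul (bimonom 0 1) b" unfolding R1v_def by blast
      moreover then obtain u w where "u \<in> free_part es k" "a = ?f u" "w \<in> free_part es k" "b = ?f w" using Suc by blast
      ultimately have "y = ?f (smul (bimonom 1 0) u + smul (bimonom 0 1) w)" "smul (bimonom 1 0) u + smul (bimonom 0 1) w \<in> free_part es (Suc k)"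
        using smul_free_part[OF mf(1), of u es k] smul_free_part[OF mf(2), of w es k]
        by (simp_all add: mat_app_add mat_app_smul fv.subspace_add[OF subspace_free_part])
      then show "y \<in> ?f ` free_part es (Suc k)" by blast
    qed
    show ?case
    proof (cases "Suc k \<le> N")
      case True
      show ?thesis
      proof (rule order_trans[OF L(3)[of "Suc k"]], rule fv.span_minimal[OF _ Im_space])
        have "set (L (Suc k)) \<subseteq> ?f ` free_part es (Suc k)"
        proof
          fix v assume "v \<in> set (L (Suc k))"
          then have "(Suc k, v) \<in> set G" using True by (simp add: setG)
          then obtain c where c: "c < length G" "G ! c = (Suc k, v)" by (auto simp: in_set_conv_nth)
          let ?w = "\<lambda>j. if j = c then (1 :: 'k bipoly) else 0"
          have "?w \<in> free_part es (Suc k)" using c by (auto simp: free_part_def len es_def shifted_forms_def)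
          moreover have "?f ?w = (\<Sum>j<length G. if j = c then v else 0)" unfolding f by (rule sum.cong) (use c in auto)
          then have "?f ?w = v" using c(1) by simp
          ultimately show "v \<in> ?f ` free_part es (Suc k)" by force
        qed
        then show "set (L (Suc k)) \<union> R1v (prev_part M (Suc k)) \<subseteq> ?f ` free_part es (Suc k)" using R by simp
      qed
    next
      case False
      then show ?thesis using gen[of k] R by auto
    qed
  qed
  show ?thesis by (rule that[OF hm _ count]) (use Im_sub Im_sup in blast)
qed


text \<open>A resolution 0 -> F_1 -> F_0 -> I with generator degrees \<open>b\<close> and
  \<open>a\<close>; \<open>g\<close> lists the generators and \<open>B\<close> is the syzygy matrix.
  Minimality is expressed by the last two clauses, which fix the number of entries of each degree at
  the values that \<nu> and \<beta> turn out to have.\<close>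

definition minimal_res ::
    "'k::field bipoly set \<Rightarrow> nat list \<Rightarrow> (nat \<Rightarrow> 'k bipoly) \<Rightarrow> nat list \<Rightarrow> (nat \<Rightarrow> nat \<Rightarrow> 'k bipoly) \<Rightarrow> bool" where
  "minimal_res I a g b B \<longleftrightarrow> hom_matrix [0] a (row_mat g) \<and> hom_matrix a b B \<and>
    (\<forall>i. mat_app (Suc 0) (length a) (row_mat g) ` free_part a i = vec_of ` piece I i) \<and>
    (\<forall>i. {v \<in> free_part a i. mat_app (Suc 0) (length a) (row_mat g) v = 0} = mat_app (length a) (length b) B ` free_part b i) \<and>
    (\<forall>i v. v \<in> free_part b i \<longrightarrow> mat_app (length a) (length b) B v = 0 \<longrightarrow> v = 0) \<and>
    (\<forall>i. int (count_list a i) = pdim I i - pred_shift (rdim I) i) \<and>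
    (\<forall>i. int (count_list b i) = int (count_list a i) - second_diff (pdim I) i)"

text \<open>Minimal generators are chosen for I and then for their syzygies Z. Since Z has the
  dimensions of a free module on its minimal generators, F_1 maps onto Z injectively and the
  resolution ends.\<close>

lemma minimal_resolution:
  fixes I :: "'k::field bipoly set"
  assumes I: "is_ideal I"
    and stab: "\<And>i. i \<ge> N \<Longrightarrow> pdim I (Suc i) = pdim I i + 1 \<and> piece I (Suc i) = R1_mult (piece I i)"
  shows "\<exists>a g b B. minimal_res I a g b B"
proof -
  obtain a A where A: "hom_matrix [0] a A" "\<And>i. mat_app (length [0::nat]) (length a) A ` free_part a i = vec_of ` piece I i"
    "\<And>i. int (count_list a i) = int (fv.dim (vec_of ` piece I i)) - int (fv.dim (R1v (prev_part (\<lambda>i. vec_of ` piece I i) i)))"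
  proof (rule minimal_generators[of "\<lambda>i. vec_of ` piece I i" "[0]" N])
    fix es A
    assume E: "hom_matrix [0] es A" "\<And>i. mat_app (length [0::nat]) (length es) A ` free_part es i = vec_of ` piece I i"
      "\<And>i. int (count_list es i) = int (fv.dim (vec_of ` piece I i)) - int (fv.dim (R1v (prev_part (\<lambda>i. vec_of ` piece I i) i)))"
    show thesis by (rule that[OF E])
  next
    show "fv.subspace (vec_of ` piece I i)" for i by (rule subspace_vec_of[OF subspace_piece[OF I]])
    show "vec_of ` piece I i \<subseteq> free_part [0] i" for i by (auto simp: vec_of_free_part piece_def)
    show "smul p v \<in> vec_of ` piece I (Suc i)" if "p \<in> forms (Suc 0)" "v \<in> vec_of ` piece I i" for i p v
      using that piece_mult[OF I, of p "Suc 0" _ i] by (auto simp: vec_of_smul)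
    show "vec_of ` piece I (Suc i) \<subseteq> R1v (vec_of ` piece I i)" if "i \<ge> N" for i
      using stab[OF that] vec_of_R1_mult[OF subspace_piece[OF I], of i] by simp
  qed
  define g where "g = A 0"
  have Ag: "mat_app (Suc 0) (length a) A = mat_app (Suc 0) (length a) (row_mat g)"
    by (auto simp: mat_app_def row_mat_def g_def fun_eq_iff)
  have hg: "hom_matrix [0] a (row_mat g)" using A(1) by (simp add: hom_matrix_def row_mat_def g_def)
  let ?e = "mat_app (Suc 0) (length a) (row_mat g)"
  have im: "?e ` free_part a i = vec_of ` piece I i" for i using A(2) Ag by simp
  have ca: "int (count_list a i) = pdim I i - pred_shift (rdim I) i" for i
    using A(3) by (simp add: pred_shift_rdim[OF I] dim_vec_of_piece[OF I])
  define Z where "Z = (\<lambda>i. {v \<in> free_part a i. ?e v = 0})"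
  have Zs: "fv.subspace (Z i)" "fv.fin_dim (Z i)" for i unfolding Z_def by (rule subspace_kernel fin_dim_kernel)+
  have zd: "int (fv.dim (Z i)) = int (fv.dim (free_part a i :: (nat \<Rightarrow> 'k bipoly) set)) - pdim I i" for i
    using dim_kernel[where m = "Suc 0" and n = "length a" and es = a and i = i and A = "row_mat g"]
    unfolding im dim_vec_of_piece[OF I] Z_def .
  have sz: "second_diff (\<lambda>i. int (fv.dim (Z i))) i = int (count_list a i) - second_diff (pdim I) i" for i
    by (simp add: zd second_diff_diff second_diff_dim_free_part)
  have kos: "int (fv.dim (Z i)) - int (fv.dim (R1v (prev_part Z i))) = int (count_list a i) - second_diff (pdim I) i" for i
    using dim_R1v_kernel[where m = "Suc 0" and es = a and A = "row_mat g" and i = i] sz[of i] unfolding Z_def by simp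
  have Zcl: "smul p v \<in> Z (Suc i)" if "p \<in> forms (Suc 0)" "v \<in> Z i" for i p v
    using that smul_free_part[of p "Suc 0" v a i] by (auto simp: Z_def mat_app_smul)
  have mf: "bimonom 1 0 \<in> (forms (Suc 0) :: 'k bipoly set)" "bimonom 0 1 \<in> (forms (Suc 0) :: 'k bipoly set)" by (auto intro: bimonom_forms)
  \<comment> \<open>The bound moves from N to N + 1 because the second difference looks back two
    degrees.\<close>
  have gen: "Z (Suc i) \<subseteq> R1v (Z i)" if i: "i \<ge> Suc N" for i
  proof -
    obtain k where k: "i = Suc k" "k \<ge> N" using i by (cases i) auto
    have "count_list a (Suc i) = 0" using ca[of "Suc i"] stab[of i] i by (simp add: pdim_def rdim_def)
    moreover have "second_diff (pdim I) (Suc i) = 0" using stab[of i] stab[of k] k by (simp add: second_diff_def)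
    ultimately have d: "fv.dim (Z (Suc i)) = fv.dim (R1v (Z i))" using kos[of "Suc i"] by simp
    have "R1v (Z i) \<subseteq> Z (Suc i)"
    proof
      fix v assume "v \<in> R1v (Z i)"
      then obtain x y where "x \<in> Z i" "y \<in> Z i" "v = smul (bimonom 1 0) x + smul (bimonom 0 1) y" unfolding R1v_def by blast
      then show "v \<in> Z (Suc i)" using Zcl mf fv.subspace_add[OF Zs(1)] by blast
    qed
    then have "R1v (Z i) = Z (Suc i)"
      by (rule fv.subspace_eq_fd[OF subspace_R1v[OF Zs(1)] _ Zs(2)]) (simp add: d)
    then show ?thesis by simp
  qed
  obtain b B where B: "hom_matrix a b B" "\<And>i. mat_app (length a) (length b) B ` free_part b i = Z i"
    "\<And>i. int (count_list b i) = int (fv.dim (Z i)) - int (fv.dim (R1v (prev_part Z i)))"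
  proof (rule minimal_generators[of Z a "Suc N"])
    fix es A
    assume E: "hom_matrix a es A" "\<And>i. mat_app (length a) (length es) A ` free_part es i = Z i"
      "\<And>i. int (count_list es i) = int (fv.dim (Z i)) - int (fv.dim (R1v (prev_part Z i)))"
    show thesis by (rule that[OF E])
  next
    show "Z i \<subseteq> free_part a i" for i by (auto simp: Z_def)
    show "fv.subspace (Z i)" for i by (rule Zs)
    show "smul p v \<in> Z (Suc i)" if "p \<in> forms (Suc 0)" "v \<in> Z i" for i p v by (rule Zcl[OF that])
    show "Z (Suc i) \<subseteq> R1v (Z i)" if "Suc N \<le> i" for i by (rule gen[OF that])
  qed
  \<comment> \<open>Equal second differences give F_1 and Z the same dimension in every degree, and
    a surjection between them has no kernel.\<close>
  have "int (fv.dim (free_part b i :: (nat \<Rightarrow> 'k bipoly) set)) = int (fv.dim (Z i))" for i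
    by (rule second_diff_inject[where F = "\<lambda>i. int (fv.dim (free_part b i :: (nat \<Rightarrow> 'k bipoly) set))" and G = "\<lambda>i. int (fv.dim (Z i))"])
      (simp add: second_diff_dim_free_part B(3) kos sz)
  then have "fv.dim {v \<in> free_part b i. mat_app (length a) (length b) B v = 0} = 0" for i
    using dim_kernel[where m = "length a" and n = "length b" and es = b and i = i and A = B] by (simp add: B(2))
  then have inj: "v = 0" if "v \<in> free_part b i" "mat_app (length a) (length b) B v = 0" for i v
    using fv.dim_eq_0_fd[OF fin_dim_kernel[of b i "length a" "length b" B]] that by auto
  have cb: "int (count_list b i) = int (count_list a i) - second_diff (pdim I) i" for i
    by (simp add: B(3) kos)
  have "minimal_res I a g b B"
    unfolding minimal_res_def by (intro conjI allI impI hg B(1) im ca cb) (use B(2) inj in \<open>simp_all add: Z_def\<close>)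
  then show ?thesis by blast
qed

text \<open>Gives meaning to the \<open>SOME\<close> in \<open>tor_dim\<close>: the minimal
  resolution, continued by zero modules from position 2 on.\<close>

lemma resolution_exists:
  fixes I :: "'k::field bipoly set"
  assumes I: "graded_ideal I"
    and stab: "\<And>i. i \<ge> N \<Longrightarrow> pdim I (Suc i) = pdim I i + 1 \<and> piece I (Suc i) = R1_mult (piece I i)"
  shows "\<exists>F. graded_free_resolution F I"
proof -
  have id: "is_ideal I" using I by (simp add: graded_ideal_def)
  obtain a g b B where "minimal_res I a g b B" using minimal_resolution[OF id stab] by blast
  then have R: "hom_matrix [0] a (row_mat g)" "hom_matrix a b B"
    "\<And>i. mat_app (Suc 0) (length a) (row_mat g) ` free_part a i = vec_of ` piece I i"
    "\<And>i. {v \<in> free_part a i. mat_app (Suc 0) (length a) (row_mat g) v = 0} = mat_app (length a) (length b) B ` free_part b i"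
    "\<And>i v. v \<in> free_part b i \<Longrightarrow> mat_app (length a) (length b) B v = 0 \<Longrightarrow> v = 0"
    by (simp_all add: minimal_res_def)
  let ?e = "mat_app (Suc 0) (length a) (row_mat g)"
  define F where "F = \<lparr>degs = (\<lambda>p::nat. if p = 0 then a else if p = 1 then b else []),
    diff = (\<lambda>p::nat. if p = 0 then B else (\<lambda>_ _. 0)), aug = g\<rparr>"
  have d [simp]: "degs F 0 = a" "degs F (Suc 0) = b" "\<And>p. degs F (Suc (Suc p)) = []" "aug F = g"
    "diff F 0 = B" "\<And>p. diff F (Suc p) = (\<lambda>_ _. 0)" by (simp_all add: F_def)
  have e_aug: "?e v = vec_of (aug_map F v)" for v by (simp add: mat_app_row_mat aug_map_def)
  have ex0: "{v \<in> free_vecs (length a). ?e v = 0} = mat_app (length a) (length b) B ` free_vecs (length b)"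
    using exact_of_pieces[OF R(1), of b B] R(4) by simp
  have "{v \<in> free_vecs (length b). mat_app (length a) (length b) B v = 0}
      = mat_app (length b) (length ([] :: nat list)) (\<lambda>_ _. 0) ` free_vecs (length ([] :: nat list))"
  proof (rule exact_of_pieces[OF R(2)])
    fix i
    have "{v \<in> free_part b i. mat_app (length a) (length b) B v = 0} = {0}" using R(5) by auto
    moreover have "mat_app (length b) (length ([] :: nat list)) (\<lambda>_ _. 0) ` free_part [] i = {0 :: nat \<Rightarrow> 'k bipoly}"
      by (auto simp: mat_app_def fun_eq_iff image_iff free_part_def)
    ultimately show "{v \<in> free_part b i. mat_app (length a) (length b) B v = 0} = mat_app (length b) (length ([] :: nat list)) (\<lambda>_ _. 0) ` free_part [] i" by simp
  qed
  then have ex1: "{v \<in> free_vecs (length b). mat_app (length a) (length b) B v = 0}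
      = mat_app (length b) 0 (\<lambda>_ _. 0) ` free_vecs 0" by simp
  have ex2: "{v \<in> free_vecs 0. mat_app m 0 (\<lambda>_ _. 0 :: 'k bipoly) v = 0} = mat_app 0 0 (\<lambda>_ _. 0) ` free_vecs 0" for m
    by (auto simp: mat_app_def fun_eq_iff image_iff free_vecs_def)
  have "kscale c f \<in> I" if "f \<in> I" for c f
    using id that kscale_eq_mult[of c f] by (simp add: is_ideal_def)
  then have ideal_sub: "bp.subspace I"
    by (intro bp_subspaceI) (use id in \<open>auto simp: is_ideal_def\<close>)
  have aug_lin: "Vector_Spaces.linear vscale kscale (aug_map F)"
    by (auto simp: lin_iff aug_map_def vscale_def kscale_mult distrib_right sum.distrib bp.scale_sum_right)
  have im: "aug_map F ` free_vecs (length a) = I"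
  proof
    show "aug_map F ` free_vecs (length a) \<subseteq> I"
    proof
      fix f assume "f \<in> aug_map F ` free_vecs (length a)"
      then obtain v where v: "v \<in> free_vecs (length a)" "f = aug_map F v" by blast
      obtain n where n: "v = (\<Sum>i<n. hom_comp a i v)" using hom_comp_decomp[OF v(1)] by blast
      have "aug_map F (hom_comp a i v) \<in> I" for i
      proof -
        have "?e (hom_comp a i v) \<in> vec_of ` piece I i" using R(3)[of i] hom_comp_free_part by blast
        then show ?thesis by (auto simp: e_aug piece_def)
      qed
      then have "(\<Sum>i<n. aug_map F (hom_comp a i v)) \<in> I" by (intro bp.subspace_sum[OF ideal_sub])
      then show "f \<in> I" using n v(2) by (metis fb.linear_sum[OF aug_lin])
    qed
    show "I \<subseteq> aug_map F ` free_vecs (length a)"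
    proof
      fix f assume f: "f \<in> I"
      obtain n where n: "f = (\<Sum>i<n. hom_part i f)" using hom_part_decomp by blast
      have "hom_part i f \<in> aug_map F ` free_vecs (length a)" for i
      proof -
        have "hom_part i f \<in> piece I i" using I f hom_part_forms by (auto simp: graded_ideal_def piece_def)
        then have "vec_of (hom_part i f) \<in> ?e ` free_part a i" using R(3)[of i] by blast
        then show ?thesis by (auto simp: e_aug intro!: imageI free_part_free_vecs)
      qed
      then have "(\<Sum>i<n. hom_part i f) \<in> aug_map F ` free_vecs (length a)"
        by (intro bp.subspace_sum[OF fb.linear_subspace_image[OF aug_lin free_vecs_subspace]])
      then show "f \<in> aug_map F ` free_vecs (length a)" using n by simp
    qed
  qed
  have "graded_free_resolution F I"
    unfolding graded_free_resolution_def zero_fun_def[symmetric]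
  proof (intro conjI allI impI)
    fix c assume "c < rk F 0"
    then show "aug F c \<in> forms (degs F 0 ! c)" using R(1) by (simp add: hom_matrix_row_mat)
  next
    fix p r c assume "r < rk F p" "c < rk F (Suc p)"
    then show "if degs F p ! r \<le> degs F (Suc p) ! c
        then diff F p r c \<in> forms (degs F (Suc p) ! c - degs F p ! r) else diff F p r c = 0"
      using R(2) by (cases p) (auto simp: hom_matrix_def shifted_forms_def split: if_splits)
  next
    show "aug_map F ` free_vecs (rk F 0) = I" using im by simp
  next
    show "{v \<in> free_vecs (rk F 0). aug_map F v = 0} = diff_map F 0 ` free_vecs (rk F 1)"
      using ex0 by (simp add: e_aug diff_map_def)
  next
    fix p
    show "{v \<in> free_vecs (rk F (Suc p)). diff_map F p v = 0} = diff_map F (Suc p) ` free_vecs (rk F (Suc (Suc p)))"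
      using ex1 ex2 by (cases p; cases "p - 1") (simp_all add: diff_map_def)
  qed
  then show ?thesis by blast
qed


section \<open>Hilbert functions\<close>

lemma hilbert_pdim: "int (hilbert I i) = int i + 1 - pdim I i"
proof -
  have "bp.dim (piece I i) \<le> Suc i"
    using bp.dim_mono_fd[of "piece I i" "forms i", OF _ fin_dim_forms] by (simp add: piece_def dim_forms)
  then show ?thesis by (simp add: hilbert_def pdim_def dim_forms)
qed

lemma pdim_nonneg: "0 \<le> pdim I i"
  by (simp add: pdim_def)

lemma pdim_le: "pdim I i \<le> int i + 1"
  using hilbert_pdim[of I i] by simp

lemma rdim_le: "is_ideal I \<Longrightarrow> rdim I i \<le> pdim I (Suc i)"
  using dim_R1_mult_le by (simp add: rdim_def pdim_def)

lemma rdim_gt: assumes "is_ideal I" "0 < pdim I i" shows "pdim I i + 1 \<le> rdim I i"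
proof -
  have ne: "piece I i \<noteq> {0}"
  proof
    assume "piece I i = {0}"
    then have "bp.dim (piece I i) = 0" by (simp only: dim_zero_space)
    then show False using assms(2) unfolding pdim_def by linarith
  qed
  have sub: "piece I i \<subseteq> forms i" by (simp add: piece_def)
  show ?thesis using dim_R1_mult_gt[OF subspace_piece[OF assms(1)] sub ne] unfolding rdim_def pdim_def by linarith
qed

text \<open>From \<mu> on the Hilbert function does not increase, so it is constant once it attains
  its minimum. There dim I_i + 1 \<le> dim R_1 I_i \<le> dim I_(i+1) = dim I_i + 1, which forces
  I_(i+1) = R_1 I_i.\<close>

lemma hilbert_stable:
  fixes I :: "'k::field bipoly set"
  assumes I: "graded_ideal I" and nz: "I \<noteq> {0}"
  shows "\<exists>\<mu> N. (\<forall>i. 0 < pdim I i \<longleftrightarrow> \<mu> \<le> i) \<and> \<mu> \<le> N \<and> \<mu> = init_deg (hilbert I) \<and>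
    (\<forall>i\<ge>N. pdim I (Suc i) = pdim I i + 1 \<and> piece I (Suc i) = R1_mult (piece I i))"
proof -
  have id: "is_ideal I" using I by (simp add: graded_ideal_def)
  have mono: "pdim I i + 1 \<le> pdim I (Suc i)" if "0 < pdim I i" for i
    using rdim_gt[OF id that] rdim_le[OF id, of i] by simp
  obtain f where f: "f \<in> I" "f \<noteq> 0" using nz id by (auto simp: is_ideal_def)
  obtain n where n: "f = (\<Sum>i<n. hom_part i f)" using hom_part_decomp by blast
  have "\<exists>i. hom_part i f \<noteq> 0"
  proof (rule ccontr)
    assume "\<not> ?thesis"
    then have "(\<Sum>i<n. hom_part i f) = 0" by simp
    then show False using n f(2) by simp
  qed
  then obtain i where i: "hom_part i f \<noteq> 0" by blast
  have "hom_part i f \<in> piece I i" using I f hom_part_forms by (auto simp: graded_ideal_def piece_def)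
  then have "\<not> piece I i \<subseteq> {0}" using i by blast
  then have "bp.dim (piece I i) \<noteq> 0" using bp.dim_eq_0_fd[OF fin_dim_piece] by blast
  then have ex: "0 < pdim I i" by (simp add: pdim_def)
  define \<mu> where "\<mu> = (LEAST i. 0 < pdim I i)"
  have up: "0 < pdim I (\<mu> + k)" for k
  proof (induction k)
    case 0
    then show ?case using LeastI[of "\<lambda>i. 0 < pdim I i", OF ex] by (simp add: \<mu>_def)
  next
    case (Suc k)
    then show ?case using mono[of "\<mu> + k"] by simp
  qed
  have iff: "0 < pdim I i \<longleftrightarrow> \<mu> \<le> i" for i
    using up[of "i - \<mu>"] Least_le[of "\<lambda>i. 0 < pdim I i" i] by (auto simp: \<mu>_def)
  have init: "\<mu> = init_deg (hilbert I)"
  proof -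
    have "hilbert I i < i + 1 \<longleftrightarrow> 0 < pdim I i" for i using hilbert_pdim[of I i] by linarith
    then show ?thesis by (simp add: \<mu>_def init_deg_def)
  qed
  obtain N where N: "\<mu> \<le> N" "\<And>i. i \<ge> \<mu> \<Longrightarrow> hilbert I N \<le> hilbert I i"
    using ex_has_least_nat[of "\<lambda>i. \<mu> \<le> i" \<mu> "hilbert I"] by auto
  have dec: "hilbert I (Suc i) \<le> hilbert I i" if "i \<ge> \<mu>" for i
    using mono[of i] iff[of i] that hilbert_pdim[of I i] hilbert_pdim[of I "Suc i"] by simp
  have const: "hilbert I (N + k) = hilbert I N" for k
  proof (induction k)
    case (Suc k)
    then show ?case using dec[of "N + k"] N(2)[of "Suc (N + k)"] N(1) by simp
  qed simp
  have st: "pdim I (Suc i) = pdim I i + 1 \<and> piece I (Suc i) = R1_mult (piece I i)" if i: "i \<ge> N" for i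
  proof
    show p: "pdim I (Suc i) = pdim I i + 1"
      using const[of "i - N"] const[of "Suc i - N"] i hilbert_pdim[of I i] hilbert_pdim[of I "Suc i"] by simp
    have "pdim I i + 1 \<le> rdim I i" using rdim_gt[OF id] iff[of i] N(1) i by simp
    then have "bp.dim (piece I (Suc i)) \<le> bp.dim (R1_mult (piece I i))" using p by (simp add: pdim_def rdim_def)
    then show "piece I (Suc i) = R1_mult (piece I i)"
      using bp.subspace_eq_fd[OF subspace_R1_mult R1_mult_piece_sub[OF id] fin_dim_piece] by metis
  qed
  show ?thesis using iff N(1) init st by blast
qed

lemma nu_beta:
  fixes I :: "'k::field bipoly set"
  assumes I: "graded_ideal I" and nz: "I \<noteq> {0}"
  shows "int (nu I i) = pdim I i - pred_shift (rdim I) i" "int (beta I i) = int (nu I i) - second_diff (pdim I) i"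
proof -
  obtain N where st: "\<And>i. i \<ge> N \<Longrightarrow> pdim I (Suc i) = pdim I i + 1 \<and> piece I (Suc i) = R1_mult (piece I i)"
    using hilbert_stable[OF I nz] by blast
  from resolution_exists[OF I st] have "\<exists>F. graded_free_resolution F I" .
  then have F: "graded_free_resolution (SOME F. graded_free_resolution F I) I" by (rule someI_ex)
  have n: "nu I i = torF (SOME F. graded_free_resolution F I) 0 i" "beta I i = torF (SOME F. graded_free_resolution F I) 1 i" for i
    by (simp_all add: nu_def beta_def tor_dim_def torF_def Let_def)
  show "int (nu I i) = pdim I i - pred_shift (rdim I) i" "int (beta I i) = int (nu I i) - second_diff (pdim I) i"
    unfolding n using tor0_resolution[OF I F] tor1_resolution[OF I F] by auto
qed

text \<open>A nonzero constant in I would be a unit.\<close>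

lemma pdim_0:
  fixes I :: "'k::field bipoly set"
  assumes id: "is_ideal I" and ne: "I \<noteq> UNIV" shows "pdim I 0 = 0"
proof -
  have "piece I 0 \<subseteq> {0}"
  proof
    fix f assume f: "f \<in> piece I 0"
    then have e: "f = kscale (bcoeff f 0 0) 1" by (intro forms_0_kscale) (simp add: piece_def)
    have "bcoeff f 0 0 = 0"
    proof (rule ccontr)
      assume c: "bcoeff f 0 0 \<noteq> 0"
      have "r \<in> I" for r
      proof -
        have "kscale (inverse (bcoeff f 0 0)) r * f = r"
          by (subst e) (simp add: kscale_mult c)
        moreover have "kscale (inverse (bcoeff f 0 0)) r * f \<in> I" using f id by (simp add: piece_def is_ideal_def)
        ultimately show ?thesis by simp
      qed
      then show False using ne by blast
    qed
    then show "f \<in> {0}" using e by simp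
  qed
  then show ?thesis using bp.dim_eq_0_fd[OF fin_dim_piece[of I 0]] by (simp add: pdim_def)
qed

lemma hdiff_pdim: "i \<ge> 1 \<Longrightarrow> hdiff (hilbert I) i = pdim I i - pdim I (i - 1) - 1"
  using hilbert_pdim[of I i] hilbert_pdim[of I "i - 1"] by (simp add: hdiff_def of_nat_diff)

lemma tau_pdim: "tau (piece I i) = rdim I i - pdim I i"
  by (simp add: tau_def rdim_def pdim_def)

text \<open>With p_i = dim I_i and r_i = dim R_1 I_i, everything is linear arithmetic from p_i + 1
  \<le> r_i \<le> p_(i+1) and r_i + p_(i-1) \<le> 2 p_i, by e_i = p_i - p_(i-1) - 1, \<tau>(I_i) =
  r_i - p_i and \<nu>_(i+1) = p_(i+1) - r_i.\<close>

theorem ideal_invariants: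
  fixes I :: "'k::field bipoly set" and H :: "nat \<Rightarrow> nat" and \<mu> :: nat and e :: "nat \<Rightarrow> int"
  assumes gr: "graded_ideal I" and nz: "I \<noteq> {0}" and ne: "I \<noteq> UNIV"
    and H: "H = hilbert I" and mu: "\<mu> = init_deg H" and e: "e = hdiff H"
  shows "(\<exists>i. H i < i + 1) \<and> \<mu> \<ge> 1 \<and> (\<forall>i<\<mu>. H i = i + 1) \<and> H \<mu> \<le> \<mu> \<and> (\<forall>i\<ge>\<mu>. H (i + 1) \<le> H i)"
    and "int (nu I \<mu>) = e \<mu> + 1"
    and "\<forall>i\<le>\<mu>. beta I i = 0"
    and "\<forall>i<\<mu>. tau (piece I i) = 0"
    and "\<forall>i\<ge>\<mu>.
      e (i + 1) \<ge> int (nu I (i + 1)) \<and> int (nu I (i + 1)) \<ge> pos_part (e (i + 1) - e i) \<and>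
      e i \<ge> int (beta I (i + 1)) \<and> int (beta I (i + 1)) \<ge> pos_part (e i - e (i + 1)) \<and>
      tau (piece I i) = e (i + 1) + 1 - int (nu I (i + 1)) \<and>
      tau (piece I i) = e i + 1 - int (beta I (i + 1)) \<and>
      tau (piece I i) = tau (piece I (i - 1)) + int (nu I i) - int (beta I (i + 1)) \<and>
      1 \<le> tau (piece I i) \<and> tau (piece I i) \<le> 1 + min (e i) (e (i + 1))"
proof -
  have id: "is_ideal I" using gr by (simp add: graded_ideal_def)
  obtain m where pos: "\<And>i. 0 < pdim I i \<longleftrightarrow> m \<le> i" and m: "m = init_deg (hilbert I)"
    using hilbert_stable[OF gr nz] by blast
  have mm: "m = \<mu>" using m mu H by simp
  have p0: "pdim I 0 = 0" by (rule pdim_0[OF id ne])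
  have m1: "\<mu> \<ge> 1" using pos[of 0] p0 mm by (cases \<mu>) auto
  have zero: "pdim I i = 0" if "i < \<mu>" for i using pos[of i] pdim_nonneg[of I i] that mm by linarith
  have posi: "0 < pdim I i" if "i \<ge> \<mu>" for i using pos[of i] that mm by simp
  have rz: "rdim I i = 0" if "i < \<mu>" for i
    using rdim_upper[OF id, of i] zero[OF that] by (cases i) (auto simp: rdim_def pdim_def)
  have h: "int (H i) = int i + 1 - pdim I i" for i using hilbert_pdim H by metis
  have r1: "pdim I i + 1 \<le> rdim I i" if "i \<ge> \<mu>" for i by (rule rdim_gt[OF id posi[OF that]])
  have r2: "rdim I i \<le> pdim I (Suc i)" for i by (rule rdim_le[OF id])
  have ee: "e i = pdim I i - pdim I (i - 1) - 1" if "i \<ge> 1" for i using hdiff_pdim that e H by metis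
  note nb = nu_beta[OF gr nz]
  show "(\<exists>i. H i < i + 1) \<and> \<mu> \<ge> 1 \<and> (\<forall>i<\<mu>. H i = i + 1) \<and> H \<mu> \<le> \<mu> \<and> (\<forall>i\<ge>\<mu>. H (i + 1) \<le> H i)"
  proof (intro conjI allI impI exI)
    show "H \<mu> < \<mu> + 1" "H \<mu> \<le> \<mu>" using h[of \<mu>] posi[of \<mu>] by linarith+
    show "H i = i + 1" if "i < \<mu>" for i using h[of i] zero[OF that] by linarith
    show "H (i + 1) \<le> H i" if "i \<ge> \<mu>" for i using h[of i] h[of "i + 1"] r1[OF that] r2[of i] by simp
  qed (rule m1)
  show "int (nu I \<mu>) = e \<mu> + 1"
    using nb(1)[of \<mu>] m1 ee[OF m1] zero[of "\<mu> - 1"] rz[of "\<mu> - 1"] by (simp add: pred_shift_def)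
  show "\<forall>i\<le>\<mu>. beta I i = 0"
  proof (intro allI impI)
    fix i assume i: "i \<le> \<mu>"
    have s: "pred_shift (pdim I) i = 0" "pred_shift (rdim I) i = 0" "pred_shift (pred_shift (pdim I)) i = 0"
      using i zero[of "i - 1"] rz[of "i - 1"] zero[of "i - 1 - 1"] by (simp_all add: pred_shift_def)
    then show "beta I i = 0" using nb[of i] by (simp add: second_diff_def)
  qed
  show "\<forall>i<\<mu>. tau (piece I i) = 0" by (simp add: tau_pdim zero rz)
  show "\<forall>i\<ge>\<mu>.
      e (i + 1) \<ge> int (nu I (i + 1)) \<and> int (nu I (i + 1)) \<ge> pos_part (e (i + 1) - e i) \<and>
      e i \<ge> int (beta I (i + 1)) \<and> int (beta I (i + 1)) \<ge> pos_part (e i - e (i + 1)) \<and>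
      tau (piece I i) = e (i + 1) + 1 - int (nu I (i + 1)) \<and>
      tau (piece I i) = e i + 1 - int (beta I (i + 1)) \<and>
      tau (piece I i) = tau (piece I (i - 1)) + int (nu I i) - int (beta I (i + 1)) \<and>
      1 \<le> tau (piece I i) \<and> tau (piece I i) \<le> 1 + min (e i) (e (i + 1))"
  proof (intro allI impI)
    fix i assume i: "i \<ge> \<mu>"
    then obtain k where k: "i = Suc k" using m1 by (cases i) auto
    have n1: "int (nu I (Suc i)) = pdim I (Suc i) - rdim I i" using nb(1)[of "Suc i"] by simp
    have n0: "int (nu I i) = pdim I i - rdim I k" using nb(1)[of i] k by simp
    have b1: "int (beta I (Suc i)) = int (nu I (Suc i)) - (pdim I (Suc i) - 2 * pdim I i + pdim I k)"
      using nb(2)[of "Suc i"] k by (simp add: second_diff_def)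
    have e0: "e i = pdim I i - pdim I k - 1" using ee[of i] k by simp
    have e1: "e (Suc i) = pdim I (Suc i) - pdim I i - 1" using ee[of "Suc i"] by simp
    have u: "rdim I i + pdim I k \<le> 2 * pdim I i" using rdim_upper[OF id, of i] k by simp
    note r1[OF i] r2[of i]
    then show "e (i + 1) \<ge> int (nu I (i + 1)) \<and> int (nu I (i + 1)) \<ge> pos_part (e (i + 1) - e i) \<and>
      e i \<ge> int (beta I (i + 1)) \<and> int (beta I (i + 1)) \<ge> pos_part (e i - e (i + 1)) \<and>
      tau (piece I i) = e (i + 1) + 1 - int (nu I (i + 1)) \<and>
      tau (piece I i) = e i + 1 - int (beta I (i + 1)) \<and>
      tau (piece I i) = tau (piece I (i - 1)) + int (nu I i) - int (beta I (i + 1)) \<and>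
      1 \<le> tau (piece I i) \<and> tau (piece I i) \<le> 1 + min (e i) (e (i + 1))"
      using n1 n0 b1 e0 e1 u by (simp add: tau_pdim pos_part_def k)
  qed
qed


section \<open>Minors\<close>

text \<open>Columns are picked by a function into an arbitrary index type rather than by a set:
  single columns can then be exchanged, and triples (component, exponent, exponent) can serve as
  columns.\<close>

definition minor :: "nat \<Rightarrow> (nat \<Rightarrow> 's \<Rightarrow> 'k::field) \<Rightarrow> (nat \<Rightarrow> 's) \<Rightarrow> 'k" where
  "minor q M \<sigma> = Determinant.det (Matrix.mat q q (\<lambda>(r, c). M r (\<sigma> c)))"

lemma minor_cong:
  "(\<And>r c. r < q \<Longrightarrow> c < q \<Longrightarrow> M r (\<sigma> c) = M' r (\<sigma>' c)) \<Longrightarrow> minor q M \<sigma> = minor q M' \<sigma>'"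
  unfolding minor_def by (intro arg_cong[of _ _ Determinant.det] eq_matI) auto

text \<open>Laplace expansion: the cofactors along column k do not involve that column, so the minor
  is a linear form in it. If k is the last index, the bottom cofactor is the minor without row and
  column k.\<close>

lemma minor_expand_column:
  assumes k: "k < q"
  shows "\<exists>cof. (\<forall>s. minor q M (\<sigma>(k := s)) = (\<Sum>r<q. cof r * M r s)) \<and>
    (q = Suc k \<longrightarrow> cof k = minor k M \<sigma>)"
proof -
  define A where "A s = Matrix.mat q q (\<lambda>(r, c). M r ((\<sigma>(k := s)) c))" for s
  \<comment> \<open>The column entered as \<open>undefined\<close> is deleted in each of these
    cofactors.\<close>
  define cof where "cof r = cofactor (A undefined) r k" for r
  have d: "mat_delete (A s) r k = mat_delete (A undefined) r k" if "r < q" for s r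
    by (rule eq_matI) (use that k in \<open>auto simp: mat_delete_def A_def\<close>)
  have "minor q M (\<sigma>(k := s)) = (\<Sum>r<q. cof r * M r s)" for s
  proof -
    have "minor q M (\<sigma>(k := s)) = (\<Sum>r<q. A s $$ (r, k) * cofactor (A s) r k)"
      using laplace_expansion_column[of "A s" q k] k by (simp add: minor_def A_def)
    also have "\<dots> = (\<Sum>r<q. cof r * M r s)"
    proof (rule sum.cong[OF refl])
      fix r assume r: "r \<in> {..<q}"
      have "A s $$ (r, k) = M r s" using r k by (simp add: A_def)
      moreover have "cofactor (A s) r k = cof r" using d[of r s] r by (simp add: cof_def cofactor_def)
      ultimately show "A s $$ (r, k) * cofactor (A s) r k = cof r * M r s" by simp
    qed
    finally show ?thesis .
  qed
  moreover have "cof k = minor k M \<sigma>" if "q = Suc k"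
  proof -
    have "mat_delete (A undefined) k k = Matrix.mat k k (\<lambda>(r, c). M r (\<sigma> c))"
      by (rule eq_matI) (use that in \<open>auto simp: mat_delete_def A_def\<close>)
    then show ?thesis by (simp add: cof_def cofactor_def minor_def)
  qed
  ultimately show ?thesis by blast
qed

lemma minor_eq_0_of_dup:
  assumes "k < q" "l < q" "k \<noteq> l" "\<sigma> k = \<sigma> l" shows "minor q M \<sigma> = 0"
  unfolding minor_def
  by (rule det_identical_columns[of _ q k l]) (use assms in \<open>auto intro!: eq_vecI\<close>)

lemma minor_independent:
  assumes "minor q M \<sigma> \<noteq> 0" "\<And>l. l < q \<Longrightarrow> (\<Sum>r<q. c r * M r (\<sigma> l)) = 0" "r < q"
  shows "c r = 0"
proof (rule ccontr)
  assume nz: "c r \<noteq> 0"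
  let ?A = "Matrix.mat q q (\<lambda>(i, j). M j (\<sigma> i))"
  have "?A = transpose_mat (Matrix.mat q q (\<lambda>(r, c). M r (\<sigma> c)))" by (rule eq_matI) auto
  then have "Determinant.det ?A \<noteq> 0"
    using assms(1) Determinant.det_transpose[of "Matrix.mat q q (\<lambda>(r, c). M r (\<sigma> c))" q] by (simp add: minor_def)
  moreover have "?A *\<^sub>v vec q c = 0\<^sub>v q"
    by (rule eq_vecI) (use assms(2) in \<open>auto simp: scalar_prod_def mult.commute atLeast0LessThan\<close>)
  moreover have "vec q c \<noteq> 0\<^sub>v q" using nz assms(3) by (metis index_vec index_zero_vec(1))
  ultimately show False using det_0_iff_vec_prod_zero_field[of ?A q] by (metis mat_carrier vec_carrier)
qed

text \<open>Induction on the number of rows: expansion along a new column is a combination of the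
  rows whose last coefficient is the nonzero smaller minor, and by independence some column of
  \<open>S\<close> does not annihilate it.\<close>

lemma minor_exists:
  assumes "\<And>c. (\<And>s. s \<in> S \<Longrightarrow> (\<Sum>r<q. c r * M r s) = 0) \<Longrightarrow> (\<forall>r<q. c r = 0)"
  shows "\<exists>\<sigma>. (\<forall>l<q. \<sigma> l \<in> S) \<and> minor q M \<sigma> \<noteq> 0"
  using assms
proof (induction q)
  case 0
  then show ?case by (simp add: minor_def)
next
  case (Suc q)
  have "\<forall>r<q. c r = 0" if "\<And>s. s \<in> S \<Longrightarrow> (\<Sum>r<q. c r * M r s) = 0" for c
  proof -
    have "\<forall>r<Suc q. (if r < q then c r else 0) = 0"
      by (rule Suc.prems) (use that in simp)
    then show ?thesis by (metis less_SucI)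
  qed
  from Suc.IH[OF this] obtain \<sigma> where \<sigma>: "\<forall>l<q. \<sigma> l \<in> S" "minor q M \<sigma> \<noteq> 0" by blast
  obtain cof where cof: "\<And>s. minor (Suc q) M (\<sigma>(q := s)) = (\<Sum>r<Suc q. cof r * M r s)" "cof q = minor q M \<sigma>"
    using minor_expand_column[of q "Suc q" M \<sigma>] by blast
  have "\<exists>s\<in>S. minor (Suc q) M (\<sigma>(q := s)) \<noteq> 0"
  proof (rule ccontr)
    assume "\<not> ?thesis"
    then have "\<forall>r<Suc q. cof r = 0" by (intro Suc.prems) (metis cof(1))
    then show False using cof(2) \<sigma>(2) by simp
  qed
  then obtain s where "s \<in> S" "minor (Suc q) M (\<sigma>(q := s)) \<noteq> 0" by blast
  moreover have "\<forall>l<Suc q. (\<sigma>(q := s)) l \<in> S" using \<sigma>(1) calculation(1) by (simp add: less_Suc_eq)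
  ultimately show ?case by blast
qed

lemma permutes_lt: "p permutes {0..<n} \<Longrightarrow> i < n \<Longrightarrow> p i < (n :: nat)"
  using permutes_in_image[of p "{0..<n}" i] by simp

lemma minor_permute:
  assumes "\<pi> permutes {0..<q}"
  shows "minor q M (\<sigma> \<circ> \<pi>) = signof \<pi> * minor q M \<sigma>"
proof -
  let ?B = "\<lambda>\<sigma>. Matrix.mat q q (\<lambda>(i, j). M j (\<sigma> i))"
  have t: "minor q M \<tau> = Determinant.det (?B \<tau>)" for \<tau>
  proof -
    have "?B \<tau> = transpose_mat (Matrix.mat q q (\<lambda>(r, c). M r (\<tau> c)))" by (rule eq_matI) auto
    then show ?thesis using Determinant.det_transpose[of "Matrix.mat q q (\<lambda>(r, c). M r (\<tau> c))" q] by (simp add: minor_def)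
  qed
  have "?B (\<sigma> \<circ> \<pi>) = Matrix.mat q q (\<lambda>(i, j). ?B \<sigma> $$ (\<pi> i, j))"
    by (rule eq_matI) (use permutes_lt[OF assms] in auto)
  then show ?thesis using det_permute_rows[of "?B \<sigma>" q \<pi>] assms by (simp add: t)
qed

lemma minor_change_of_basis:
  assumes "\<And>r s. r < q \<Longrightarrow> M' r s = (\<Sum>l<q. C r l * M l s)"
  shows "minor q M' \<sigma> = Determinant.det (Matrix.mat q q (\<lambda>(r, l). C r l)) * minor q M \<sigma>"
proof -
  let ?C = "Matrix.mat q q (\<lambda>(r, l). C r l)" and ?A = "Matrix.mat q q (\<lambda>(r, c). M r (\<sigma> c))"
  have "Matrix.mat q q (\<lambda>(r, c). M' r (\<sigma> c)) = ?C * ?A"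
    by (rule eq_matI) (auto simp: assms scalar_prod_def atLeast0LessThan)
  then show ?thesis by (simp add: minor_def Determinant.det_mult[of _ q])
qed


section \<open>Polynomial curves\<close>

definition poly_fun :: "('k::field \<Rightarrow> 'k) \<Rightarrow> bool" where
  "poly_fun f \<longleftrightarrow> (\<exists>p. \<forall>t. f t = Polynomial.poly p t)"

definition poly_curve :: "('k::field \<Rightarrow> 'k bipoly) \<Rightarrow> bool" where
  "poly_curve f \<longleftrightarrow> (\<forall>a b. poly_fun (\<lambda>t. bcoeff (f t) a b))"

lemma poly_fun_const: "poly_fun (\<lambda>t. c)"
  unfolding poly_fun_def by (rule exI[of _ "[:c:]"]) simp

lemma poly_fun_id: "poly_fun (\<lambda>t. t)"
  unfolding poly_fun_def by (rule exI[of _ "[:0, 1:]"]) simp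

lemma poly_fun_add: "poly_fun f \<Longrightarrow> poly_fun g \<Longrightarrow> poly_fun (\<lambda>t. f t + g t)"
  unfolding poly_fun_def by (metis poly_add)

lemma poly_fun_mult: "poly_fun f \<Longrightarrow> poly_fun g \<Longrightarrow> poly_fun (\<lambda>t. f t * g t)"
  unfolding poly_fun_def by (metis poly_mult)

lemma poly_fun_minus: "poly_fun f \<Longrightarrow> poly_fun (\<lambda>t. - f t)"
  unfolding poly_fun_def by (metis poly_minus)

lemma poly_fun_sum: "(\<And>x. x \<in> A \<Longrightarrow> poly_fun (f x)) \<Longrightarrow> poly_fun (\<lambda>t. \<Sum>x\<in>A. f x t)"
  by (induction A rule: infinite_finite_induct) (auto intro: poly_fun_const poly_fun_add)

lemma poly_fun_prod: "(\<And>x. x \<in> A \<Longrightarrow> poly_fun (f x)) \<Longrightarrow> poly_fun (\<lambda>t. \<Prod>x\<in>A. f x t)"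
  by (induction A rule: infinite_finite_induct) (auto intro: poly_fun_const poly_fun_mult)

lemma poly_fun_power: "poly_fun f \<Longrightarrow> poly_fun (\<lambda>t. f t ^ n)"
  by (induction n) (auto intro: poly_fun_const poly_fun_mult)

lemma poly_fun_det:
  assumes "\<And>i j. i < n \<Longrightarrow> j < n \<Longrightarrow> poly_fun (\<lambda>t. A t i j)"
  shows "poly_fun (\<lambda>t. Determinant.det (Matrix.mat n n (\<lambda>(i, j). A t i j)))"
proof -
  have "Determinant.det (Matrix.mat n n (\<lambda>(i, j). A t i j))
      = (\<Sum>p | p permutes {0..<n}. signof p * (\<Prod>i = 0..<n. A t i (p i)))" for t
    unfolding Determinant.det_def by (auto intro!: sum.cong prod.cong simp: permutes_lt)
  moreover have "poly_fun (\<lambda>t. \<Sum>p | p permutes {0..<n}. signof p * (\<Prod>i = 0..<n. A t i (p i)))"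
    by (intro poly_fun_sum poly_fun_mult poly_fun_const poly_fun_prod assms) (auto simp: permutes_lt)
  ultimately show ?thesis by simp
qed

lemma poly_fun_minor: "(\<And>r c. r < q \<Longrightarrow> c < q \<Longrightarrow> poly_fun (\<lambda>t. M t r (\<sigma> c))) \<Longrightarrow> poly_fun (\<lambda>t. minor q (M t) \<sigma>)"
  unfolding minor_def by (rule poly_fun_det)

text \<open>The source of every genericity statement. Over a finite field it says nothing; the final
  application is over an algebraic closure.\<close>

lemma poly_fun_nonzero:
  assumes "poly_fun f" "f 0 \<noteq> 0" shows "\<forall>\<^sub>F t in cofinite. f t \<noteq> 0"
proof -
  obtain p where p: "\<And>t. f t = Polynomial.poly p t" using assms(1) unfolding poly_fun_def by blast
  then have "p \<noteq> 0" using assms(2) by auto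
  then show ?thesis using poly_roots_finite[of p] by (simp add: eventually_cofinite p)
qed

lemma poly_curve_const: "poly_curve (\<lambda>t. f)"
  by (simp add: poly_curve_def poly_fun_const)

lemma poly_curve_add: "poly_curve f \<Longrightarrow> poly_curve g \<Longrightarrow> poly_curve (\<lambda>t. f t + g t)"
  by (simp add: poly_curve_def poly_fun_add)

lemma poly_curve_mult: "poly_curve f \<Longrightarrow> poly_curve g \<Longrightarrow> poly_curve (\<lambda>t. f t * g t)"
  by (auto simp: poly_curve_def bcoeff_mult intro!: poly_fun_sum poly_fun_mult)

lemma poly_curve_sum: "(\<And>x. x \<in> A \<Longrightarrow> poly_curve (f x)) \<Longrightarrow> poly_curve (\<lambda>t. \<Sum>x\<in>A. f x t)"
  by (auto simp: poly_curve_def bcoeff_sum intro!: poly_fun_sum)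

lemma poly_curve_kscale: "poly_fun p \<Longrightarrow> poly_curve f \<Longrightarrow> poly_curve (\<lambda>t. kscale (p t) (f t))"
  by (auto simp: poly_curve_def intro!: poly_fun_mult)

lemma fv_zero_iff: "v = 0 \<longleftrightarrow> (\<forall>j a b. bcoeff (v j) a b = 0)"
proof
  assume z: "\<forall>j a b. bcoeff (v j) a b = 0"
  show "v = 0"
  proof (rule ext)
    fix j show "v j = 0 j" using z by (simp add: bipoly_eqI)
  qed
qed simp

lemma vscale_sum_zero_iff:
  "(\<Sum>r<q. vscale (c r) (u r)) = 0 \<longleftrightarrow> (\<forall>j a b. (\<Sum>r<q. c r * bcoeff (u r j) a b) = 0)"
proof -
  have "bcoeff ((\<Sum>r<q. vscale (c r) (u r)) j) a b = (\<Sum>r<q. c r * bcoeff (u r j) a b)" for j a b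
    by (simp add: fun_sum_apply bcoeff_sum vscale_def)
  then show ?thesis unfolding fv_zero_iff by simp
qed

text \<open>Independence at t = 0 is witnessed by a nonzero minor of the coefficient matrix, which
  is a polynomial in t.\<close>

lemma lin_indep_generic:
  assumes p: "\<And>l j. l < q \<Longrightarrow> poly_curve (\<lambda>t. u t l j)" and ind: "fv.lin_indep q (u 0)"
  shows "\<forall>\<^sub>F t in cofinite. fv.lin_indep q (u t)"
proof -
  define M where "M t r s = (case s of (j, a, b) \<Rightarrow> bcoeff (u t r j) a b)" for t r and s :: "nat \<times> nat \<times> nat"
  have "\<exists>\<sigma>. (\<forall>l<q. \<sigma> l \<in> UNIV) \<and> minor q (M 0) \<sigma> \<noteq> 0"
  proof (rule minor_exists)
    fix c assume c: "\<And>s. s \<in> UNIV \<Longrightarrow> (\<Sum>r<q. c r * M 0 r s) = 0"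
    have "(\<Sum>r<q. vscale (c r) (u 0 r)) = 0"
      unfolding vscale_sum_zero_iff
    proof (intro allI)
      fix j a b show "(\<Sum>r<q. c r * bcoeff (u 0 r j) a b) = 0" using c[of "(j, a, b)"] by (simp add: M_def)
    qed
    then show "\<forall>r<q. c r = 0" using ind unfolding fv.lin_indep_def by blast
  qed
  then obtain \<sigma> where \<sigma>: "minor q (M 0) \<sigma> \<noteq> 0" by blast
  have "poly_fun (\<lambda>t. minor q (M t) \<sigma>)"
  proof (rule poly_fun_minor)
    fix r c assume "r < q"
    obtain j a b where "\<sigma> c = (j, a, b)" by (metis prod_cases3)
    then show "poly_fun (\<lambda>t. M t r (\<sigma> c))" using p[OF \<open>r < q\<close>, of j] by (simp add: M_def poly_curve_def)
  qed
  then have "\<forall>\<^sub>F t in cofinite. minor q (M t) \<sigma> \<noteq> 0" by (rule poly_fun_nonzero) (rule \<sigma>)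
  then show ?thesis
  proof (rule eventually_mono)
    fix t assume t: "minor q (M t) \<sigma> \<noteq> 0"
    show "fv.lin_indep q (u t)"
      unfolding fv.lin_indep_def vscale_sum_zero_iff
    proof (intro allI impI)
      fix c l assume z: "\<forall>j a b. (\<Sum>r<q. c r * bcoeff (u t r j) a b) = 0" and l: "l < q"
      show "c l = 0"
      proof (rule minor_independent[OF t _ l])
        fix i
        obtain j a b where "\<sigma> i = (j, a, b)" by (metis prod_cases3)
        then show "(\<Sum>r<q. c r * M t r (\<sigma> i)) = 0" using z by (simp add: M_def)
      qed
    qed
  qed
qed

lemma (in linear_space) lin_indep_ex:
  assumes "fin_dim S" "q \<le> dim S" shows "\<exists>u. lin_indep q u \<and> (\<forall>l<q. u l \<in> S)"
proof (rule lin_indep_exists[OF assms])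
  fix u assume "lin_indep q u" "\<And>l. l < q \<Longrightarrow> u l \<in> S"
  then show ?thesis by blast
qed

lemma (in linear_space) span_indexed:
  assumes "v \<in> span (y ` {..<(m :: nat)})"
  shows "\<exists>c. v = (\<Sum>k<m. scale (c k) (y k))"
proof -
  have "subspace {v. \<exists>c. v = (\<Sum>k<m. scale (c k) (y k))}"
    unfolding subspace_def
  proof (intro conjI ballI allI)
    show "0 \<in> {v. \<exists>c. v = (\<Sum>k<m. scale (c k) (y k))}" by (auto intro!: exI[of _ "\<lambda>_. 0"])
    fix u w assume "u \<in> {v. \<exists>c. v = (\<Sum>k<m. scale (c k) (y k))}" "w \<in> {v. \<exists>c. v = (\<Sum>k<m. scale (c k) (y k))}"
    then obtain c d where "u = (\<Sum>k<m. scale (c k) (y k))" "w = (\<Sum>k<m. scale (d k) (y k))" by blast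
    then show "u + w \<in> {v. \<exists>c. v = (\<Sum>k<m. scale (c k) (y k))}"
      by (auto intro!: exI[of _ "\<lambda>k. c k + d k"] simp: scale_left_distrib sum.distrib)
  next
    fix a u assume "u \<in> {v. \<exists>c. v = (\<Sum>k<m. scale (c k) (y k))}"
    then obtain c where "u = (\<Sum>k<m. scale (c k) (y k))" by blast
    then show "scale a u \<in> {v. \<exists>c. v = (\<Sum>k<m. scale (c k) (y k))}"
      by (auto intro!: exI[of _ "\<lambda>k. a * c k"] simp: scale_sum_right)
  qed
  moreover have "y ` {..<m} \<subseteq> {v. \<exists>c. v = (\<Sum>k<m. scale (c k) (y k))}"
  proof clarify
    fix l assume l: "l < m"
    have "(\<Sum>k<m. scale (if k = l then 1 else 0) (y k)) = (\<Sum>k<m. if k = l then y l else 0)"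
      by (rule sum.cong) auto
    then show "\<exists>c. y l = (\<Sum>k<m. scale (c k) (y k))" using l by (intro exI[of _ "\<lambda>k. if k = l then 1 else 0"]) simp
  qed
  ultimately show ?thesis using assms span_minimal by blast
qed

text \<open>If \<open>A\<close> is onto, a solution of \<open>A v = 0\<close> extends to a polynomial family of solutions of
  \<open>(A + t B) v = 0\<close>, by Cramer's rule on a right inverse of \<open>A\<close>.\<close>

lemma kernel_curve:
  fixes A B :: "(nat \<Rightarrow> 'k::field bipoly) \<Rightarrow> nat \<Rightarrow> 'k bipoly"
  assumes A: "Vector_Spaces.linear vscale vscale A" and B: "Vector_Spaces.linear vscale vscale B"
    and U: "fv.subspace U" and Y: "fv.subspace Y" "fv.fin_dim Y" and AU: "A ` U = Y" and BU: "B ` U \<subseteq> Y"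
    and v0: "v0 \<in> U" "A v0 = 0"
  shows "\<exists>v. v 0 = v0 \<and> (\<forall>t. v t \<in> U \<and> A (v t) + vscale t (B (v t)) = 0) \<and> (\<forall>j. poly_curve (\<lambda>t. v t j))"
proof -
  define m where "m = fv.dim Y"
  obtain y where y: "fv.lin_indep m y" "\<And>l. l < m \<Longrightarrow> y l \<in> Y"
    using fv.lin_indep_ex[OF Y(2), of m] by (auto simp: m_def)
  have sp: "fv.span (y ` {..<m}) = Y" by (rule fv.lin_indep_span[OF Y(2,1) y m_def])
  have "\<forall>l\<in>{..<m}. \<exists>x. x \<in> U \<and> A x = y l"
  proof
    fix l assume "l \<in> {..<m}"
    then have "y l \<in> A ` U" using y(2) AU by simp
    then show "\<exists>x. x \<in> U \<and> A x = y l" by (auto elim!: imageE)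
  qed
  from bchoice[OF this] obtain x where "\<forall>l\<in>{..<m}. x l \<in> U \<and> A (x l) = y l" ..
  then have x: "\<And>l. l < m \<Longrightarrow> x l \<in> U" "\<And>l. l < m \<Longrightarrow> A (x l) = y l" by simp_all
  have "\<exists>c. B w = (\<Sum>k<m. vscale (c k) (y k))" if "w \<in> U" for w
    using fv.span_indexed[of "B w" y m] BU that sp by blast
  then obtain \<theta>' where \<theta>': "\<And>w. w \<in> U \<Longrightarrow> B w = (\<Sum>k<m. vscale (\<theta>' w k) (y k))" by metis
  \<comment> \<open>\<open>x\<close> is a right inverse of A on the basis \<open>y\<close>; \<theta>
    is the matrix of B following it, and \<beta> the coordinates of B v0.\<close>
  define \<theta> where "\<theta> k l = \<theta>' (x l) k" for k l
  define \<beta> where "\<beta> = \<theta>' v0"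
  \<comment> \<open>The equation to solve is (1 + t \<theta>) w = \<beta>. The adjugate solves it up
    to the factor \<delta> = det (1 + t \<theta>), without division, so that the solution stays
    polynomial in t.\<close>
  define T where "T t = Matrix.mat m m (\<lambda>(k, l). (if k = l then 1 else 0) + t * \<theta> k l)" for t
  define \<delta> where "\<delta> t = Determinant.det (T t)" for t
  define w where "w t l = (\<Sum>k<m. adj_mat (T t) $$ (l, k) * \<beta> k)" for t l
  have T: "T t \<in> carrier_mat m m" for t by (simp add: T_def)
  have cr: "w t k + t * (\<Sum>l<m. \<theta> k l * w t l) = \<delta> t * \<beta> k" if k: "k < m" for t k
  proof -
    have "w t k + t * (\<Sum>l<m. \<theta> k l * w t l) = (\<Sum>l<m. (if l = k then w t l else 0) + t * \<theta> k l * w t l)"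
      using k by (simp add: sum.distrib sum_distrib_left mult.assoc)
    also have "\<dots> = (\<Sum>l<m. T t $$ (k, l) * w t l)"
      by (rule sum.cong) (use k in \<open>auto simp: T_def algebra_simps\<close>)
    also have "\<dots> = (\<Sum>l<m. \<Sum>j<m. T t $$ (k, l) * (adj_mat (T t) $$ (l, j) * \<beta> j))"
      by (simp add: w_def sum_distrib_left)
    also have "\<dots> = (\<Sum>j<m. \<Sum>l<m. T t $$ (k, l) * (adj_mat (T t) $$ (l, j) * \<beta> j))" by (rule sum.swap)
    also have "\<dots> = (\<Sum>j<m. (T t * adj_mat (T t)) $$ (k, j) * \<beta> j)"
    proof (rule sum.cong[OF refl])
      fix j assume j: "j \<in> {..<m}"
      have "(T t * adj_mat (T t)) $$ (k, j) = (\<Sum>l<m. T t $$ (k, l) * adj_mat (T t) $$ (l, j))"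
        using k j T[of t] adj_mat(1)[OF T[of t]] by (simp add: scalar_prod_def atLeast0LessThan)
      then show "(\<Sum>l<m. T t $$ (k, l) * (adj_mat (T t) $$ (l, j) * \<beta> j)) = (T t * adj_mat (T t)) $$ (k, j) * \<beta> j"
        by (simp add: sum_distrib_right mult.assoc)
    qed
    also have "\<dots> = (\<Sum>j<m. if j = k then \<delta> t * \<beta> k else 0)"
      unfolding adj_mat(2)[OF T] by (rule sum.cong) (use k in \<open>auto simp: \<delta>_def\<close>)
    also have "\<dots> = \<delta> t * \<beta> k" using k by simp
    finally show ?thesis .
  qed
  \<comment> \<open>In coordinates A sends this to -t w and B sends it to \<delta> \<beta> - t
    \<theta> w, so \<open>cr\<close> makes the total vanish. At t = 0 the factor \<delta> is
    1.\<close>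
  define v where "v t = vscale (\<delta> t) v0 + (\<Sum>l<m. vscale (- t * w t l) (x l))" for t
  have T0: "T 0 = 1\<^sub>m m" by (rule eq_matI) (auto simp: T_def)
  have "v 0 = v0" by (simp add: v_def \<delta>_def T0)
  moreover have "v t \<in> U" for t
    unfolding v_def by (intro fv.subspace_add[OF U] fv.subspace_scale[OF U] fv.subspace_sum[OF U] v0 x) auto
  moreover have "A (v t) + vscale t (B (v t)) = 0" for t
  proof -
    have "A (v t) = vscale (\<delta> t) (A v0) + (\<Sum>l<m. vscale (- t * w t l) (A (x l)))"
      by (simp only: v_def ff.linear_add[OF A] ff.linear_scale[OF A] ff.linear_sum[OF A])
    then have a: "A (v t) = (\<Sum>k<m. vscale (- t * w t k) (y k))" by (simp add: v0 x)
    have "B (v t) = vscale (\<delta> t) (B v0) + (\<Sum>l<m. vscale (- t * w t l) (B (x l)))"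
      by (simp only: v_def ff.linear_add[OF B] ff.linear_scale[OF B] ff.linear_sum[OF B])
    also have "\<dots> = vscale (\<delta> t) (\<Sum>k<m. vscale (\<beta> k) (y k)) + (\<Sum>l<m. vscale (- t * w t l) (\<Sum>k<m. vscale (\<theta> k l) (y k)))"
      by (simp add: \<theta>' v0 x \<beta>_def \<theta>_def)
    also have "\<dots> = (\<Sum>k<m. vscale (\<delta> t * \<beta> k) (y k)) + (\<Sum>l<m. \<Sum>k<m. vscale (- t * w t l * \<theta> k l) (y k))"
      by (simp add: fv.scale_sum_right)
    also have "(\<Sum>l<m. \<Sum>k<m. vscale (- t * w t l * \<theta> k l) (y k)) = (\<Sum>k<m. \<Sum>l<m. vscale (- t * w t l * \<theta> k l) (y k))"
      by (rule sum.swap)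
    also have "\<dots> = (\<Sum>k<m. vscale (- t * (\<Sum>l<m. \<theta> k l * w t l)) (y k))"
      by (rule sum.cong[OF refl]) (simp add: fv.scale_sum_left[symmetric] sum_distrib_left sum_negf mult_ac)
    finally have b: "B (v t) = (\<Sum>k<m. vscale (\<delta> t * \<beta> k) (y k)) + (\<Sum>k<m. vscale (- t * (\<Sum>l<m. \<theta> k l * w t l)) (y k))" .
    have e: "vscale a1 z + vscale t (vscale a2 z + vscale a3 z) = vscale (a1 + t * (a2 + a3)) z" for a1 a2 a3 and z :: "nat \<Rightarrow> 'k bipoly"
      by (simp add: fv.scale_left_distrib fv.scale_right_distrib distrib_left)
    have "A (v t) + vscale t (B (v t)) = (\<Sum>k<m. vscale (- t * w t k) (y k) +
        vscale t (vscale (\<delta> t * \<beta> k) (y k) + vscale (- t * (\<Sum>l<m. \<theta> k l * w t l)) (y k)))"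
      by (simp only: a b sum.distrib[symmetric] fv.scale_sum_right)
    also have "\<dots> = (\<Sum>k<m. 0)"
    proof (rule sum.cong[OF refl])
      fix k assume "k \<in> {..<m}"
      then have "- t * w t k + t * (\<delta> t * \<beta> k + (- t * (\<Sum>l<m. \<theta> k l * w t l))) = 0"
        using cr[of k t, symmetric] by (simp add: algebra_simps)
      then show "vscale (- t * w t k) (y k) +
          vscale t (vscale (\<delta> t * \<beta> k) (y k) + vscale (- t * (\<Sum>l<m. \<theta> k l * w t l)) (y k)) = 0"
        unfolding e by (simp only: fv.scale_zero_left)
    qed
    finally show ?thesis by simp
  qed
  moreover have "poly_curve (\<lambda>t. v t j)" for j
  proof -
    have Tp: "poly_fun (\<lambda>t. (if k = l then 1 else 0) + t * \<theta> k l)" for k l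
      by (intro poly_fun_add poly_fun_mult poly_fun_const poly_fun_id)
    have dp: "poly_fun \<delta>" unfolding \<delta>_def T_def by (rule poly_fun_det) (rule Tp)
    have "poly_fun (\<lambda>t. w t l)" if l: "l < m" for l
      unfolding w_def
    proof (intro poly_fun_sum poly_fun_mult poly_fun_const)
      fix k assume k: "k \<in> {..<m}"
      \<comment> \<open>The entries left after deleting row k and column l, renumbered: again
        polynomials in t, hence so are the cofactors.\<close>
      define f where "f t i' j' = (\<lambda>(a, b). (if a = b then 1 else 0) + t * \<theta> a b)
          (if i' < k then i' else Suc i', if j' < l then j' else Suc j')" for t i' j'
      have "mat_delete (T t) k l = Matrix.mat (m - 1) (m - 1) (\<lambda>(i', j'). f t i' j')" for t
        by (rule eq_matI) (use k l in \<open>auto simp: mat_delete_def T_def f_def\<close>)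
      then have "adj_mat (T t) $$ (l, k) = (-1) ^ (k + l) * Determinant.det (Matrix.mat (m - 1) (m - 1) (\<lambda>(i', j'). f t i' j'))" for t
        using k l by (simp add: adj_mat_def cofactor_def T_def)
      moreover have "poly_fun (\<lambda>t. (-1) ^ (k + l) * Determinant.det (Matrix.mat (m - 1) (m - 1) (\<lambda>(i', j'). f t i' j')))"
      proof (intro poly_fun_mult poly_fun_const poly_fun_det)
        fix i j show "poly_fun (\<lambda>t. f t i j)" unfolding f_def by (simp only: prod.case) (rule Tp)
      qed
      ultimately show "poly_fun (\<lambda>t. adj_mat (T t) $$ (l, k))" by simp
    qed
    then have "poly_curve (\<lambda>t. kscale (\<delta> t) (v0 j) + (\<Sum>l<m. kscale (- t * w t l) (x l j)))"
      by (intro poly_curve_add poly_curve_kscale poly_curve_sum dp poly_curve_const poly_fun_mult poly_fun_minus poly_fun_id) auto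
    moreover have "v t j = kscale (\<delta> t) (v0 j) + (\<Sum>l<m. kscale (- t * w t l) (x l j))" for t
      by (simp add: v_def vscale_def fun_sum_apply)
    ultimately show ?thesis by simp
  qed
  ultimately show ?thesis by blast
qed


section \<open>Deforming an ideal through its resolution\<close>

text \<open>For fixed H, \<tau> determines \<nu> and \<beta> by affine formulas under which the
  three extremal values correspond; as \<tau> is bounded above by its extremal value, a lower bound
  is equality.\<close>

lemma extremal_iff:
  fixes J :: "'k::field bipoly set"
  assumes J: "graded_ideal J" "J \<noteq> {0}" "J \<noteq> UNIV" and H: "hilbert J = H"
  shows "extremal_invariants J H \<longleftrightarrow>
    (\<forall>i\<ge>init_deg H. 1 + min (hdiff H i) (hdiff H (i + 1)) \<le> tau (piece J i))"
proof -
  note inv = ideal_invariants(5)[OF J H[symmetric] refl refl]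
  have "int (nu J (i + 1)) = pos_part (hdiff H (i + 1) - hdiff H i) \<and>
      int (beta J (i + 1)) = pos_part (hdiff H i - hdiff H (i + 1)) \<and>
      tau (piece J i) = 1 + min (hdiff H i) (hdiff H (i + 1))
    \<longleftrightarrow> 1 + min (hdiff H i) (hdiff H (i + 1)) \<le> tau (piece J i)" if "i \<ge> init_deg H" for i
  proof -
    have "tau (piece J i) = hdiff H (i + 1) + 1 - int (nu J (i + 1))"
      "tau (piece J i) = hdiff H i + 1 - int (beta J (i + 1))"
      "tau (piece J i) \<le> 1 + min (hdiff H i) (hdiff H (i + 1))"
      using inv that by blast+
    then show ?thesis unfolding pos_part_def by linarith
  qed
  then show ?thesis unfolding extremal_invariants_def by blast
qed

lemma count_list_card: "count_list xs d = card {i. i < length xs \<and> xs ! i = d}"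
  by (simp add: count_list_eq_length_filter length_filter_conv_card eq_commute)

text \<open>Provides the positions of the ones in the deforming matrix. The pairing is made in each
  degree separately; different degrees cannot collide, as \<open>\<phi>\<close> preserves the
  degree.\<close>

lemma partial_matching:
  "\<exists>S \<phi>. S \<subseteq> {..<length b} \<and> inj_on \<phi> S \<and> (\<forall>j\<in>S. \<phi> j < length a \<and> a ! \<phi> j = b ! j) \<and>
    (\<forall>d. card {j \<in> S. b ! j = d} = min (count_list a d) (count_list b d))"
proof -
  let ?A = "\<lambda>d. {c. c < length a \<and> a ! c = d}" and ?B = "\<lambda>d. {j. j < length b \<and> b ! j = d}"
  have "\<exists>S f. S \<subseteq> ?B d \<and> card S = min (count_list a d) (count_list b d) \<and> inj_on f S \<and> f ` S \<subseteq> ?A d" for d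
  proof -
    have "min (count_list a d) (count_list b d) \<le> card (?B d)" unfolding count_list_card[of b] by (rule min.cobounded2)
    from obtain_subset_with_card_n[OF this] obtain S where S: "S \<subseteq> ?B d" "card S = min (count_list a d) (count_list b d)" by metis
    have fS: "finite S" using S(1) by (rule finite_subset) simp
    have fA: "finite (?A d)" by simp
    have "card S \<le> card (?A d)" unfolding S(2) count_list_card[of a] by (rule min.cobounded1)
    from card_le_inj[OF fS fA this] obtain f where "f ` S \<subseteq> ?A d \<and> inj_on f S" ..
    then show ?thesis using S by blast
  qed
  then have "\<forall>d. \<exists>p. fst p \<subseteq> ?B d \<and> card (fst p) = min (count_list a d) (count_list b d) \<and>
      inj_on (snd p) (fst p) \<and> snd p ` fst p \<subseteq> ?A d" by simp
  from choice[OF this] obtain p where p: "\<forall>d. fst (p d) \<subseteq> ?B d \<and> card (fst (p d)) = min (count_list a d) (count_list b d) \<and>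
      inj_on (snd (p d)) (fst (p d)) \<and> snd (p d) ` fst (p d) \<subseteq> ?A d" ..
  define T where "T = fst \<circ> p"
  define f where "f = snd \<circ> p"
  have Tf: "T d \<subseteq> ?B d" "card (T d) = min (count_list a d) (count_list b d)" "inj_on (f d) (T d)" "f d ` T d \<subseteq> ?A d" for d
    using p by (simp_all add: T_def f_def)
  define S where "S = (\<Union>d. T d)"
  have TS: "{j \<in> S. b ! j = d} = T d" for d using Tf(1) by (auto simp: S_def)
  define \<phi> where "\<phi> j = f (b ! j) j" for j
  have P: "\<phi> j < length a \<and> a ! \<phi> j = b ! j" if "j \<in> S" for j
  proof -
    have "j \<in> T (b ! j)" using TS that by blast
    then show ?thesis using Tf(4)[of "b ! j"] by (auto simp: \<phi>_def)
  qed
  show ?thesis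
  proof (intro exI conjI ballI allI)
    show "S \<subseteq> {..<length b}" using Tf(1) by (auto simp: S_def)
    show "inj_on \<phi> S"
    proof (rule inj_onI)
      fix j k assume jk: "j \<in> S" "k \<in> S" "\<phi> j = \<phi> k"
      then have e: "b ! j = b ! k" using P by metis
      have "j \<in> T (b ! k)" "k \<in> T (b ! k)" using TS jk e by blast+
      then show "j = k" using Tf(3)[of "b ! k"] jk(3) e by (auto simp: \<phi>_def dest: inj_onD)
    qed
  qed (use P Tf(2) TS in auto)
qed

section \<open>Duals of homogeneous matrices\<close>

definition unit_free :: "nat \<Rightarrow> nat \<Rightarrow> 'k::field bipoly" where
  "unit_free c = (\<lambda>j. if j = c then 1 else 0)"

lemma unit_free_free_part: "c < length ds \<Longrightarrow> unit_free c \<in> free_part ds (ds ! c)"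
  by (auto simp: free_part_def unit_free_def shifted_forms_def)

lemma mat_app_unit_free: "c < n \<Longrightarrow> mat_app m n A (unit_free c) r = (if r < m then A r c else 0)"
  by (auto simp: mat_app_def unit_free_def if_distrib[of "\<lambda>x. _ * x"] cong: if_cong)

lemma mat_app_transpose:
  fixes h :: "nat \<Rightarrow> 'k::field bipoly"
  shows "(\<Sum>c<n. mat_app n m B u c * h c) = (\<Sum>j<m. u j * mat_app m n (\<lambda>j c. B c j) h j)"
proof -
  have "(\<Sum>c<n. mat_app n m B u c * h c) = (\<Sum>c<n. \<Sum>j<m. u j * (B c j * h c))"
    proof (rule sum.cong[OF refl])
    fix c assume "c \<in> {..<n}"
    then have "mat_app n m B u c * h c = (\<Sum>j<m. B c j * u j * h c)" by (simp add: mat_app_def sum_distrib_right)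
    also have "\<dots> = (\<Sum>j<m. u j * (B c j * h c))" by (rule sum.cong) (simp_all add: mult_ac)
    finally show "mat_app n m B u c * h c = (\<Sum>j<m. u j * (B c j * h c))" .
  qed
  also have "\<dots> = (\<Sum>j<m. \<Sum>c<n. u j * (B c j * h c))" by (rule sum.swap)
  finally show ?thesis by (simp add: mat_app_def sum_distrib_left)
qed

text \<open>Dualizing into R(-D) turns a generator degree d into D - d, and D bounds all degrees so
  that these differences are true ones. In degree D the dual of F_0 consists of the vectors whose
  c-th entry has degree \<open>a ! c\<close>, the shape of the vector of generators.\<close>

lemma hom_matrix_transpose:
  assumes "hom_matrix a b B" "\<And>c. c < length a \<Longrightarrow> a ! c \<le> D" "\<And>j. j < length b \<Longrightarrow> b ! j \<le> D"
  shows "hom_matrix (map (\<lambda>d. D - d) b) (map (\<lambda>d. D - d) a) (\<lambda>j c. B c j)"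
  unfolding hom_matrix_def
proof (intro allI impI)
  fix j c assume "j < length (map (\<lambda>d. D - d) b)" "c < length (map (\<lambda>d. D - d) a)"
  then have jc: "j < length b" "c < length a" by auto
  then have "B c j \<in> shifted_forms (a ! c) (b ! j)" using assms(1) by (simp add: hom_matrix_def)
  moreover have "D - b ! j \<le> D - a ! c \<longleftrightarrow> a ! c \<le> b ! j" "D - a ! c - (D - b ! j) = b ! j - a ! c"
    using assms(2)[OF jc(2)] assms(3)[OF jc(1)] by auto
  ultimately show "B c j \<in> shifted_forms (map (\<lambda>d. D - d) b ! j) (map (\<lambda>d. D - d) a ! c)"
    using jc by (auto simp: shifted_forms_def split: if_splits)
qed

text \<open>Beyond all generator degrees, and for the dual in degree D, the truncated differences
  become affine, so dimensions depend only on the rank and the sum of the degrees.\<close>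

lemma sum_list_dual:
  assumes "\<And>d. d \<in> set ds \<Longrightarrow> d \<le> D"
  shows "D \<le> i \<Longrightarrow> int (\<Sum>d\<leftarrow>ds. Suc i - d) = int (length ds) * (int i + 1) - (\<Sum>d\<leftarrow>ds. int d)"
    and "int (\<Sum>d\<leftarrow>map (\<lambda>d. D - d) ds. Suc D - d) = int (length ds) + (\<Sum>d\<leftarrow>ds. int d)"
proof -
  show "int (\<Sum>d\<leftarrow>ds. Suc i - d) = int (length ds) * (int i + 1) - (\<Sum>d\<leftarrow>ds. int d)" if "D \<le> i"
    using assms
  proof (induction ds)
    case (Cons x ds)
    then have "x \<le> D" by simp
    then have "int (Suc i - x) = int i + 1 - int x" using that by simp
    then show ?case using Cons by (simp add: algebra_simps)
  qed simp
  show "int (\<Sum>d\<leftarrow>map (\<lambda>d. D - d) ds. Suc D - d) = int (length ds) + (\<Sum>d\<leftarrow>ds. int d)"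
    using assms
  proof (induction ds)
    case (Cons x ds)
    then have "x \<le> D" by simp
    then have "int (Suc D - (D - x)) = 1 + int x" by simp
    then show ?case using Cons by simp
  qed simp
qed

lemma pdim_minimal_res:
  fixes J :: "'k::field bipoly set"
  assumes id: "is_ideal J" and R: "minimal_res J a g b B"
  shows "pdim J i = int (fv.dim (free_part a i :: (nat \<Rightarrow> 'k bipoly) set)) - int (fv.dim (free_part b i :: (nat \<Rightarrow> 'k bipoly) set))"
proof -
  have Z: "{v \<in> free_part a i. mat_app (Suc 0) (length a) (row_mat g) v = 0} = mat_app (length a) (length b) B ` free_part b i"
    and im: "mat_app (Suc 0) (length a) (row_mat g) ` free_part a i = vec_of ` piece J i"
    and inj: "\<And>v. v \<in> free_part b i \<Longrightarrow> mat_app (length a) (length b) B v = 0 \<Longrightarrow> v = 0"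
    using R by (auto simp: minimal_res_def)
  have "fv.dim (mat_app (length a) (length b) B ` free_part b i) = fv.dim (free_part b i :: (nat \<Rightarrow> 'k bipoly) set)"
    by (rule ff.dim_image_inj[OF mat_app_linear subspace_free_part fin_dim_free_part inj])
  then show ?thesis
    using dim_kernel[where m = "Suc 0" and n = "length a" and es = a and i = i and A = "row_mat g"]
    unfolding Z im dim_vec_of_piece[OF id] by simp
qed

text \<open>Surjectivity of the dual of the syzygy matrix; a vector killed by it is proportional to the
  vector of generators, so Hopf's inequality bounds the kernel.\<close>

lemma dual_surjective:
  fixes J :: "'k::field bipoly set"
  assumes J: "graded_ideal J" "J \<noteq> {0}" and R: "minimal_res J a g b B"
    and D: "\<And>d. d \<in> set a \<union> set b \<Longrightarrow> d \<le> D"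
  shows "mat_app (length b) (length a) (\<lambda>j c. B c j) ` free_part (map (\<lambda>d. D - d) a) D = free_part (map (\<lambda>d. D - d) b) D"
proof -
  let ?A = "mat_app (length b) (length a) (\<lambda>j c. B c j)" and ?a = "map (\<lambda>d. D - d) a" and ?b = "map (\<lambda>d. D - d) b"
  let ?e = "mat_app (Suc 0) (length a) (row_mat g)"
  have id: "is_ideal J" using J by (simp add: graded_ideal_def)
  have r: "hom_matrix [0] a (row_mat g)" "hom_matrix a b B"
    "\<And>i. ?e ` free_part a i = vec_of ` piece J i"
    "\<And>i. {v \<in> free_part a i. ?e v = 0} = mat_app (length a) (length b) B ` free_part b i"
    using R by (simp_all add: minimal_res_def)
  have Da: "a ! c \<le> D" if "c < length a" for c using D that by simp
  have Db: "b ! j \<le> D" if "j < length b" for j using D that by simp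
  have sub: "?A ` free_part ?a D \<subseteq> free_part ?b D"
    using mat_app_free_part[OF hom_matrix_transpose[OF r(2) Da Db]] by auto
  obtain \<mu> N where st: "\<And>i. 0 < pdim J i \<longleftrightarrow> \<mu> \<le> i" "\<mu> \<le> N" "\<And>i. i \<ge> N \<Longrightarrow> pdim J (Suc i) = pdim J i + 1"
    using hilbert_stable[OF J] by blast
  define i where "i = max D N"
  have pi: "0 < pdim J i" using st(1)[of i] st(2) by (simp add: i_def)
  have pd: "pdim J k = int (length a) * (int k + 1) - (\<Sum>d\<leftarrow>a. int d) - (int (length b) * (int k + 1) - (\<Sum>d\<leftarrow>b. int d))"
    if "D \<le> k" for k
    using pdim_minimal_res[OF id R, of k] sum_list_dual(1)[of a D k] sum_list_dual(1)[of b D k] D that by (simp add: dim_free_part)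
  \<comment> \<open>dim J_i grows by 1 in large degrees, so F_0 has rank one more than F_1, as in
    the Hilbert-Burch theorem.\<close>
  have "int (length a) - int (length b) = 1"
  proof -
    have "D \<le> i" "D \<le> Suc i" "N \<le> i" by (simp_all add: i_def)
    then show ?thesis using pd[of i] pd[of "Suc i"] st(3)[of i] by (simp add: algebra_simps)
  qed
  then have la: "int (length a) = int (length b) + 1" by simp
  have "pdim J i = int i + 1 - (\<Sum>d\<leftarrow>a. int d) + (\<Sum>d\<leftarrow>b. int d)"
    using pd[of i] unfolding la by (simp add: max.cobounded1[of D N, folded i_def] algebra_simps)
  moreover have "int (fv.dim (free_part ?a D :: (nat \<Rightarrow> 'k bipoly) set)) = int (length a) + (\<Sum>d\<leftarrow>a. int d)"
    "int (fv.dim (free_part ?b D :: (nat \<Rightarrow> 'k bipoly) set)) = int (length b) + (\<Sum>d\<leftarrow>b. int d)"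
    using sum_list_dual(2)[of a D] sum_list_dual(2)[of b D] D unfolding dim_free_part by simp_all
  \<comment> \<open>Surjectivity thus amounts to dim Ker \<le> i + 2 - dim J_i.\<close>
  ultimately have UY: "int (fv.dim (free_part ?a D :: (nat \<Rightarrow> 'k bipoly) set)) - int (fv.dim (free_part ?b D :: (nat \<Rightarrow> 'k bipoly) set))
      = int i + 2 - pdim J i" using la by simp
  define Ker where "Ker = {h \<in> free_part ?a D. ?A h = 0}"
  have Ks: "fv.subspace Ker" "fv.fin_dim Ker" unfolding Ker_def by (rule subspace_kernel fin_dim_kernel)+
  have hf: "h c \<in> forms (a ! c)" if "h \<in> free_part ?a D" "c < length a" for h c
    using that Da[OF that(2)] by (auto simp: free_part_def shifted_forms_def)
  \<comment> \<open>A vector killed by the dual of B pairs to 0 with the image of B, that is, with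
    every syzygy of \<open>g\<close>.\<close>
  have kill: "(\<Sum>c<length a. v c * h c) = 0" if h: "h \<in> Ker" and v: "v \<in> free_part a k" "?e v = 0" for h v k
  proof -
    obtain u where "v = mat_app (length a) (length b) B u" using r(4)[of k] v by blast
    then show ?thesis using h by (simp add: mat_app_transpose Ker_def)
  qed
  have "\<exists>c<length a. g c \<noteq> 0"
  proof (rule ccontr)
    assume "\<not> ?thesis"
    then have "?e v = 0" for v by (simp add: mat_app_row_mat)
    then have "vec_of ` piece J i \<subseteq> {0}" unfolding r(3)[symmetric] by blast
    then have "piece J i \<subseteq> {0}" by auto
    then have "bp.dim (piece J i) = 0" using bp.dim_eq_0_fd[OF fin_dim_piece] by blast
    then show False using pi by (simp add: pdim_def)
  qed
  then obtain c0 where c0: "c0 < length a" "g c0 \<noteq> 0" by blast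
  have gf: "g c \<in> forms (a ! c)" if "c < length a" for c using r(1) that by (simp add: hom_matrix_row_mat)
  \<comment> \<open>Pairing with the Koszul syzygy of two generators makes \<open>h\<close>
    proportional to \<open>g\<close>.\<close>
  have kz: "g c0 * h c = g c * h c0" if h: "h \<in> Ker" and c: "c < length a" for h c
  proof (cases "c = c0")
    case False
    define v where "v = (\<lambda>j. if j = c then g c0 else if j = c0 then - g c else 0)"
    have s: "(\<Sum>j<length a. v j * x j) = g c0 * x c - g c * x c0" for x
    proof -
      have "(\<Sum>j<length a. v j * x j) = (\<Sum>j\<in>{c, c0}. v j * x j)"
        by (rule sum.mono_neutral_right) (use c c0 in \<open>auto simp: v_def\<close>)
      then show ?thesis using False by (simp add: v_def)
    qed
    have "v \<in> free_part a (a ! c + a ! c0)"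
      using c c0 gf[OF c] gf[OF c0(1)] bp.subspace_neg[OF subspace_forms] by (auto simp: free_part_def v_def shifted_forms_def)
    moreover have "?e v = 0" unfolding mat_app_row_mat s by (simp add: mult.commute)
    ultimately have "(\<Sum>j<length a. v j * h j) = 0" by (rule kill[OF h])
    then show ?thesis unfolding s by simp
  qed simp
  \<comment> \<open>By proportionality \<open>h\<close> is determined by its entry at
    \<open>c0\<close>.\<close>
  define W where "W = (\<lambda>h. h c0) ` Ker"
  have Ws: "bp.subspace W" unfolding W_def by (rule fb.linear_subspace_image[OF linear_proj Ks(1)])
  have dW: "bp.dim W = fv.dim Ker"
    unfolding W_def
  proof (rule fb.dim_image_inj[OF linear_proj Ks])
    fix h assume h: "h \<in> Ker" "h c0 = 0"
    have "h c = 0" for c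
    proof (cases "c < length a")
      case True
      then show ?thesis using kz[OF h(1) True] h(2) c0(2) by simp
    next
      case False
      then show ?thesis using h(1) by (simp add: Ker_def free_part_def)
    qed
    then show "h = 0" by (auto simp: fun_eq_iff)
  qed
  have WF: "W \<subseteq> forms (a ! c0)" using hf c0(1) by (auto simp: W_def Ker_def)
  have "int (fv.dim Ker) + pdim J i \<le> int i + 2"
  proof (cases "W = {0}")
    case True
    then have "fv.dim Ker = 0" using dW by simp
    then show ?thesis using pdim_le[of J i] by simp
  next
    case False
    \<comment> \<open>W J_i lies in the product of g_c0 with R_i, of dimension i + 1, so Hopf's
      inequality yields dim W + dim J_i \<le> i + 2.\<close>
    define P where "P = (*) (g c0) ` forms i"
    have lg: "Vector_Spaces.linear kscale kscale ((*) (g c0))"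
      by (rule bp_linearI) (simp_all add: algebra_simps kscale_mult)
    have dP: "bp.dim P = Suc i"
      unfolding P_def by (subst bb.dim_image_inj[OF lg subspace_forms fin_dim_forms]) (use c0 in \<open>auto simp: dim_forms\<close>)
    have "bp.dim W + bp.dim (piece J i) \<le> Suc (bp.dim P)"
    proof (rule dim_product_ge[OF Ws WF False subspace_piece[OF id]])
      show "piece J i \<subseteq> forms i" by (simp add: piece_def)
      show "piece J i \<noteq> {0}"
      proof
        assume "piece J i = {0}"
        then have "bp.dim (piece J i) = 0" by (simp only: dim_zero_space)
        then show False using pi unfolding pdim_def by linarith
      qed
      show "bp.subspace P" unfolding P_def by (rule bb.linear_subspace_image[OF lg subspace_forms])
      show "P \<subseteq> forms (a ! c0 + i)" using forms_mult[OF gf[OF c0(1)], of _ i] by (auto simp: P_def)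
      fix w f assume "w \<in> W" and f: "f \<in> piece J i"
      then obtain h where h: "h \<in> Ker" "w = h c0" by (auto simp: W_def)
      have "vec_of f \<in> ?e ` free_part a i" using f r(3)[of i] by blast
      then obtain v where v: "v \<in> free_part a i" "f = (\<Sum>c<length a. v c * g c)" by (auto simp: mat_app_row_mat)
      have "w * f = (\<Sum>c<length a. v c * (g c * h c0))" unfolding v(2) h(2) by (simp add: sum_distrib_left mult_ac)
      also have "\<dots> = (\<Sum>c<length a. v c * (g c0 * h c))" by (rule sum.cong) (use kz[OF h(1)] in auto)
      also have "\<dots> = g c0 * (\<Sum>c<length a. v c * h c)" by (simp add: sum_distrib_left mult_ac)
      finally have "w * f = g c0 * (\<Sum>c<length a. v c * h c)" .
      moreover have "(\<Sum>c<length a. v c * h c) \<in> forms i"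
      proof (rule bp.subspace_sum[OF subspace_forms])
        fix c assume "c \<in> {..<length a}"
        then have c: "c < length a" by simp
        have "h \<in> free_part ?a D" using h by (simp add: Ker_def)
        from hf[OF this c] have "h c \<in> shifted_forms 0 (a ! c)" by simp
        moreover have "v c \<in> shifted_forms (a ! c) i" using v c by (simp add: free_part_def)
        ultimately have "h c * v c \<in> shifted_forms 0 i" by (rule shifted_forms_mult)
        then show "v c * h c \<in> forms i" by (simp add: mult.commute)
      qed
      ultimately show "w * f \<in> P" unfolding P_def by (rule image_eqI)
    qed
    then show ?thesis using dW dP by (simp add: pdim_def)
  qed
  moreover have "int (fv.dim (free_part ?a D :: (nat \<Rightarrow> 'k bipoly) set)) = int (fv.dim (?A ` free_part ?a D)) + int (fv.dim Ker)"
    using ff.rank_nullity[OF mat_app_linear[of "length b" "length a" "\<lambda>j c. B c j"] subspace_free_part[of ?a D] fin_dim_free_part[of ?a D]]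
    unfolding Ker_def by linarith
  ultimately have "fv.dim (free_part ?b D :: (nat \<Rightarrow> 'k bipoly) set) \<le> fv.dim (?A ` free_part ?a D)" using UY by linarith
  then show ?thesis
    by (rule fv.subspace_eq_fd[OF ff.linear_subspace_image[OF mat_app_linear subspace_free_part] sub fin_dim_free_part])
qed

section \<open>Ideals generated by a vector of forms, and bases of their pieces\<close>

definition gen_ideal :: "nat \<Rightarrow> (nat \<Rightarrow> 'k::field bipoly) \<Rightarrow> 'k bipoly set" where
  "gen_ideal n v = {\<Sum>c<n. w c * v c | w. True}"

lemma hom_comp_vec_of: "hom_comp [0] i (vec_of f) = vec_of (hom_part i f)"
  by (auto simp: hom_comp_def vec_of_def fun_eq_iff)

lemma gen_idealI: "(\<Sum>c<n. w c * v c) \<in> gen_ideal n v"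
  unfolding gen_ideal_def by blast

lemma gen_ideal_graded:
  fixes v :: "nat \<Rightarrow> 'k::field bipoly"
  assumes v: "hom_matrix [0] a (row_mat v)"
  shows "graded_ideal (gen_ideal (length a) v)"
    and "vec_of ` piece (gen_ideal (length a) v) i = mat_app (Suc 0) (length a) (row_mat v) ` free_part a i"
proof -
  have I: "is_ideal (gen_ideal (length a) v)"
    unfolding is_ideal_def
  proof (intro conjI ballI allI)
    show "0 \<in> gen_ideal (length a) v" unfolding gen_ideal_def by (auto intro!: exI[of _ "\<lambda>_. 0"])
    fix f g assume "f \<in> gen_ideal (length a) v" "g \<in> gen_ideal (length a) v"
    then obtain w u where "f = (\<Sum>c<length a. w c * v c)" "g = (\<Sum>c<length a. u c * v c)" unfolding gen_ideal_def by blast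
    then have "f + g = (\<Sum>c<length a. (w c + u c) * v c)" by (simp add: distrib_right sum.distrib)
    then show "f + g \<in> gen_ideal (length a) v" using gen_idealI[of "\<lambda>c. w c + u c"] by metis
  next
    fix r f assume "f \<in> gen_ideal (length a) v"
    then obtain w where "f = (\<Sum>c<length a. w c * v c)" unfolding gen_ideal_def by blast
    then have "r * f = (\<Sum>c<length a. (r * w c) * v c)" by (simp add: sum_distrib_left mult.assoc)
    then show "r * f \<in> gen_ideal (length a) v" using gen_idealI[of "\<lambda>c. r * w c"] by metis
  qed
  have hc: "vec_of (hom_part i (\<Sum>c<length a. w c * v c)) = mat_app (Suc 0) (length a) (row_mat v) (hom_comp a i w)" for i w
  proof -
    have "hom_comp [0] i (mat_app (Suc 0) (length a) (row_mat v) w) = mat_app (Suc 0) (length a) (row_mat v) (hom_comp a i w)"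
      using hom_comp_mat_app[OF v, of i w] by simp
    then show ?thesis by (simp add: mat_app_row_mat hom_comp_vec_of)
  qed
  have mem: "f \<in> gen_ideal (length a) v" if "vec_of f = mat_app (Suc 0) (length a) (row_mat v) w" for f w
    using that unfolding mat_app_row_mat gen_ideal_def by auto
  show "graded_ideal (gen_ideal (length a) v)"
    unfolding graded_ideal_def
  proof (intro conjI ballI allI I)
    fix f i assume "f \<in> gen_ideal (length a) v"
    then obtain w where "f = (\<Sum>c<length a. w c * v c)" unfolding gen_ideal_def by blast
    then show "hom_part i f \<in> gen_ideal (length a) v" using hc mem by metis
  qed
  show "vec_of ` piece (gen_ideal (length a) v) i = mat_app (Suc 0) (length a) (row_mat v) ` free_part a i"
  proof
    show "vec_of ` piece (gen_ideal (length a) v) i \<subseteq> mat_app (Suc 0) (length a) (row_mat v) ` free_part a i"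
    proof clarify
      fix f assume f: "f \<in> piece (gen_ideal (length a) v) i"
      then obtain w where w: "f = (\<Sum>c<length a. w c * v c)" unfolding gen_ideal_def piece_def by blast
      have "hom_part i f = f" using f hom_part_of_form[of f i i] by (simp add: piece_def)
      then have "vec_of f = mat_app (Suc 0) (length a) (row_mat v) (hom_comp a i w)" using hc[of i w] w by simp
      then show "vec_of f \<in> mat_app (Suc 0) (length a) (row_mat v) ` free_part a i" using hom_comp_free_part by blast
    qed
    show "mat_app (Suc 0) (length a) (row_mat v) ` free_part a i \<subseteq> vec_of ` piece (gen_ideal (length a) v) i"
    proof clarify
      fix w :: "nat \<Rightarrow> 'k bipoly" assume w: "w \<in> free_part a i"
      define f where "f = (\<Sum>c<length a. w c * v c)"
      have e: "mat_app (Suc 0) (length a) (row_mat v) w = vec_of f" by (simp add: mat_app_row_mat f_def)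
      have "vec_of f \<in> free_part [0] i" using mat_app_free_part[OF v w] e by simp
      then have "f \<in> piece (gen_ideal (length a) v) i" using mem[of f w] e by (simp add: piece_def vec_of_free_part)
      then show "mat_app (Suc 0) (length a) (row_mat v) w \<in> vec_of ` piece (gen_ideal (length a) v) i" unfolding e by blast
    qed
  qed
qed

text \<open>No basis vector has degree i + 1, so every element of that degree reduces to 0 modulo
  (x, y).\<close>

lemma free_part_generated:
  assumes "\<And>d. d \<in> set a \<Longrightarrow> d \<le> i" shows "free_part a (Suc i) = R1v (free_part a i :: (nat \<Rightarrow> 'k::field bipoly) set)"
proof -
  have "const_terms v = 0" if v: "v \<in> free_part a (Suc i)" for v :: "nat \<Rightarrow> 'k bipoly"
  proof -
    have "const_terms v \<in> tensor_part a (Suc i)" using v const_terms_image by blast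
    moreover have "a ! j \<noteq> Suc i" if "j < length a" for j using assms[of "a ! j"] that by simp
    ultimately have "const_terms v j = 0" for j by (cases "j < length a") (auto simp: tensor_part_def free_vecs_def)
    then show ?thesis by (auto simp: fun_eq_iff)
  qed
  then have "free_part a (Suc i) = {v \<in> free_part a (Suc i). const_terms v = (0 :: nat \<Rightarrow> 'k)}" by blast
  then show ?thesis by (simp only: const_terms_kernel prev_part_simps)
qed


lemma kv_unit_vectors_dim:
  assumes "finite S" and U: "kv.subspace U" "kv.fin_dim U"
    and "\<And>c. c \<in> S \<Longrightarrow> (\<lambda>j. if j = c then 1 else 0 :: 'k::field) \<in> U"
  shows "card S \<le> kv.dim U"
proof -
  let ?u = "\<lambda>c j. if j = c then 1 else 0 :: 'k"
  have inj: "inj ?u" by (rule injI) (metis zero_neq_one)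
  have "kv.independent (?u ` S)"
  proof (rule kv.independent_if_scalars_zero)
    fix f x assume z: "(\<Sum>x\<in>?u ` S. (\<lambda>j. f x * x j)) = 0" and x: "x \<in> ?u ` S"
    then obtain c where c: "c \<in> S" "x = ?u c" by blast
    have "0 = (\<Sum>x\<in>?u ` S. (\<lambda>j. f x * x j)) c" unfolding z by simp
    also have "\<dots> = (\<Sum>d\<in>S. f (?u d) * ?u d c)"
      unfolding fun_sum_apply by (subst sum.reindex) (use inj in \<open>auto intro: inj_on_subset simp: o_def\<close>)
    also have "\<dots> = (\<Sum>d\<in>S. if d = c then f (?u c) else 0)" by (rule sum.cong) auto
    also have "\<dots> = f x" using c assms(1) by simp
    finally show "f x = 0" by simp
  qed (use assms(1) in simp)
  moreover have "?u ` S \<subseteq> U" using assms(4) by blast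
  ultimately have "card (?u ` S) \<le> kv.dim U" using kv.indep_card_le[OF U(2)] by blast
  then show ?thesis using card_image[OF inj_on_subset[OF inj subset_UNIV]] by metis
qed

lemma vec_of_lin_indep: "fv.lin_indep q (\<lambda>l. vec_of (u l)) \<longleftrightarrow> bp.lin_indep q u"
proof -
  have "(\<Sum>l<q. vscale (c l) (vec_of (u l))) = vec_of (\<Sum>l<q. kscale (c l) (u l))" for c
    by (simp add: bf.linear_sum[OF vec_of_linear] bf.linear_scale[OF vec_of_linear])
  then show ?thesis by (simp add: fv.lin_indep_def bp.lin_indep_def)
qed

lemma is_basis_iff:
  assumes "bp.subspace V" "bp.fin_dim V"
  shows "is_basis d u V \<longleftrightarrow> bp.lin_indep d u \<and> (\<forall>l<d. u l \<in> V) \<and> d = bp.dim V"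
proof
  assume "is_basis d u V"
  then have b: "inj_on u {..<d}" "bp.independent (u ` {..<d})" "bp.span (u ` {..<d}) = V" by (auto simp: is_basis_def)
  have "bp.dim V = card (u ` {..<d})" using bp.dim_span_eq_card_independent[OF b(2)] b(3) by simp
  then have "d = bp.dim V" by (simp add: card_image[OF b(1)])
  moreover have "\<forall>l<d. u l \<in> V" using b(3) bp.span_superset[of "u ` {..<d}"] by blast
  ultimately show "bp.lin_indep d u \<and> (\<forall>l<d. u l \<in> V) \<and> d = bp.dim V"
    using bp.independent_lin_indep[OF b(1,2)] by blast
next
  assume r: "bp.lin_indep d u \<and> (\<forall>l<d. u l \<in> V) \<and> d = bp.dim V"
  then show "is_basis d u V"
    unfolding is_basis_def using bp.lin_indep_inj bp.lin_indep_independent bp.lin_indep_span[OF assms(2,1)] by blast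
qed

lemma hilbert_eq_iff: "hilbert I = hilbert J \<longleftrightarrow> (\<forall>i. pdim I i = pdim J i)"
proof -
  have "hilbert I i = hilbert J i \<longleftrightarrow> pdim I i = pdim J i" for i
    using hilbert_pdim[of I i] hilbert_pdim[of J i] by linarith
  then show ?thesis by (auto simp: fun_eq_iff)
qed

text \<open>Whether an ideal is zero or the whole ring is visible in its Hilbert function. The
  fields may differ, which lets the given ideal over k control ideals over the algebraic
  closure.\<close>

lemma hilbert_proper:
  fixes I :: "'k::field bipoly set" and J :: "'l::field bipoly set"
  assumes J: "graded_ideal J" "J \<noteq> {0}" "J \<noteq> UNIV" and I: "is_ideal I" and H: "hilbert I = hilbert J"
  shows "I \<noteq> {0}" "I \<noteq> UNIV"
proof -
  have p: "pdim I i = pdim J i" for i using H hilbert_pdim[of I i] hilbert_pdim[of J i] by simp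
  obtain \<mu> where "\<And>i. 0 < pdim J i \<longleftrightarrow> \<mu> \<le> i" using hilbert_stable[OF J(1,2)] by blast
  then have pos: "0 < pdim I \<mu>" using p by simp
  show "I \<noteq> {0}"
  proof
    assume "I = {0}"
    then have "piece I \<mu> \<subseteq> {0}" by (auto simp: piece_def)
    then have "bp.dim (piece I \<mu>) = 0" using bp.dim_eq_0_fd[OF fin_dim_piece] by blast
    then show False using pos by (simp add: pdim_def)
  qed
  have id: "is_ideal J" using J by (simp add: graded_ideal_def)
  show "I \<noteq> UNIV"
  proof
    assume "I = UNIV"
    then have "piece I 0 = forms 0" by (simp add: piece_def)
    then have "pdim I 0 = 1" by (simp add: pdim_def dim_forms)
    then show False using p[of 0] pdim_0[OF id J(3)] by simp
  qed
qed

text \<open>Besides the ideals, the curve carries bases of their pieces that are polynomial in t and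
  start at a basis of the piece of J; along them Pluecker coordinates become polynomials in t. The
  finite set of exceptional t for these bases may depend on the degree.\<close>

theorem deformation:
  fixes J :: "'k::field bipoly set"
  assumes J: "graded_ideal J" "J \<noteq> {0}" "J \<noteq> UNIV"
  shows "\<exists>Jt :: 'k \<Rightarrow> 'k bipoly set.
    (\<forall>\<^sub>F t in cofinite. graded_ideal (Jt t) \<and> hilbert (Jt t) = hilbert J \<and> extremal_invariants (Jt t) (hilbert J)) \<and>
    (\<forall>i. \<exists>bs. (\<forall>r. poly_curve (\<lambda>t. bs t r)) \<and> is_basis (bp.dim (piece J i)) (bs 0) (piece J i) \<and>
      (\<forall>\<^sub>F t in cofinite. is_basis (bp.dim (piece J i)) (bs t) (piece (Jt t) i)))"
proof -
  have id: "is_ideal J" using J by (simp add: graded_ideal_def)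
  obtain \<mu> N where st: "\<And>i. 0 < pdim J i \<longleftrightarrow> \<mu> \<le> i" "\<mu> \<le> N" "\<mu> = init_deg (hilbert J)"
    "\<And>i. i \<ge> N \<Longrightarrow> pdim J (Suc i) = pdim J i + 1 \<and> piece J (Suc i) = R1_mult (piece J i)"
    using hilbert_stable[OF J(1,2)] by blast
  obtain a g b B where R: "minimal_res J a g b B" using minimal_resolution[OF id st(4)] by blast
  \<comment> \<open>A bound on all generator degrees that also lies in the stable range of
    J.\<close>
  define D where "D = Max (insert N (set a \<union> set b))"
  have D: "d \<le> D" if "d \<in> set a \<union> set b" for d unfolding D_def by (rule Max_ge) (use that in auto)
  have ND: "N \<le> D" unfolding D_def by (rule Max_ge) auto
  define n where "n = length a"
  define m where "m = length b"
  let ?e = "\<lambda>g. mat_app (Suc 0) n (row_mat g)"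
  have r: "hom_matrix [0] a (row_mat g)" "hom_matrix a b B"
    "\<And>i. ?e g ` free_part a i = vec_of ` piece J i"
    "\<And>i. {v \<in> free_part a i. ?e g v = 0} = mat_app n m B ` free_part b i"
    "\<And>i v. v \<in> free_part b i \<Longrightarrow> mat_app n m B v = 0 \<Longrightarrow> v = 0"
    "\<And>i. int (count_list a i) = pdim J i - pred_shift (rdim J) i"
    "\<And>i. int (count_list b i) = int (count_list a i) - second_diff (pdim J) i"
    using R by (simp_all add: minimal_res_def n_def m_def)
  obtain S \<phi> where S: "S \<subseteq> {..<m}" "inj_on \<phi> S" "\<And>j. j \<in> S \<Longrightarrow> \<phi> j < n \<and> a ! \<phi> j = b ! j"
    "\<And>d. card {j \<in> S. b ! j = d} = min (count_list a d) (count_list b d)"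
    using partial_matching[of b a] unfolding n_def m_def by blast
  define C where "C = (\<lambda>c j. if j \<in> S \<and> c = \<phi> j then 1 else 0 :: 'k bipoly)"
  have hC: "hom_matrix a b C" using S(3) by (auto simp: hom_matrix_def C_def shifted_forms_def)
  define U where "U = (free_part (map (\<lambda>d. D - d) a) D :: (nat \<Rightarrow> 'k bipoly) set)"
  define Y where "Y = (free_part (map (\<lambda>d. D - d) b) D :: (nat \<Rightarrow> 'k bipoly) set)"
  define A where "A = mat_app m n (\<lambda>j c. B c j)"
  define A' where "A' = mat_app m n (\<lambda>j c. C c j)"
  have Da: "a ! c \<le> D" if "c < length a" for c using D that by simp
  have Db: "b ! j \<le> D" if "j < length b" for j using D that by simp
  have AU: "A ` U = Y" using dual_surjective[OF J(1,2) R D] by (simp add: A_def U_def Y_def n_def m_def)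
  have A'U: "A' ` U \<subseteq> Y"
    using mat_app_free_part[OF hom_matrix_transpose[OF hC Da Db]] by (auto simp: A'_def U_def Y_def n_def m_def)
  \<comment> \<open>\<open>g\<close> is arbitrary beyond position \<open>n\<close>, whereas the
    members of \<open>U\<close> vanish there.\<close>
  define v0 where "v0 = (\<lambda>c. if c < n then g c else 0)"
  have gf: "g c \<in> forms (a ! c)" if "c < n" for c using r(1) that by (simp add: hom_matrix_row_mat n_def)
  have Uf: "h \<in> U \<longleftrightarrow> (\<forall>c<n. h c \<in> forms (a ! c)) \<and> (\<forall>c\<ge>n. h c = 0)" for h
    using Da by (auto simp: U_def free_part_def n_def shifted_forms_def)
  have v0U: "v0 \<in> U" using gf by (simp add: Uf v0_def)
  have e_cong: "?e v0 w = ?e g w" for w by (simp add: mat_app_row_mat v0_def)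
  \<comment> \<open>The columns of B are syzygies of \<open>g\<close>, as seen by pairing with
    standard basis vectors.\<close>
  have "A v0 = 0"
  proof (rule ext)
    fix j
    show "A v0 j = 0 j"
    proof (cases "j < m")
      case True
      have "unit_free j \<in> (free_part b (b ! j) :: (nat \<Rightarrow> 'k bipoly) set)" by (rule unit_free_free_part) (use True in \<open>simp add: m_def\<close>)
      then have "mat_app n m B (unit_free j) \<in> {v \<in> free_part a (b ! j). ?e g v = 0}" unfolding r(4) by blast
      then have "?e v0 (mat_app n m B (unit_free j)) = 0" by (simp add: e_cong)
      then have "(\<Sum>c<n. mat_app n m B (unit_free j) c * v0 c) = 0" by (simp add: mat_app_row_mat)
      then have "(\<Sum>k<m. unit_free j k * A v0 k) = 0" by (simp only: mat_app_transpose A_def)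
      moreover have "(\<Sum>k<m. unit_free j k * A v0 k) = (\<Sum>k<m. if k = j then A v0 j else 0)"
        by (rule sum.cong) (auto simp: unit_free_def)
      ultimately show ?thesis using True by simp
    qed (simp add: A_def mat_app_def)
  qed
  from kernel_curve[OF mat_app_linear mat_app_linear subspace_free_part subspace_free_part fin_dim_free_part
      AU[unfolded A_def U_def Y_def] A'U[unfolded A'_def U_def Y_def] v0U[unfolded U_def] this[unfolded A_def]]
  obtain v where v: "v 0 = v0" "\<And>t. v t \<in> U" "\<And>t. A (v t) + vscale t (A' (v t)) = 0" "\<And>j. poly_curve (\<lambda>t. v t j)"
    unfolding A_def A'_def U_def by blast
  have hv: "hom_matrix [0] a (row_mat (v t))" for t using v(2)[of t] by (simp add: hom_matrix_row_mat Uf n_def)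
  define Jt where "Jt t = gen_ideal n (v t)" for t
  have Jg: "graded_ideal (Jt t)" and Jp: "vec_of ` piece (Jt t) i = ?e (v t) ` free_part a i" for t i
    using gen_ideal_graded[OF hv] by (simp_all add: Jt_def n_def)
  have Jid: "is_ideal (Jt t)" for t using Jg by (simp add: graded_ideal_def)
  define Mt where "Mt t c j = B c j + kscale t (C c j)" for t c j
  have hMt: "hom_matrix a b (Mt t)" for t
    using r(2) hC by (auto simp: hom_matrix_def Mt_def intro!: bp.subspace_add[OF subspace_shifted_forms] bp.subspace_scale[OF subspace_shifted_forms])
  have Mt_zero: "?e (v t) (mat_app n m (Mt t) u) = 0" for t u
  proof -
    have "mat_app m n (\<lambda>j c. Mt t c j) (v t) = A (v t) + vscale t (A' (v t))"
      by (auto simp: mat_app_def A_def A'_def Mt_def vscale_def fun_eq_iff distrib_right sum.distrib kscale_mult bp.scale_sum_right)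
    then have "(\<Sum>c<n. mat_app n m (Mt t) u c * v t c) = 0" by (simp add: mat_app_transpose v(3))
    then show ?thesis by (simp add: mat_app_row_mat)
  qed
  have dp: "pdim J i = int (fv.dim (free_part a i :: (nat \<Rightarrow> 'k bipoly) set)) - int (fv.dim (free_part b i :: (nat \<Rightarrow> 'k bipoly) set))" for i
    by (rule pdim_minimal_res[OF id R])
  have dk: "int (fv.dim {w \<in> free_part a i. ?e (v t) w = 0}) = int (fv.dim (free_part a i :: (nat \<Rightarrow> 'k bipoly) set)) - pdim (Jt t) i" for t i
    using dim_kernel[where m = "Suc 0" and n = n and es = a and i = i and A = "row_mat (v t)"]
    by (simp add: dim_vec_of_piece[OF Jid] flip: Jp)
  \<comment> \<open>B is injective in degree i, so B + tC is injective there for almost all t. Its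
    image consists of syzygies of v(t), so the piece of \<open>Jt\<close> cannot be larger than that
    of J.\<close>
  have upper: "\<forall>\<^sub>F t in cofinite. pdim (Jt t) i \<le> pdim J i" for i
  proof -
    let ?q = "fv.dim (free_part b i :: (nat \<Rightarrow> 'k bipoly) set)"
    obtain z :: "nat \<Rightarrow> nat \<Rightarrow> 'k bipoly" where z: "fv.lin_indep ?q z" "\<And>l. l < ?q \<Longrightarrow> z l \<in> free_part b i"
      using fv.lin_indep_ex[OF fin_dim_free_part order_refl] by blast
    have "fv.lin_indep ?q (\<lambda>l. mat_app n m (Mt 0) (z l))"
      unfolding fv.lin_indep_def
    proof (intro allI impI)
      fix c l assume c: "(\<Sum>l<?q. vscale (c l) (mat_app n m (Mt 0) (z l))) = 0" and l: "l < ?q"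
      have "Mt 0 = B" by (auto simp: Mt_def fun_eq_iff)
      then have "mat_app n m B (\<Sum>l<?q. vscale (c l) (z l)) = 0"
        using c by (simp add: ff.linear_sum[OF mat_app_linear] ff.linear_scale[OF mat_app_linear])
      moreover have "(\<Sum>l<?q. vscale (c l) (z l)) \<in> free_part b i"
        by (intro fv.subspace_sum[OF subspace_free_part] fv.subspace_scale[OF subspace_free_part]) (use z in auto)
      ultimately have "(\<Sum>l<?q. vscale (c l) (z l)) = 0" using r(5) by blast
      then show "c l = 0" using z(1) l unfolding fv.lin_indep_def by blast
    qed
    moreover have "poly_curve (\<lambda>t. mat_app n m (Mt t) (z l) j)" for l j
      unfolding mat_app_def Mt_def
      by (cases "j < n") (simp_all add: poly_curve_const poly_curve_sum poly_curve_mult poly_curve_add poly_curve_kscale poly_fun_id)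
    ultimately have "\<forall>\<^sub>F t in cofinite. fv.lin_indep ?q (\<lambda>l. mat_app n m (Mt t) (z l))"
      by (rule lin_indep_generic[of ?q "\<lambda>t l. mat_app n m (Mt t) (z l)", rotated])
    then show ?thesis
    proof (rule eventually_mono)
      fix t assume t: "fv.lin_indep ?q (\<lambda>l. mat_app n m (Mt t) (z l))"
      have "?q \<le> fv.dim {w \<in> free_part a i. ?e (v t) w = 0}"
      proof (rule fv.lin_indep_le_dim[OF fin_dim_kernel t])
        fix l assume "l < ?q"
        then show "mat_app n m (Mt t) (z l) \<in> {w \<in> free_part a i. ?e (v t) w = 0}"
          using mat_app_free_part[OF hMt z(2)] Mt_zero by (simp add: n_def m_def)
      qed
      then show "pdim (Jt t) i \<le> pdim J i" using dk[of i t] dp[of i] by linarith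
    qed
  qed
  \<comment> \<open>A basis of J_i is written through the generators \<open>g\<close>; replacing
    \<open>g\<close> by v(t) in these combinations gives members of \<open>Jt\<close> that remain
    independent for almost all t.\<close>
  have lower: "\<exists>bs. (\<forall>r. poly_curve (\<lambda>t. bs t r)) \<and> bp.lin_indep (bp.dim (piece J i)) (bs 0) \<and>
      (\<forall>l<bp.dim (piece J i). bs 0 l \<in> piece J i) \<and> (\<forall>t. \<forall>l<bp.dim (piece J i). bs t l \<in> piece (Jt t) i) \<and>
      (\<forall>\<^sub>F t in cofinite. bp.lin_indep (bp.dim (piece J i)) (bs t))" for i
  proof -
    let ?d = "bp.dim (piece J i)"
    obtain y where y: "bp.lin_indep ?d y" "\<And>l. l < ?d \<Longrightarrow> y l \<in> piece J i"
      using bp.lin_indep_ex[OF fin_dim_piece order_refl] by blast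
    have "\<forall>l\<in>{..<?d}. \<exists>u. u \<in> free_part a i \<and> ?e g u = vec_of (y l)"
    proof
      fix l assume "l \<in> {..<?d}"
      then have "vec_of (y l) \<in> ?e g ` free_part a i" using y(2) r(3) by simp
      then show "\<exists>u. u \<in> free_part a i \<and> ?e g u = vec_of (y l)" by (auto elim!: imageE)
    qed
    from bchoice[OF this] obtain u where u: "\<forall>l\<in>{..<?d}. u l \<in> free_part a i \<and> ?e g (u l) = vec_of (y l)" ..
    define bs where "bs t l = (\<Sum>c<n. u l c * v t c)" for t l
    have eb: "vec_of (bs t l) = ?e (v t) (u l)" for t l by (simp add: bs_def mat_app_row_mat)
    have b0: "bs 0 l = y l" if "l < ?d" for l
    proof -
      have "vec_of (bs 0 l) = vec_of (y l)" using u that by (simp add: eb v(1) e_cong)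
      then show ?thesis by simp
    qed
    have ind0: "bp.lin_indep ?d (bs 0)"
      using y(1) b0 unfolding bp.lin_indep_def by simp
    have pb: "poly_curve (\<lambda>t. bs t l)" for l
      unfolding bs_def by (intro poly_curve_sum poly_curve_mult poly_curve_const v(4))
    have "\<forall>\<^sub>F t in cofinite. fv.lin_indep ?d (\<lambda>l. vec_of (bs t l))"
    proof (rule lin_indep_generic)
      show "poly_curve (\<lambda>t. vec_of (bs t l) j)" for l j
        by (cases "j = 0") (simp_all add: vec_of_def pb poly_curve_const)
      show "fv.lin_indep ?d (\<lambda>l. vec_of (bs 0 l))" using ind0 by (simp add: vec_of_lin_indep)
    qed
    then have ind: "\<forall>\<^sub>F t in cofinite. bp.lin_indep ?d (bs t)" by (simp add: vec_of_lin_indep)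
    have "bs t l \<in> piece (Jt t) i" if "l < ?d" for t l
    proof -
      have "vec_of (bs t l) \<in> vec_of ` piece (Jt t) i" unfolding Jp eb using u that by blast
      then show ?thesis by auto
    qed
    then show ?thesis using pb ind0 ind b0 y(2) by (intro exI[of _ bs]) auto
  qed
  have eqd: "\<forall>\<^sub>F t in cofinite. pdim (Jt t) i = pdim J i" for i
  proof -
    obtain bs where bs: "\<forall>t. \<forall>l<bp.dim (piece J i). bs t l \<in> piece (Jt t) i"
      "\<forall>\<^sub>F t in cofinite. bp.lin_indep (bp.dim (piece J i)) (bs t)"
      using lower[of i] by blast
    from bs(2) upper[of i] show ?thesis
    proof eventually_elim
      case (elim t)
      have "bp.dim (piece J i) \<le> bp.dim (piece (Jt t) i)"
        by (rule bp.lin_indep_le_dim[OF fin_dim_piece elim(1)]) (use bs(1) in blast)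
      then show ?case using elim(2) by (simp add: pdim_def)
    qed
  qed
  have gen: "piece (Jt t) (Suc i) = R1_mult (piece (Jt t) i)" if "i \<ge> D" for t i
  proof -
    have "free_part a (Suc i) = R1v (free_part a i :: (nat \<Rightarrow> 'k bipoly) set)" by (rule free_part_generated) (use D that in force)
    then have "vec_of ` piece (Jt t) (Suc i) = R1v (vec_of ` piece (Jt t) i)" unfolding Jp by (simp add: mat_app_R1v)
    then have "vec_of ` piece (Jt t) (Suc i) = vec_of ` R1_mult (piece (Jt t) i)" by (simp add: vec_of_R1_mult subspace_piece[OF Jid])
    then show ?thesis by (metis (no_types, lifting) vec_of_eq_iff injI inj_image_eq_iff)
  qed
  \<comment> \<open>Only finitely many degrees can be imposed on almost all t. Beyond D each piece
    is R_1 times the one before, and dim R_1 J_i lies between dim J_i + 1 and 2 dim J_i - dim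
    J_(i-1), which leaves growth by exactly 1.\<close>
  have hilb: "\<forall>\<^sub>F t in cofinite. hilbert (Jt t) = hilbert J"
  proof -
    have "\<forall>\<^sub>F t in cofinite. \<forall>i\<in>{..Suc D}. pdim (Jt t) i = pdim J i"
      by (rule eventually_ball_finite) (use eqd in auto)
    then show ?thesis
    proof (rule eventually_mono)
      fix t assume t: "\<forall>i\<in>{..Suc D}. pdim (Jt t) i = pdim J i"
      have "pdim (Jt t) (Suc (D + k)) = pdim J (Suc (D + k)) \<and> pdim (Jt t) (D + k) = pdim J (D + k)" for k
      proof (induction k)
        case 0
        then show ?case using t by simp
      next
        case (Suc k)
        let ?i = "D + k"
        have p: "0 < pdim J (Suc ?i)" using st(1)[of "Suc ?i"] st(2) ND by simp
        have "pdim (Jt t) (Suc (Suc ?i)) = rdim (Jt t) (Suc ?i)" by (simp add: rdim_def pdim_def gen)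
        moreover have "rdim (Jt t) (Suc ?i) + pdim (Jt t) ?i \<le> 2 * pdim (Jt t) (Suc ?i)"
          using rdim_upper[OF Jid, of t "Suc ?i"] by simp
        moreover have "pdim (Jt t) (Suc ?i) + 1 \<le> rdim (Jt t) (Suc ?i)"
          by (rule rdim_gt[OF Jid]) (use Suc p in simp)
        ultimately show ?case using Suc st(4)[of ?i] st(4)[of "Suc ?i"] ND by simp
      qed
      then have "pdim (Jt t) i = pdim J i" if "i \<ge> D" for i using that by (metis le_add_diff_inverse)
      then have "pdim (Jt t) i = pdim J i" for i using t by (cases "i \<le> D") auto
      then show "hilbert (Jt t) = hilbert J" unfolding hilbert_eq_iff by blast
    qed
  qed
  \<comment> \<open>Minimality of the generators: no syzygy of \<open>g\<close> has a constant term,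
    since \<open>count_list a i\<close> already equals dim J_i - dim R_1 J_(i-1).\<close>
  have cst0: "const_terms w = 0" if w: "w \<in> free_part a i" "?e g w = 0" for w i
  proof -
    let ?Z = "{w \<in> free_part a i. ?e g w = 0}"
    have "int (kv.dim (tensor_part a i :: (nat \<Rightarrow> 'k) set)) - int (kv.dim (const_terms ` ?Z)) = pdim J i - pred_shift (rdim J) i"
      using dim_tensor_image[where m = "Suc 0" and es = a and A = "row_mat g" and i = i]
      unfolding n_def[symmetric] r(3) pred_shift_rdim[OF id] dim_vec_of_piece[OF id] .
    then have "kv.dim (const_terms ` ?Z) = 0" using r(6)[of i] by (simp add: dim_tensor_part)
    moreover have "kv.fin_dim (const_terms ` ?Z)" by (rule fk.fin_dim_image[OF const_terms_linear fin_dim_kernel])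
    ultimately have "const_terms ` ?Z \<subseteq> {0}" using kv.dim_eq_0_fd by blast
    then show ?thesis using w by blast
  qed
  \<comment> \<open>For j in \<open>S\<close> the constant part of column j of B + tC is t times the
    unit vector at \<open>\<phi> j\<close>, as B contributes none. Dividing by t, these unit vectors
    are reductions of syzygies, and each removes one generator. What remains is
    \<open>count_list a i\<close> minus its minimum with \<open>count_list b i\<close>, the positive
    part of the second difference.\<close>
  have nu_le: "int (nu (Jt t) i) \<le> pos_part (second_diff (pdim J) i)" if t: "t \<noteq> 0" and h: "hilbert (Jt t) = hilbert J" for t i
  proof -
    have nz: "Jt t \<noteq> {0}" by (rule hilbert_proper(1)[OF J Jid h])
    let ?Z = "{w \<in> free_part a i. ?e (v t) w = 0}"
    have "int (kv.dim (tensor_part a i :: (nat \<Rightarrow> 'k) set)) - int (kv.dim (const_terms ` ?Z)) = pdim (Jt t) i - pred_shift (rdim (Jt t)) i"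
      using dim_tensor_image[where m = "Suc 0" and es = a and A = "row_mat (v t)" and i = i]
      unfolding n_def[symmetric] Jp[symmetric] pred_shift_rdim[OF Jid] dim_vec_of_piece[OF Jid] .
    then have nuT: "int (nu (Jt t) i) = int (count_list a i) - int (kv.dim (const_terms ` ?Z))"
      using nu_beta(1)[OF Jg nz] by (simp add: dim_tensor_part)
    have sZ: "kv.subspace (const_terms ` ?Z)" by (rule fk.linear_subspace_image[OF const_terms_linear subspace_kernel])
    let ?S = "{j \<in> S. b ! j = i}"
    have "card (\<phi> ` ?S) \<le> kv.dim (const_terms ` ?Z)"
    proof (rule kv_unit_vectors_dim[OF _ sZ fk.fin_dim_image[OF const_terms_linear fin_dim_kernel]])
      show "finite (\<phi> ` ?S)" using S(1) finite_subset by (metis (no_types, lifting) finite_imageI finite_lessThan mem_Collect_eq subsetI)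
      fix c assume "c \<in> \<phi> ` ?S"
      then obtain j where j: "j \<in> S" "b ! j = i" "c = \<phi> j" by blast
      then have jm: "j < m" and cn: "c < n" using S(1) S(3)[OF j(1)] by auto
      let ?w = "mat_app n m (Mt t) (unit_free j)"
      have uj: "unit_free j \<in> (free_part b i :: (nat \<Rightarrow> 'k bipoly) set)"
        unfolding j(2)[symmetric] by (rule unit_free_free_part) (use jm in \<open>simp add: m_def\<close>)
      have "?w \<in> ?Z" using mat_app_free_part[OF hMt uj] Mt_zero by (simp add: n_def m_def)
      then have wz: "vscale (inverse t) ?w \<in> ?Z" by (rule fv.subspace_scale[OF subspace_kernel])
      have "mat_app n m B (unit_free j) \<in> {w \<in> free_part a i. ?e g w = 0}" unfolding r(4) using uj by blast
      then have "const_terms (mat_app n m B (unit_free j)) = 0" using cst0 by blast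
      then have Bz: "bcoeff (B k j) 0 0 = 0" if "k < n" for k
        using that jm by (auto simp: const_terms_def mat_app_unit_free fun_eq_iff dest: spec[of _ k])
      have k1: "bcoeff (1 :: 'k bipoly) 0 0 = 1" by (simp add: bcoeff_def)
      have ce: "const_terms (vscale (inverse t) ?w) = (\<lambda>k. if k = c then 1 else 0)"
        using t jm cn Bz j by (auto simp: const_terms_def vscale_def mat_app_unit_free Mt_def C_def k1 fun_eq_iff)
      show "(\<lambda>k. if k = c then 1 else 0) \<in> const_terms ` ?Z" by (rule image_eqI[of _ const_terms "vscale (inverse t) ?w", OF ce[symmetric] wz])
    qed
    moreover have "card (\<phi> ` ?S) = card ?S" by (rule card_image) (use S(2) in \<open>auto intro: inj_on_subset\<close>)
    ultimately have "min (count_list a i) (count_list b i) \<le> kv.dim (const_terms ` ?Z)" using S(4) by simp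
    then show ?thesis using nuT r(7)[of i] unfolding pos_part_def by linarith
  qed
  have "\<forall>\<^sub>F t in cofinite. t \<noteq> (0 :: 'k)" by (simp add: eventually_cofinite)
  with hilb have "\<forall>\<^sub>F t in cofinite. graded_ideal (Jt t) \<and> hilbert (Jt t) = hilbert J \<and> extremal_invariants (Jt t) (hilbert J)"
  proof eventually_elim
    case (elim t)
    note pr = hilbert_proper[OF J Jid elim(1)]
    let ?e = "hdiff (hilbert J)"
    note inv = ideal_invariants[OF Jg pr elim(1)[symmetric] refl refl]
    have "1 + min (?e i) (?e (i + 1)) \<le> tau (piece (Jt t) i)" if i: "i \<ge> init_deg (hilbert J)" for i
    proof -
      have "init_deg (hilbert J) \<ge> 1" using inv(1) by blast
      then obtain k where k: "i = Suc k" using i by (cases i) auto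
      have "tau (piece (Jt t) i) = ?e (i + 1) + 1 - int (nu (Jt t) (i + 1))" using inv(5) i by blast
      moreover have "second_diff (pdim J) (i + 1) = ?e (i + 1) - ?e i"
        using hdiff_pdim[of i J] hdiff_pdim[of "Suc i" J] by (simp add: k second_diff_def)
      moreover have "int (nu (Jt t) (i + 1)) \<le> pos_part (second_diff (pdim J) (i + 1))" by (rule nu_le[OF elim(2,1)])
      ultimately show ?thesis unfolding pos_part_def by linarith
    qed
    then have "extremal_invariants (Jt t) (hilbert J)" using extremal_iff[OF Jg pr elim(1)] by blast
    then show ?case using Jg elim(1) by blast
  qed
  moreover have "\<exists>bs. (\<forall>r. poly_curve (\<lambda>t. bs t r)) \<and> is_basis (bp.dim (piece J i)) (bs 0) (piece J i) \<and>
      (\<forall>\<^sub>F t in cofinite. is_basis (bp.dim (piece J i)) (bs t) (piece (Jt t) i))" for i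
  proof -
    obtain bs where bs: "\<forall>r. poly_curve (\<lambda>t. bs t r)" "bp.lin_indep (bp.dim (piece J i)) (bs 0)"
      "\<forall>l<bp.dim (piece J i). bs 0 l \<in> piece J i" "\<forall>t. \<forall>l<bp.dim (piece J i). bs t l \<in> piece (Jt t) i"
      "\<forall>\<^sub>F t in cofinite. bp.lin_indep (bp.dim (piece J i)) (bs t)"
      using lower[of i] by blast
    have "is_basis (bp.dim (piece J i)) (bs 0) (piece J i)"
      using is_basis_iff[OF subspace_piece[OF id] fin_dim_piece] bs(2,3) by blast
    moreover from bs(5) eqd[of i] have "\<forall>\<^sub>F t in cofinite. is_basis (bp.dim (piece J i)) (bs t) (piece (Jt t) i)"
    proof eventually_elim
      case (elim t)
      then have "bp.dim (piece J i) = bp.dim (piece (Jt t) i)" by (simp add: pdim_def)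
      then show ?case using is_basis_iff[OF subspace_piece[OF Jid] fin_dim_piece] bs(4) elim(1) by metis
    qed
    ultimately show ?thesis using bs(1) by blast
  qed
  ultimately show ?thesis by (intro exI[of _ Jt]) blast
qed


section \<open>Polynomials in the Pluecker coordinates\<close>

definition mdeg :: "(plucker_var \<Rightarrow>\<^sub>0 nat) \<Rightarrow> nat" where
  "mdeg m = (\<Sum>v\<in>Poly_Mapping.keys m. Poly_Mapping.lookup m v)"

definition meval :: "(plucker_var \<Rightarrow>\<^sub>0 nat) \<Rightarrow> (plucker_var \<Rightarrow> 'a::comm_semiring_1) \<Rightarrow> 'a" where
  "meval m z = (\<Prod>v\<in>Poly_Mapping.keys m. z v ^ Poly_Mapping.lookup m v)"

text \<open>Functions given by homogeneous polynomials of degree D with coefficients in k, handled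
  through their values. Monomials may repeat in the list, so that sums concatenate lists and
  products pair their entries.\<close>

definition plucker_form :: "plucker_var set \<Rightarrow> nat \<Rightarrow> ((plucker_var \<Rightarrow> 'k::field alg_closure) \<Rightarrow> 'k alg_closure) \<Rightarrow> bool" where
  "plucker_form Vs D f \<longleftrightarrow> (\<exists>ts :: ('k \<times> (plucker_var \<Rightarrow>\<^sub>0 nat)) list.
     (\<forall>(c, m)\<in>set ts. Poly_Mapping.keys m \<subseteq> Vs \<and> mdeg m = D) \<and> (\<forall>z. f z = (\<Sum>(c, m)\<leftarrow>ts. to_ac c * meval m z)))"

lemma mdeg_superset: "finite A \<Longrightarrow> Poly_Mapping.keys m \<subseteq> A \<Longrightarrow> mdeg m = (\<Sum>v\<in>A. Poly_Mapping.lookup m v)"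
  unfolding mdeg_def by (rule sum.mono_neutral_left) (auto simp: in_keys_iff)

lemma meval_superset: "finite A \<Longrightarrow> Poly_Mapping.keys m \<subseteq> A \<Longrightarrow> meval m z = (\<Prod>v\<in>A. z v ^ Poly_Mapping.lookup m v)"
  unfolding meval_def by (rule prod.mono_neutral_left) (auto simp: in_keys_iff)

lemma mdeg_add: "mdeg (m + m') = mdeg m + mdeg m'"
  and meval_add: "meval (m + m') z = meval m z * meval m' z"
proof -
  let ?A = "Poly_Mapping.keys m \<union> Poly_Mapping.keys m'"
  have A: "finite ?A" "Poly_Mapping.keys (m + m') \<subseteq> ?A" "Poly_Mapping.keys m \<subseteq> ?A" "Poly_Mapping.keys m' \<subseteq> ?A"
    using Poly_Mapping.keys_add[of m m'] by auto
  show "mdeg (m + m') = mdeg m + mdeg m'"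
    unfolding mdeg_superset[OF A(1,2)] mdeg_superset[OF A(1,3)] mdeg_superset[OF A(1,4)]
    by (simp add: lookup_add sum.distrib)
  show "meval (m + m') z = meval m z * meval m' z"
    unfolding meval_superset[OF A(1,2)] meval_superset[OF A(1,3)] meval_superset[OF A(1,4)]
    by (simp add: lookup_add power_add prod.distrib)
qed

lemma plucker_form_zero: "plucker_form Vs D (\<lambda>z. 0)"
  unfolding plucker_form_def by (rule exI[of _ "[]"]) simp

lemma plucker_form_const: "plucker_form Vs 0 (\<lambda>z. to_ac c)"
  unfolding plucker_form_def by (rule exI[of _ "[(c, 0)]"]) (simp add: mdeg_def meval_def)

lemma plucker_form_var: "v \<in> Vs \<Longrightarrow> plucker_form Vs 1 (\<lambda>z. z v)"
  unfolding plucker_form_def by (rule exI[of _ "[(1, Poly_Mapping.single v 1)]"]) (simp add: mdeg_def meval_def)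

lemma plucker_form_add: assumes "plucker_form Vs D f" "plucker_form Vs D g" shows "plucker_form Vs D (\<lambda>z. f z + g z)"
proof -
  obtain ts us where "\<forall>(c, m)\<in>set ts. Poly_Mapping.keys m \<subseteq> Vs \<and> mdeg m = D" "\<forall>z. f z = (\<Sum>(c, m)\<leftarrow>ts. to_ac c * meval m z)"
    "\<forall>(c, m)\<in>set us. Poly_Mapping.keys m \<subseteq> Vs \<and> mdeg m = D" "\<forall>z. g z = (\<Sum>(c, m)\<leftarrow>us. to_ac c * meval m z)"
    using assms unfolding plucker_form_def by blast
  then show ?thesis unfolding plucker_form_def by (intro exI[of _ "ts @ us"]) auto
qed

lemma sum_list_times: "(\<Sum>x\<leftarrow>xs. f x) * (\<Sum>y\<leftarrow>ys. g y) = (\<Sum>(x, y)\<leftarrow>List.product xs ys. f x * (g y :: 'a::comm_semiring_1))"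
  by (induction xs) (simp_all add: distrib_right sum_list_const_mult o_def)

lemma plucker_form_mult: assumes "plucker_form Vs D f" "plucker_form Vs E g" shows "plucker_form Vs (D + E) (\<lambda>z. f z * g z)"
proof -
  obtain ts where ts: "\<forall>(c, m)\<in>set ts. Poly_Mapping.keys m \<subseteq> Vs \<and> mdeg m = D" "\<forall>z. f z = (\<Sum>(c, m)\<leftarrow>ts. to_ac c * meval m z)"
    using assms(1) unfolding plucker_form_def by blast
  obtain us where us: "\<forall>(c, m)\<in>set us. Poly_Mapping.keys m \<subseteq> Vs \<and> mdeg m = E" "\<forall>z. g z = (\<Sum>(c, m)\<leftarrow>us. to_ac c * meval m z)"
    using assms(2) unfolding plucker_form_def by blast
  let ?l = "map (\<lambda>(x, y). (fst x * fst y, snd x + snd y)) (List.product ts us)"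
  have "f z * g z = (\<Sum>(c, m)\<leftarrow>?l. to_ac c * meval m z)" for z
  proof -
    have "f z * g z = (\<Sum>x\<leftarrow>ts. to_ac (fst x) * meval (snd x) z) * (\<Sum>y\<leftarrow>us. to_ac (fst y) * meval (snd y) z)"
      using ts(2) us(2) by (simp add: case_prod_unfold)
    also have "\<dots> = (\<Sum>(c, m)\<leftarrow>?l. to_ac c * meval m z)"
      unfolding sum_list_times by (simp add: o_def case_prod_unfold meval_add mult_ac)
    finally show ?thesis .
  qed
  moreover have "Poly_Mapping.keys (snd p) \<subseteq> Vs \<and> mdeg (snd p) = D + E" if "p \<in> set ?l" for p
  proof -
    from that obtain x y where xy: "x \<in> set ts" "y \<in> set us" "snd p = snd x + snd y" by auto
    then have "Poly_Mapping.keys (snd x) \<subseteq> Vs" "Poly_Mapping.keys (snd y) \<subseteq> Vs" "mdeg (snd x) = D" "mdeg (snd y) = E"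
      using ts(1) us(1) by fastforce+
    then show ?thesis using Poly_Mapping.keys_add[of "snd x" "snd y"] by (auto simp: xy(3) mdeg_add)
  qed
  ultimately show ?thesis unfolding plucker_form_def case_prod_unfold by blast
qed

lemma plucker_form_sum: "(\<And>x. x \<in> A \<Longrightarrow> plucker_form Vs D (f x)) \<Longrightarrow> plucker_form Vs D (\<lambda>z. \<Sum>x\<in>A. f x z)"
  by (induction A rule: infinite_finite_induct) (auto intro: plucker_form_zero plucker_form_add)

lemma plucker_form_prod: "finite A \<Longrightarrow> (\<And>x. x \<in> A \<Longrightarrow> plucker_form Vs 1 (f x)) \<Longrightarrow> plucker_form Vs (card A) (\<lambda>z. \<Prod>x\<in>A. f x z)"
proof (induction A rule: finite_induct)
  case empty
  then show ?case using plucker_form_const[of Vs 1] by simp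
next
  case (insert x A)
  then have "plucker_form Vs (1 + card A) (\<lambda>z. f x z * (\<Prod>x\<in>A. f x z))" by (intro plucker_form_mult) auto
  then show ?case using insert by simp
qed

lemma plucker_form_signof: "plucker_form Vs D f \<Longrightarrow> plucker_form Vs D (\<lambda>z. signof \<pi> * f z)"
  using plucker_form_mult[OF plucker_form_const[of Vs "of_int (sign \<pi>)"], of D f] by simp

lemma plucker_form_minor:
  assumes "\<And>r c. r < q \<Longrightarrow> c < q \<Longrightarrow> plucker_form Vs 1 (\<lambda>z. M z r (\<sigma> c))"
  shows "plucker_form Vs q (\<lambda>z. minor q (M z) \<sigma>)"
proof -
  have "minor q (M z) \<sigma> = (\<Sum>p | p permutes {0..<q}. signof p * (\<Prod>i = 0..<q. M z i (\<sigma> (p i))))" for z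
    unfolding minor_def Determinant.det_def by (auto intro!: sum.cong prod.cong simp: permutes_lt)
  moreover have "plucker_form Vs q (\<lambda>z. \<Sum>p | p permutes {0..<q}. signof p * (\<Prod>i = 0..<q. M z i (\<sigma> (p i))))"
  proof (intro plucker_form_sum plucker_form_signof)
    fix p assume "p \<in> {p. p permutes {0..<q}}"
    then have "plucker_form Vs (card {0..<q}) (\<lambda>z. \<Prod>i = 0..<q. M z i (\<sigma> (p i)))"
      by (intro plucker_form_prod assms) (auto simp: permutes_lt)
    then show "plucker_form Vs q (\<lambda>z. \<Prod>i = 0..<q. M z i (\<sigma> (p i)))" by simp
  qed
  ultimately show ?thesis by simp
qed

lemma eval_at_superset:
  "finite A \<Longrightarrow> Poly_Mapping.keys P \<subseteq> A \<Longrightarrow> eval_at P z = (\<Sum>m\<in>A. to_ac (Poly_Mapping.lookup P m) * meval m z)"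
  unfolding eval_at_def meval_def by (rule sum.mono_neutral_left) (auto simp: in_keys_iff)

lemma eval_at_add: "eval_at (P + Q) z = eval_at P z + eval_at Q z"
proof -
  let ?A = "Poly_Mapping.keys P \<union> Poly_Mapping.keys Q"
  have A: "finite ?A" "Poly_Mapping.keys (P + Q) \<subseteq> ?A" "Poly_Mapping.keys P \<subseteq> ?A" "Poly_Mapping.keys Q \<subseteq> ?A"
    using Poly_Mapping.keys_add[of P Q] by auto
  show ?thesis
    unfolding eval_at_superset[OF A(1,2)] eval_at_superset[OF A(1,3)] eval_at_superset[OF A(1,4)]
    by (simp add: lookup_add distrib_right sum.distrib)
qed

lemma eval_at_single: "eval_at (Poly_Mapping.single m c) z = to_ac c * meval m z"
  using eval_at_superset[of "{m}" "Poly_Mapping.single m c" z] by simp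

text \<open>All variables belong to the one factor i, so homogeneity of degree D is multihomogeneity
  with degree D in group i and 0 in the others.\<close>

lemma plucker_form_poly:
  fixes f :: "(plucker_var \<Rightarrow> 'k::field alg_closure) \<Rightarrow> 'k alg_closure"
  assumes "plucker_form Vs D f" and Vs: "Vs \<subseteq> plucker_vars N H" "\<And>v. v \<in> Vs \<Longrightarrow> fst v = i"
  shows "\<exists>P :: 'k plucker_poly. multihomogeneous N H P \<and> (\<forall>z. eval_at P z = f z)"
proof -
  obtain ts where ts: "\<forall>(c, m)\<in>set ts. Poly_Mapping.keys m \<subseteq> Vs \<and> mdeg m = D" "\<forall>z. f z = (\<Sum>(c, m)\<leftarrow>ts. to_ac c * meval m z)"
    using assms(1) unfolding plucker_form_def by blast
  define P where "P = (\<Sum>(c, m)\<leftarrow>ts. Poly_Mapping.single m c)"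
  have e: "eval_at (\<Sum>(c, m)\<leftarrow>us. Poly_Mapping.single m c) z = (\<Sum>(c, m)\<leftarrow>us. to_ac c * meval m z)" for us :: "('k \<times> _) list" and z
    by (induction us) (auto simp: eval_at_add eval_at_single, simp add: eval_at_def)
  \<comment> \<open>Terms with the same monomial may cancel, hence an inclusion only.\<close>
  have k: "Poly_Mapping.keys (\<Sum>(c, m)\<leftarrow>us. Poly_Mapping.single m c) \<subseteq> snd ` set us" for us :: "('k \<times> (plucker_var \<Rightarrow>\<^sub>0 nat)) list"
  proof (induction us)
    case (Cons u us)
    then show ?case
      using Poly_Mapping.keys_add[of "Poly_Mapping.single (snd u) (fst u)" "\<Sum>(c, m)\<leftarrow>us. Poly_Mapping.single m c"]
      by (auto simp: case_prod_unfold split: if_splits)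
  qed simp
  have keys: "Poly_Mapping.keys m \<subseteq> Vs \<and> mdeg m = D" if "m \<in> Poly_Mapping.keys P" for m
    using k[of ts] that ts(1) unfolding P_def by fastforce
  have "multihomogeneous N H P"
    unfolding multihomogeneous_def
  proof (intro conjI ballI exI allI)
    fix m assume m: "m \<in> Poly_Mapping.keys P"
    then show "Poly_Mapping.keys m \<subseteq> plucker_vars N H" using keys Vs(1) by blast
    fix j
    have "{v \<in> Poly_Mapping.keys m. fst v = j} = (if j = i then Poly_Mapping.keys m else {})"
      using keys[OF m] Vs(2) by auto
    then show "(\<Sum>v\<in>{v \<in> Poly_Mapping.keys m. fst v = j}. Poly_Mapping.lookup m v) = (if j = i then D else 0)"
      using keys[OF m] by (simp add: mdeg_def)
  qed
  moreover have "\<forall>z. eval_at P z = f z" unfolding P_def e using ts(2) by simp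
  ultimately show ?thesis by blast
qed


section \<open>Pluecker coordinates of an ideal\<close>

definition coord :: "nat \<Rightarrow> (nat \<Rightarrow> 'k::field bipoly) \<Rightarrow> nat \<Rightarrow> nat \<Rightarrow> 'k" where
  "coord i u r s = bcoeff (u r) (i - s) s"

lemma plucker_minor: "plucker H B (i, S) = minor (i + 1 - H i) (coord i (B i)) (\<lambda>c. sorted_list_of_set S ! c)"
  by (simp add: plucker_def minor_def coord_def Let_def)

text \<open>A repeated column gives 0; distinct columns give the Pluecker coordinate of their set up
  to the sign of the sorting permutation. The same \<open>F\<close> serves all bases.\<close>

lemma minor_plucker:
  fixes H :: "nat \<Rightarrow> nat"
  assumes i: "init_deg H \<le> i" "i \<le> N" and \<sigma>: "\<And>c. c < i + 1 - H i \<Longrightarrow> \<sigma> c \<le> i"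
  shows "\<exists>F :: (plucker_var \<Rightarrow> 'k::field alg_closure) \<Rightarrow> 'k alg_closure.
    plucker_form {v \<in> plucker_vars N H. fst v = i} 1 F \<and> (\<forall>B. F (plucker H B) = minor (i + 1 - H i) (coord i (B i)) \<sigma>)"
proof (cases "inj_on \<sigma> {..<i + 1 - H i}")
  case False
  then obtain k l where "k < i + 1 - H i" "l < i + 1 - H i" "k \<noteq> l" "\<sigma> k = \<sigma> l" by (auto simp: inj_on_def)
  then have "minor (i + 1 - H i) M \<sigma> = 0" for M :: "nat \<Rightarrow> nat \<Rightarrow> 'k alg_closure" by (rule minor_eq_0_of_dup)
  then show ?thesis using plucker_form_zero by (intro exI[of _ "\<lambda>z. 0"]) simp
next
  case inj: True
  define d where "d = i + 1 - H i"
  define S where "S = \<sigma> ` {..<d}"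
  have S: "finite S" "card S = d" "S \<subseteq> {0..i}" using inj \<sigma> by (auto simp: S_def d_def card_image)
  define \<tau> where "\<tau> = (\<lambda>c. sorted_list_of_set S ! c)"
  have \<tau>: "bij_betw \<tau> {..<d} S"
    unfolding \<tau>_def using bij_betw_nth[of "sorted_list_of_set S" "{..<d}" S] S by simp
  have b\<sigma>: "bij_betw \<sigma> {..<d} S" using inj by (simp add: bij_betw_def S_def d_def)
  define \<pi> where "\<pi> c = (if c < d then the_inv_into {..<d} \<tau> (\<sigma> c) else c)" for c
  have "bij_betw (the_inv_into {..<d} \<tau> \<circ> \<sigma>) {..<d} {..<d}"
    by (rule bij_betw_trans[OF b\<sigma> bij_betw_the_inv_into[OF \<tau>]])
  then have "bij_betw \<pi> {..<d} {..<d}" by (rule bij_betw_cong[THEN iffD1, rotated]) (simp add: \<pi>_def)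
  then have \<pi>: "\<pi> permutes {0..<d}" by (intro bij_imp_permutes) (auto simp: atLeast0LessThan \<pi>_def)
  have st: "\<sigma> c = \<tau> (\<pi> c)" if "c < d" for c
  proof -
    have "\<sigma> c \<in> \<tau> ` {..<d}" using that \<tau> b\<sigma> by (auto simp: bij_betw_def)
    then show ?thesis using f_the_inv_into_f[of \<tau> "{..<d}" "\<sigma> c"] \<tau> that by (simp add: \<pi>_def bij_betw_def)
  qed
  have "minor d M \<sigma> = signof \<pi> * minor d M \<tau>" for M :: "nat \<Rightarrow> nat \<Rightarrow> 'k alg_closure"
  proof -
    have "minor d M \<sigma> = minor d M (\<tau> \<circ> \<pi>)" by (rule minor_cong) (simp add: st)
    then show ?thesis using minor_permute[OF \<pi>] by simp
  qed
  moreover have "(i, S) \<in> {v \<in> plucker_vars N H. fst v = i}" using S i by (simp add: plucker_vars_def d_def)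
  ultimately show ?thesis
    by (intro exI[of _ "\<lambda>z. signof \<pi> * z (i, S)"] conjI plucker_form_signof plucker_form_var)
      (auto simp: plucker_minor d_def \<tau>_def)
qed

lemma forms_zero_iff:
  assumes "f \<in> forms i" shows "f = 0 \<longleftrightarrow> (\<forall>s\<le>i. bcoeff f (i - s) s = 0)"
proof
  assume z: "\<forall>s\<le>i. bcoeff f (i - s) s = 0"
  show "f = 0"
  proof (rule bipoly_eqI)
    fix a b
    show "bcoeff f a b = bcoeff 0 a b"
      using z[rule_format, of b] formsD[OF assms, of a b] by (cases "a + b = i") auto
  qed
qed simp

lemma coord_minor_exists:
  assumes "bp.lin_indep q u" "\<And>r. r < q \<Longrightarrow> u r \<in> forms i"
  shows "\<exists>\<sigma>. (\<forall>l<q. \<sigma> l \<le> i) \<and> minor q (coord i u) \<sigma> \<noteq> 0"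
proof -
  have "\<exists>\<sigma>. (\<forall>l<q. \<sigma> l \<in> {..i}) \<and> minor q (coord i u) \<sigma> \<noteq> 0"
  proof (rule minor_exists)
    fix c assume c: "\<And>s. s \<in> {..i} \<Longrightarrow> (\<Sum>r<q. c r * coord i u r s) = 0"
    have f: "(\<Sum>r<q. kscale (c r) (u r)) \<in> forms i"
      by (intro bp.subspace_sum[OF subspace_forms] bp.subspace_scale[OF subspace_forms]) (use assms(2) in auto)
    have "(\<Sum>r<q. kscale (c r) (u r)) = 0"
      unfolding forms_zero_iff[OF f] using c by (simp add: bcoeff_sum coord_def)
    then show "\<forall>r<q. c r = 0" using assms(1) unfolding bp.lin_indep_def by blast
  qed
  then show ?thesis by simp
qed

lemma coord_minor_lin_indep:
  assumes "minor q (coord i u) \<sigma> \<noteq> 0" shows "bp.lin_indep q u"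
  unfolding bp.lin_indep_def
proof (intro allI impI)
  fix c l assume z: "(\<Sum>r<q. kscale (c r) (u r)) = 0" and l: "l < q"
  show "c l = 0"
  proof (rule minor_independent[OF assms _ l])
    fix k
    have "bcoeff (\<Sum>r<q. kscale (c r) (u r)) (i - \<sigma> k) (\<sigma> k) = 0" unfolding z by simp
    then show "(\<Sum>r<q. c r * coord i u r (\<sigma> k)) = 0" by (simp add: bcoeff_sum coord_def)
  qed
qed

text \<open>The common factor is the determinant of the change of basis; it is nonzero because some
  minor of the new basis is.\<close>

lemma plucker_change_of_basis:
  assumes V: "bp.subspace V" "bp.fin_dim V" and "is_basis (i + 1 - H i) (B i) V" "is_basis (i + 1 - H i) (B' i) V" "V \<subseteq> forms i"
  shows "\<exists>c. c \<noteq> 0 \<and> (\<forall>S. plucker H B' (i, S) = c * plucker H B (i, S))"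
proof -
  define d where "d = i + 1 - H i"
  have b: "bp.span (B i ` {..<d}) = V" using assms(3) by (simp add: is_basis_def d_def)
  have b': "bp.lin_indep d (B' i)" "\<And>l. l < d \<Longrightarrow> B' i l \<in> V"
    using assms(4) unfolding is_basis_iff[OF V] d_def by blast+
  have "\<exists>C. B' i r = (\<Sum>l<d. kscale (C l) (B i l))" if "r < d" for r
    using bp.span_indexed[of "B' i r" "B i" d] b b'(2)[OF that] by simp
  then have "\<forall>r\<in>{..<d}. \<exists>C. B' i r = (\<Sum>l<d. kscale (C l) (B i l))" by simp
  from bchoice[OF this] obtain C where C: "\<forall>r\<in>{..<d}. B' i r = (\<Sum>l<d. kscale (C r l) (B i l))" ..
  define c where "c = Determinant.det (Matrix.mat d d (\<lambda>(r, l). C r l))"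
  have m: "minor d (coord i (B' i)) \<sigma> = c * minor d (coord i (B i)) \<sigma>" for \<sigma>
    unfolding c_def by (rule minor_change_of_basis) (use C in \<open>simp add: coord_def bcoeff_sum\<close>)
  obtain \<sigma> where "minor d (coord i (B' i)) \<sigma> \<noteq> 0" using coord_minor_exists[OF b'(1)] b'(2) assms(5) by blast
  then have "c \<noteq> 0" using m[of \<sigma>] by auto
  then show ?thesis using m by (auto simp: plucker_minor d_def)
qed

text \<open>A monomial is multiplied by c_i to the power of its degree in group i; multihomogeneity
  makes this one nonzero factor for all monomials.\<close>

lemma eval_at_change_of_basis:
  fixes P :: "'k::field plucker_poly" and J :: "'k alg_closure bipoly set"
  assumes J: "is_ideal J" and P: "multihomogeneous N H P"
    and B: "\<And>i. i \<in> {init_deg H..N} \<Longrightarrow> is_basis (i + 1 - H i) (B i) (piece J i)"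
    and B': "\<And>i. i \<in> {init_deg H..N} \<Longrightarrow> is_basis (i + 1 - H i) (B' i) (piece J i)"
    and nz: "eval_at P (plucker H B) \<noteq> 0"
  shows "eval_at P (plucker H B') \<noteq> 0"
proof -
  let ?T = "{init_deg H..N}"
  have "\<forall>i\<in>?T. \<exists>c. c \<noteq> 0 \<and> (\<forall>S. plucker H B' (i, S) = c * plucker H B (i, S))"
  proof
    fix i assume i: "i \<in> ?T"
    show "\<exists>c. c \<noteq> 0 \<and> (\<forall>S. plucker H B' (i, S) = c * plucker H B (i, S))"
      by (rule plucker_change_of_basis[where V = "piece J i" and i = i and H = H and B = B and B' = B',
            OF subspace_piece[OF J] fin_dim_piece B[OF i] B'[OF i]]) (simp add: piece_def)
  qed
  from bchoice[OF this] obtain c where c: "\<forall>i\<in>?T. c i \<noteq> 0 \<and> (\<forall>S. plucker H B' (i, S) = c i * plucker H B (i, S))" ..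
  obtain D where D: "\<forall>m\<in>Poly_Mapping.keys P. \<forall>i. (\<Sum>v\<in>{v \<in> Poly_Mapping.keys m. fst v = i}. Poly_Mapping.lookup m v) = D i"
    using P unfolding multihomogeneous_def by blast
  have "meval m (plucker H B') = (\<Prod>i\<in>?T. c i ^ D i) * meval m (plucker H B)" if m: "m \<in> Poly_Mapping.keys P" for m
  proof -
    have km: "Poly_Mapping.keys m \<subseteq> plucker_vars N H" using P m by (simp add: multihomogeneous_def)
    then have fst: "fst ` Poly_Mapping.keys m \<subseteq> ?T" by (auto simp: plucker_vars_def)
    have "meval m (plucker H B') = (\<Prod>v\<in>Poly_Mapping.keys m. c (fst v) ^ Poly_Mapping.lookup m v * plucker H B v ^ Poly_Mapping.lookup m v)"
      unfolding meval_def
    proof (rule prod.cong[OF refl])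
      fix v assume "v \<in> Poly_Mapping.keys m"
      then have "fst v \<in> ?T" using fst by blast
      then have "plucker H B' v = c (fst v) * plucker H B v" using c by (metis prod.collapse)
      then show "plucker H B' v ^ Poly_Mapping.lookup m v = c (fst v) ^ Poly_Mapping.lookup m v * plucker H B v ^ Poly_Mapping.lookup m v"
        by (simp add: power_mult_distrib)
    qed
    also have "\<dots> = (\<Prod>v\<in>Poly_Mapping.keys m. c (fst v) ^ Poly_Mapping.lookup m v) * meval m (plucker H B)"
      by (simp add: prod.distrib meval_def)
    also have "(\<Prod>v\<in>Poly_Mapping.keys m. c (fst v) ^ Poly_Mapping.lookup m v)
        = (\<Prod>i\<in>?T. \<Prod>v\<in>{v \<in> Poly_Mapping.keys m. fst v = i}. c (fst v) ^ Poly_Mapping.lookup m v)"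
      by (rule prod.group[symmetric]) (use fst in auto)
    also have "\<dots> = (\<Prod>i\<in>?T. c i ^ D i)"
    proof (rule prod.cong[OF refl])
      fix i
      have "(\<Prod>v\<in>{v \<in> Poly_Mapping.keys m. fst v = i}. c (fst v) ^ Poly_Mapping.lookup m v)
          = (\<Prod>v\<in>{v \<in> Poly_Mapping.keys m. fst v = i}. c i ^ Poly_Mapping.lookup m v)"
        by (rule prod.cong) auto
      also have "\<dots> = c i ^ D i" unfolding power_sum[symmetric] using D m by simp
      finally show "(\<Prod>v\<in>{v \<in> Poly_Mapping.keys m. fst v = i}. c (fst v) ^ Poly_Mapping.lookup m v) = c i ^ D i" .
    qed
    finally show ?thesis .
  qed
  then have "eval_at P (plucker H B') = (\<Sum>m\<in>Poly_Mapping.keys P. to_ac (Poly_Mapping.lookup P m) * ((\<Prod>i\<in>?T. c i ^ D i) * meval m (plucker H B)))"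
    unfolding eval_at_def meval_def[symmetric] by (intro sum.cong) auto
  also have "\<dots> = (\<Prod>i\<in>?T. c i ^ D i) * eval_at P (plucker H B)"
    unfolding eval_at_def meval_def[symmetric] by (simp add: sum_distrib_left mult_ac)
  also have "\<dots> \<noteq> 0" using nz c by simp
  finally show ?thesis .
qed

section \<open>Points of G(H), and openness of a rank condition\<close>

lemma GH_dim:
  assumes "J \<in> GH H" shows "bp.dim (piece J i) = i + 1 - H i"
  using assms hilbert_pdim[of J i] by (auto simp: GH_def pdim_def)

lemma GH_ideal: "J \<in> GH H \<Longrightarrow> is_ideal J"
  by (simp add: GH_def graded_ideal_def)

lemma GH_bases:
  assumes "J \<in> GH H" shows "\<exists>B. \<forall>i. is_basis (i + 1 - H i) (B i) (piece J i)"
proof -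
  have "\<exists>b. is_basis (i + 1 - H i) b (piece J i)" for i
  proof -
    obtain b where "bp.lin_indep (bp.dim (piece J i)) b" "\<forall>l<bp.dim (piece J i). b l \<in> piece J i"
      using bp.lin_indep_ex[OF fin_dim_piece order_refl] by blast
    then have "is_basis (bp.dim (piece J i)) b (piece J i)"
      unfolding is_basis_iff[OF subspace_piece[OF GH_ideal[OF assms]] fin_dim_piece] by blast
    then show ?thesis unfolding GH_dim[OF assms] by blast
  qed
  then have "\<forall>i. \<exists>b. is_basis (i + 1 - H i) b (piece J i)" by blast
  from choice[OF this] show ?thesis .
qed

text \<open>Near J a basis of J_i can be written with entries linear in the Pluecker coordinates.
  R_1 J_i is then spanned by 2d vectors of this kind, and a nonzero r-minor of r of them is a form
  whose nonvanishing defines a neighbourhood of J inside the set.\<close>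

lemma rank_condition_open:
  fixes H :: "nat \<Rightarrow> nat"
  assumes i: "init_deg H \<le> i" "i \<le> N"
  shows "openin (GH_zariski TYPE('k::field) N H) {J \<in> GH H. r \<le> bp.dim (R1_mult (piece J i))}" (is "openin ?Z ?U")
proof (subst openin_subopen, rule ballI)
  fix J assume J: "J \<in> ?U"
  then have JG: "J \<in> GH H" by simp
  have id: "is_ideal J" by (rule GH_ideal[OF JG])
  let ?V = "piece J i"
  let ?X = "{v \<in> plucker_vars N H. fst v = i}"
  define d where "d = i + 1 - H i"
  obtain B where B: "\<And>i. is_basis (i + 1 - H i) (B i) (piece J i)" using GH_bases[OF JG] by blast
  have b: "bp.lin_indep d (B i)" "\<And>l. l < d \<Longrightarrow> B i l \<in> ?V"
    using B[of i] unfolding is_basis_iff[OF subspace_piece[OF id] fin_dim_piece] d_def by blast+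
  have bf: "B i l \<in> forms i" if "l < d" for l using b(2)[OF that] by (simp add: piece_def)
  obtain \<sigma> where \<sigma>: "\<forall>l<d. \<sigma> l \<le> i" "minor d (coord i (B i)) \<sigma> \<noteq> 0" using coord_minor_exists[OF b(1) bf] by blast
  \<comment> \<open>Exchanging column k of a nonzero minor for s gives, up to sign, a Pluecker
    coordinate or 0.\<close>
  have "\<forall>p\<in>{..<d} \<times> {..i}. \<exists>F :: (plucker_var \<Rightarrow> 'k alg_closure) \<Rightarrow> 'k alg_closure. plucker_form ?X 1 F \<and>
    (\<forall>B. F (plucker H B) = minor d (coord i (B i)) (\<sigma>(fst p := snd p)))"
    unfolding d_def by (intro ballI minor_plucker[OF i]) (use \<sigma>(1) in \<open>auto simp: d_def\<close>)
  from bchoice[OF this] obtain F :: "nat \<times> nat \<Rightarrow> (plucker_var \<Rightarrow> 'k alg_closure) \<Rightarrow> 'k alg_closure" where F: "\<forall>p\<in>{..<d} \<times> {..i}. plucker_form ?X 1 (F p) \<and>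
    (\<forall>B. F p (plucker H B) = minor d (coord i (B i)) (\<sigma>(fst p := snd p)))" ..
  define w where "w z k = (\<Sum>s\<le>i. kscale (F (k, s) z) (bimonom (i - s) s))" for z k
  have bw: "bcoeff (w z k) a s = (if a + s = i then F (k, s) z else 0)" for z k a s
  proof -
    have "bcoeff (w z k) a s = (\<Sum>s'\<le>i. if s' = s then (if i - s = a then F (k, s) z else 0) else 0)"
      unfolding w_def bcoeff_sum by (rule sum.cong) auto
    then show ?thesis by auto
  qed
  \<comment> \<open>Expansion along the exchanged column exhibits \<open>w\<close> as a combination
    of whichever basis was used, so it lies in the piece of J' for every J'.\<close>
  have wV: "w (plucker H B') k \<in> piece J' i" if J': "is_ideal J'" and B': "is_basis d (B' i) (piece J' i)" and k: "k < d" for J' B' k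
  proof -
    obtain cof where cof: "\<And>s. minor d (coord i (B' i)) (\<sigma>(k := s)) = (\<Sum>r<d. cof r * coord i (B' i) r s)"
      using minor_expand_column[OF k] by blast
    have b': "B' i r \<in> piece J' i" if "r < d" for r
      using B' that is_basis_iff[OF subspace_piece[OF J'] fin_dim_piece] by blast
    have Fc: "F (k, s) (plucker H B') = (\<Sum>r<d. cof r * bcoeff (B' i r) (i - s) s)" if "s \<le> i" for s
      using F k that cof[of s] by (simp add: coord_def)
    have "w (plucker H B') k = (\<Sum>r<d. kscale (cof r) (B' i r))"
    proof (rule bipoly_eqI)
      fix a s
      show "bcoeff (w (plucker H B') k) a s = bcoeff (\<Sum>r<d. kscale (cof r) (B' i r)) a s"
      proof (cases "a + s = i")
        case True
        then have "s \<le> i" "a = i - s" by auto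
        then show ?thesis using Fc[of s] by (simp add: bw bcoeff_sum)
      next
        case False
        then have "bcoeff (B' i r) a s = 0" if "r < d" for r using b'[OF that] formsD by (auto simp: piece_def)
        then show ?thesis using False by (simp add: bw bcoeff_sum)
      qed
    qed
    then show ?thesis
      using b' by (auto intro!: bp.subspace_sum[OF subspace_piece[OF J']] bp.subspace_scale[OF subspace_piece[OF J']])
  qed
  define u where "u z l = (if l < d then bimonom 1 0 * w z l else bimonom 0 1 * w z (l - d))" for z l
  have uR: "u (plucker H B') l \<in> R1_mult (piece J' i)" if "is_ideal J'" "is_basis d (B' i) (piece J' i)" "l < 2 * d" for J' B' l
  proof -
    have "\<exists>k<d. \<exists>q\<in>forms 1. u (plucker H B') l = q * w (plucker H B') k"
    proof (cases "l < d")
      case True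
      then show ?thesis using bimonom_forms[of 1 0 1] by (auto simp: u_def)
    next
      case False
      then show ?thesis using bimonom_forms[of 0 1 1] that(3) by (intro exI[of _ "l - d"]) (auto simp: u_def)
    qed
    then obtain k q where kq: "k < d" "q \<in> forms 1" "u (plucker H B') l = q * w (plucker H B') k" by blast
    show ?thesis
      unfolding R1_mult_def kq(3) by (rule bp.span_base) (use kq wV[where J' = J' and B' = B', OF that(1,2) kq(1)] in blast)
  qed
  let ?z = "plucker H B"
  \<comment> \<open>On the columns \<open>\<sigma>\<close> the matrix of \<open>w\<close> is
    diagonal with the nonzero minor on the diagonal, since repeated columns give 0.\<close>
  have wind: "bp.lin_indep d (w ?z)"
    unfolding bp.lin_indep_def
  proof (intro allI impI)
    fix c l assume z: "(\<Sum>k<d. kscale (c k) (w ?z k)) = 0" and l: "l < d"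
    have s: "\<sigma> l \<le> i" using \<sigma>(1) l by blast
    have "0 = bcoeff (\<Sum>k<d. kscale (c k) (w ?z k)) (i - \<sigma> l) (\<sigma> l)" unfolding z by simp
    also have "\<dots> = (\<Sum>k<d. c k * F (k, \<sigma> l) ?z)" using s by (simp add: bcoeff_sum bw)
    also have "\<dots> = (\<Sum>k<d. if k = l then c l * minor d (coord i (B i)) \<sigma> else 0)"
    proof (rule sum.cong[OF refl])
      fix k assume k: "k \<in> {..<d}"
      have e: "F (k, \<sigma> l) ?z = minor d (coord i (B i)) (\<sigma>(k := \<sigma> l))" using F k s by simp
      show "c k * F (k, \<sigma> l) ?z = (if k = l then c l * minor d (coord i (B i)) \<sigma> else 0)"
      proof (cases "k = l")
        case False
        have "minor d (coord i (B i)) (\<sigma>(k := \<sigma> l)) = 0"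
          by (rule minor_eq_0_of_dup[of k d l]) (use k l False in auto)
        then show ?thesis using False e by simp
      next
        case True
        then have "\<sigma>(k := \<sigma> l) = \<sigma>" by simp
        then have "F (k, \<sigma> l) ?z = minor d (coord i (B i)) \<sigma>" using e by (simp only:)
        then show ?thesis using True by simp
      qed
    qed
    also have "\<dots> = c l * minor d (coord i (B i)) \<sigma>" using l by simp
    finally show "c l = 0" using \<sigma>(2) by simp
  qed
  have wspan: "bp.span (w ?z ` {..<d}) = ?V"
    by (rule bp.lin_indep_span[OF fin_dim_piece subspace_piece[OF id] wind]) (use wV[OF id] B[of i] GH_dim[OF JG] in \<open>auto simp: d_def\<close>)
  have lm: "Vector_Spaces.linear kscale kscale ((*) p)" for p :: "'k alg_closure bipoly"
    by (rule bp_linearI) (simp_all add: algebra_simps kscale_mult)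
  have "R1_mult ?V \<subseteq> bp.span (u ?z ` {..<2 * d})"
    unfolding R1_mult_eq[OF subspace_piece[OF id]]
  proof clarify
    fix a c assume "a \<in> ?V" "c \<in> ?V"
    then have "bimonom 1 0 * a \<in> (*) (bimonom 1 0) ` bp.span (w ?z ` {..<d})" "bimonom 0 1 * c \<in> (*) (bimonom 0 1) ` bp.span (w ?z ` {..<d})"
      unfolding wspan by blast+
    then have m: "bimonom 1 0 * a \<in> bp.span ((*) (bimonom 1 0) ` w ?z ` {..<d})" "bimonom 0 1 * c \<in> bp.span ((*) (bimonom 0 1) ` w ?z ` {..<d})"
      by (simp_all only: bb.linear_span_image[OF lm])
    have s1: "(*) (bimonom 1 0) ` w ?z ` {..<d} \<subseteq> u ?z ` {..<2 * d}"
    proof clarify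
      fix k assume "k < d"
      then show "bimonom 1 0 * w ?z k \<in> u ?z ` {..<2 * d}" by (intro image_eqI[of _ _ k]) (auto simp: u_def)
    qed
    have s2: "(*) (bimonom 0 1) ` w ?z ` {..<d} \<subseteq> u ?z ` {..<2 * d}"
    proof clarify
      fix k assume "k < d"
      then show "bimonom 0 1 * w ?z k \<in> u ?z ` {..<2 * d}" by (intro image_eqI[of _ _ "k + d"]) (auto simp: u_def)
    qed
    show "bimonom 1 0 * a + bimonom 0 1 * c \<in> bp.span (u ?z ` {..<2 * d})"
      by (rule bp.span_add[OF subsetD[OF bp.span_mono[OF s1] m(1)] subsetD[OF bp.span_mono[OF s2] m(2)]])
  qed
  then have "bp.dim (R1_mult ?V) \<le> bp.dim (bp.span (u ?z ` {..<2 * d}))"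
    by (rule bp.dim_mono_fd[OF _ bp.fin_dim_span_finite]) simp
  then have "r \<le> bp.dim (u ?z ` {..<2 * d})" using J by simp
  moreover have "bp.fin_dim (u ?z ` {..<2 * d})"
    by (rule bp.fin_dim_mono[OF bp.span_superset bp.fin_dim_span_finite]) simp
  ultimately obtain y where y: "bp.lin_indep r y" "\<forall>l<r. y l \<in> u ?z ` {..<2 * d}" using bp.lin_indep_ex by blast
  have "\<forall>l\<in>{..<r}. \<exists>k. k < 2 * d \<and> y l = u ?z k" using y(2) by auto
  from bchoice[OF this] obtain \<kappa> where \<kappa>: "\<forall>l\<in>{..<r}. \<kappa> l < 2 * d \<and> y l = u ?z (\<kappa> l)" ..
  have ind: "bp.lin_indep r (\<lambda>l. u ?z (\<kappa> l))" using y(1) \<kappa> unfolding bp.lin_indep_def by simp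
  have uf: "u ?z (\<kappa> l) \<in> forms (Suc i)" if "l < r" for l
    using uR[OF id, of B "\<kappa> l"] B[of i] \<kappa> that R1_mult_forms[of ?V i] by (auto simp: d_def piece_def)
  obtain \<rho> where \<rho>: "\<forall>l<r. \<rho> l \<le> Suc i" "minor r (coord (Suc i) (\<lambda>l. u ?z (\<kappa> l))) \<rho> \<noteq> 0"
    using coord_minor_exists[OF ind uf] by blast
  \<comment> \<open>A coefficient of xw or yw is a coefficient of w or 0, hence linear in the
    Pluecker coordinates.\<close>
  have G: "plucker_form ?X r (\<lambda>z. minor r (coord (Suc i) (\<lambda>l. u z (\<kappa> l))) \<rho>)"
  proof (rule plucker_form_minor)
    fix l c assume lc: "l < r" "c < r"
    have s: "\<rho> c \<le> Suc i" using \<rho>(1) lc by blast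
    have k: "\<kappa> l < 2 * d" using \<kappa> lc by simp
    show "plucker_form ?X 1 (\<lambda>z. coord (Suc i) (\<lambda>l. u z (\<kappa> l)) l (\<rho> c))"
    proof (cases "\<kappa> l < d")
      case True
      show ?thesis
      proof (cases "\<rho> c \<le> i")
        case le: True
        then have "coord (Suc i) (\<lambda>l. u z (\<kappa> l)) l (\<rho> c) = F (\<kappa> l, \<rho> c) z" for z
          using True by (simp add: coord_def u_def bw)
        then show ?thesis using F True le by simp
      next
        case False
        then have "coord (Suc i) (\<lambda>l. u z (\<kappa> l)) l (\<rho> c) = 0" for z
          using True s by (simp add: coord_def u_def)
        then show ?thesis using plucker_form_zero by simp
      qed
    next
      case False
      show ?thesis
      proof (cases "\<rho> c")
        case 0
        then have "coord (Suc i) (\<lambda>l. u z (\<kappa> l)) l (\<rho> c) = 0" for z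
          using False by (simp add: coord_def u_def)
        then show ?thesis using plucker_form_zero by simp
      next
        case (Suc s')
        then have "coord (Suc i) (\<lambda>l. u z (\<kappa> l)) l (\<rho> c) = F (\<kappa> l - d, s') z" for z
          using False s by (simp add: coord_def u_def bw)
        moreover have "(\<kappa> l - d, s') \<in> {..<d} \<times> {..i}" using k False s Suc by auto
        ultimately show ?thesis using F by simp
      qed
    qed
  qed
  have "\<exists>P :: 'k plucker_poly. multihomogeneous N H P \<and> (\<forall>z. eval_at P z = minor r (coord (Suc i) (\<lambda>l. u z (\<kappa> l))) \<rho>)"
    by (rule plucker_form_poly[OF G, of N H i]) simp_all
  then obtain P :: "'k plucker_poly" where
    P: "multihomogeneous N H P" "\<forall>z. eval_at P z = minor r (coord (Suc i) (\<lambda>l. u z (\<kappa> l))) \<rho>" by blast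
  have "openin ?Z (principal_open N H P)"
    unfolding GH_zariski_def by (rule topology_generated_by_Basis) (use P(1) in blast)
  moreover have "J \<in> principal_open N H P"
    unfolding principal_open_def
  proof (intro CollectI conjI JG allI impI)
    fix B' assume "\<forall>i\<in>{init_deg H..N}. is_basis (i + 1 - H i) (B' i) (piece J i)"
    then show "eval_at P (plucker H B') \<noteq> 0"
      by (intro eval_at_change_of_basis[OF id P(1), of B B'] B) (use P(2) \<rho>(2) in auto)
  qed
  \<comment> \<open>At other points \<open>w\<close> may fail to be a basis, but its multiples by x
    and y stay in R_1 J'_i, which suffices for a lower bound on the dimension.\<close>
  moreover have "principal_open N H P \<subseteq> ?U"
  proof
    fix J' assume J': "J' \<in> principal_open N H P"
    then have G: "J' \<in> GH H" by (simp add: principal_open_def)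
    obtain B' where B': "\<And>i. is_basis (i + 1 - H i) (B' i) (piece J' i)" using GH_bases[OF G] by blast
    have "eval_at P (plucker H B') \<noteq> 0" using J' B' by (simp add: principal_open_def)
    then have "minor r (coord (Suc i) (\<lambda>l. u (plucker H B') (\<kappa> l))) \<rho> \<noteq> 0" using P(2) by simp
    then have "bp.lin_indep r (\<lambda>l. u (plucker H B') (\<kappa> l))" by (rule coord_minor_lin_indep)
    moreover have "u (plucker H B') (\<kappa> l) \<in> R1_mult (piece J' i)" if "l < r" for l
      using uR[OF GH_ideal[OF G], of B' "\<kappa> l"] B'[of i] \<kappa> that by (simp add: d_def)
    ultimately have "r \<le> bp.dim (R1_mult (piece J' i))"
      by (intro bp.lin_indep_le_dim[OF fin_dim_R1_mult[OF subspace_piece[OF GH_ideal[OF G]] fin_dim_piece]])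
    then show "J' \<in> ?U" using G by simp
  qed
  ultimately show "\<exists>T. openin ?Z T \<and> J \<in> T \<and> T \<subseteq> ?U" by blast
qed


section \<open>Density\<close>

text \<open>The product of all X - x, plus 1, would have no root.\<close>

lemma infinite_alg_closed: "infinite (UNIV :: 'a::alg_closed_field set)"
proof
  assume fin: "finite (UNIV :: 'a set)"
  define p where "p = (\<Prod>x\<in>(UNIV :: 'a set). [:- x, 1:])"
  have "Polynomial.degree p = (\<Sum>x\<in>(UNIV :: 'a set). Polynomial.degree [:- x, 1:])"
    unfolding p_def by (rule degree_prod_eq_sum_degree) simp
  then have dp: "Polynomial.degree p = card (UNIV :: 'a set)" by simp
  have "card (UNIV :: 'a set) > 0" using fin by (simp add: card_gt_0_iff)
  then have "Polynomial.degree (p + 1) > 0" using dp degree_add_eq_left[of 1 p] by simp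
  then obtain x where "Polynomial.poly (p + 1) x = 0" using alg_closed_imp_poly_has_root by blast
  moreover have "Polynomial.poly p x = 0" unfolding p_def poly_prod by (rule prod_zero[OF fin]) auto
  ultimately show False by simp
qed

lemma poly_fun_eval_at: "(\<And>v. poly_fun (\<lambda>t. z t v)) \<Longrightarrow> poly_fun (\<lambda>t. eval_at P (z t))"
  unfolding eval_at_def by (intro poly_fun_sum poly_fun_mult poly_fun_prod poly_fun_const poly_fun_power) auto

text \<open>Induction over the generation of the topology: cofinite sets of parameters are closed
  under finite intersections and supersets. On a basic open set the defining polynomial, evaluated
  along the bases, is a polynomial in t that is nonzero at 0.\<close>

lemma generic_in_open:
  fixes J :: "'k::field alg_closure bipoly set" and Jt :: "'k alg_closure \<Rightarrow> 'k alg_closure bipoly set"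
  assumes J: "J \<in> GH H" and Jt: "\<forall>\<^sub>F t in cofinite. Jt t \<in> GH H"
    and bs: "\<And>i. \<exists>bs. (\<forall>r. poly_curve (\<lambda>t. bs t r)) \<and> is_basis (i + 1 - H i) (bs 0) (piece J i) \<and>
      (\<forall>\<^sub>F t in cofinite. is_basis (i + 1 - H i) (bs t) (piece (Jt t) i))"
    and T: "generate_topology_on {principal_open N H (P :: 'k plucker_poly) | P. multihomogeneous N H P} T" and JT: "J \<in> T"
  shows "\<forall>\<^sub>F t in cofinite. Jt t \<in> T"
  using T JT
proof (induction rule: generate_topology_on.induct)
  case Empty
  then show ?case by simp
next
  case (Int a b)
  then have "\<forall>\<^sub>F t in cofinite. Jt t \<in> a" "\<forall>\<^sub>F t in cofinite. Jt t \<in> b" by auto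
  then show ?case by eventually_elim simp
next
  case (UN K)
  then obtain k where "k \<in> K" "J \<in> k" by blast
  then have "\<forall>\<^sub>F t in cofinite. Jt t \<in> k" using UN by blast
  then show ?case by (rule eventually_mono) (use \<open>k \<in> K\<close> in blast)
next
  case (Basis s)
  then obtain P :: "'k plucker_poly" where P: "multihomogeneous N H P" "s = principal_open N H P" by blast
  have "\<forall>i. \<exists>bs. (\<forall>r. poly_curve (\<lambda>t. bs t r)) \<and> is_basis (i + 1 - H i) (bs 0) (piece J i) \<and>
      (\<forall>\<^sub>F t in cofinite. is_basis (i + 1 - H i) (bs t) (piece (Jt t) i))" using bs by blast
  from choice[OF this] obtain B where B: "\<forall>i. (\<forall>r. poly_curve (\<lambda>t. B i t r)) \<and> is_basis (i + 1 - H i) (B i 0) (piece J i) \<and>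
      (\<forall>\<^sub>F t in cofinite. is_basis (i + 1 - H i) (B i t) (piece (Jt t) i))" ..
  define z where "z t = plucker H (\<lambda>i. B i t)" for t
  have "\<forall>B. (\<forall>i\<in>{init_deg H..N}. is_basis (i + 1 - H i) (B i) (piece J i)) \<longrightarrow> eval_at P (plucker H B) \<noteq> 0"
    using Basis(2) unfolding P(2) principal_open_def by simp
  from this[THEN spec, of "\<lambda>i. B i 0"] have "eval_at P (z 0) \<noteq> 0" using B by (simp add: z_def)
  moreover have "poly_fun (\<lambda>t. eval_at P (z t))"
  proof (rule poly_fun_eval_at)
    fix v :: plucker_var
    obtain i S where v: "v = (i, S)" by (cases v)
    show "poly_fun (\<lambda>t. z t v)"
      unfolding z_def v plucker_minor by (rule poly_fun_minor) (use B in \<open>simp add: coord_def poly_curve_def\<close>)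
  qed
  ultimately have nz: "\<forall>\<^sub>F t in cofinite. eval_at P (z t) \<noteq> 0" by (intro poly_fun_nonzero)
  have "\<forall>\<^sub>F t in cofinite. \<forall>i\<in>{init_deg H..N}. is_basis (i + 1 - H i) (B i t) (piece (Jt t) i)"
    by (rule eventually_ball_finite) (use B in auto)
  from this Jt nz show ?case
  proof eventually_elim
    case (elim t)
    show ?case unfolding P(2) principal_open_def
    proof (intro CollectI conjI allI impI elim(2))
      fix B' assume "\<forall>i\<in>{init_deg H..N}. is_basis (i + 1 - H i) (B' i) (piece (Jt t) i)"
      then show "eval_at P (plucker H B') \<noteq> 0"
        using eval_at_change_of_basis[OF GH_ideal[OF elim(2)] P(1), of "\<lambda>i. B i t" B'] elim(1,3) by (simp add: z_def)
    qed
  qed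
qed

text \<open>The constant polynomial 1 exhibits all of G(H) as a basic open set.\<close>

lemma topspace_GH_zariski: "topspace (GH_zariski TYPE('k::field) N H) = GH H"
proof
  show "topspace (GH_zariski TYPE('k) N H) \<subseteq> GH H"
    unfolding GH_zariski_def topology_generated_by_topspace by (auto simp: principal_open_def)
  obtain P :: "'k plucker_poly" where P: "multihomogeneous N H P" "\<forall>z. eval_at P z = 1"
    using plucker_form_poly[OF plucker_form_const[of "{}" "1 :: 'k"], of N H 0] by auto
  then have "principal_open N H P = GH H" by (auto simp: principal_open_def)
  then show "GH H \<subseteq> topspace (GH_zariski TYPE('k) N H)"
    unfolding GH_zariski_def topology_generated_by_topspace using P(1) by blast
qed


section \<open>Base change\<close>

definition ac_extend :: "'k::field bipoly \<Rightarrow> 'k alg_closure bipoly" where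
  "ac_extend f = map_poly (map_poly to_ac) f"

lemma bcoeff_ac_extend [simp]: "bcoeff (ac_extend f) a b = to_ac (bcoeff f a b)"
  by (simp add: bcoeff_def ac_extend_def coeff_map_poly)

lemma ac_extend_simps: "ac_extend (f + g) = ac_extend f + ac_extend g" "ac_extend (kscale c f) = kscale (to_ac c) (ac_extend f)" "ac_extend 0 = 0"
  "ac_extend (bimonom p q * f) = bimonom p q * ac_extend f" "ac_extend (hom_part i f) = hom_part i (ac_extend f)"
  by (auto intro!: bipoly_eqI)

lemma ac_extend_span:
  assumes "V \<subseteq> bp.span W" shows "ac_extend ` V \<subseteq> bp.span (ac_extend ` W)"
proof -
  have "bp.subspace {f. ac_extend f \<in> bp.span (ac_extend ` W)}"
    by (rule bp_subspaceI) (auto simp: ac_extend_simps bp.span_zero bp.span_add bp.span_scale)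
  then have "bp.span W \<subseteq> {f. ac_extend f \<in> bp.span (ac_extend ` W)}"
    by (intro bp.span_minimal) (auto intro: bp.span_base)
  then show ?thesis using assms by blast
qed

lemma dim_ac_extend_le: assumes "bp.fin_dim V" shows "bp.dim (bp.span (ac_extend ` V)) \<le> bp.dim V"
proof -
  obtain C where C: "finite C" "C \<subseteq> V" "bp.independent C" "V \<subseteq> bp.span C" "card C = bp.dim V"
    using bp.fin_dim_basis[OF assms] .
  have "bp.span (ac_extend ` V) \<subseteq> bp.span (ac_extend ` C)" by (rule bp.span_minimal[OF ac_extend_span[OF C(4)] bp.subspace_span])
  then have "bp.dim (bp.span (ac_extend ` V)) \<le> card (ac_extend ` C)" by (rule bp.dim_le_card) (use C(1) in simp)
  also have "\<dots> \<le> card C" by (rule card_image_le[OF C(1)])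
  finally show ?thesis using C(5) by simp
qed

text \<open>Multiplication by a polynomial over K is a K-combination of multiplications by
  monomials, and those commute with the extension of scalars.\<close>

lemma span_ac_extend_ideal:
  fixes J :: "'a::field bipoly set"
  assumes J: "is_ideal J" shows "is_ideal (bp.span (ac_extend ` J))"
  unfolding is_ideal_def
proof (intro conjI ballI allI)
  fix r f :: "'a alg_closure bipoly" assume f: "f \<in> bp.span (ac_extend ` J)"
  have lm: "Vector_Spaces.linear kscale kscale (\<lambda>f. r * f)" for r :: "'a alg_closure bipoly"
    by (rule bp_linearI) (simp_all add: algebra_simps kscale_mult)
  have m: "bimonom p q * f \<in> bp.span (ac_extend ` J)" for p q
  proof -
    have "bimonom p q * f \<in> (\<lambda>f. bimonom p q * f) ` bp.span (ac_extend ` J)" using f by blast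
    then have "bimonom p q * f \<in> bp.span ((\<lambda>f. bimonom p q * f) ` ac_extend ` J)" by (simp only: bb.linear_span_image[OF lm])
    moreover have sub: "(\<lambda>f. bimonom p q * f) ` ac_extend ` J \<subseteq> ac_extend ` J"
    proof clarify
      fix x assume "x \<in> J"
      then have "bimonom p q * x \<in> J" using J by (simp add: is_ideal_def)
      then show "bimonom p q * ac_extend x \<in> ac_extend ` J" by (metis ac_extend_simps(4) imageI)
    qed
    ultimately show ?thesis using bp.span_mono[OF sub] by blast
  qed
  have h: "p * f \<in> bp.span (ac_extend ` J)" if "p \<in> forms i" for p i
  proof -
    have "p * f = (\<Sum>b\<le>i. kscale (bcoeff p (i - b) b) (bimonom (i - b) b * f))"
      by (subst forms_expand[OF that]) (simp add: sum_distrib_right kscale_mult)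
    then show ?thesis using m by (simp add: bp.span_sum bp.span_scale)
  qed
  obtain n where "r = (\<Sum>i<n. hom_part i r)" using hom_part_decomp by blast
  then have "r * f = (\<Sum>i<n. hom_part i r * f)" by (metis sum_distrib_right)
  then show "r * f \<in> bp.span (ac_extend ` J)" using h[OF hom_part_forms] by (simp add: bp.span_sum)
qed (simp_all add: bp.span_zero bp.span_add)

text \<open>The K-span of J is an ideal, so it contains the least ideal over the image of J; taking
  components of degree i leaves the span of J_i.\<close>

lemma piece_base_change:
  fixes J :: "'a::field bipoly set"
  assumes J: "graded_ideal J" shows "piece (base_change J) i \<subseteq> bp.span (ac_extend ` piece J i)"
proof
  fix f assume f: "f \<in> piece (base_change J) i"
  have "is_ideal (bp.span (ac_extend ` J))" using J by (simp add: graded_ideal_def span_ac_extend_ideal)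
  moreover have be: "map_poly (map_poly to_ac) = (ac_extend :: 'a bipoly \<Rightarrow> _)" by (rule ext) (simp add: ac_extend_def)
  ultimately have "base_change J \<subseteq> bp.span (ac_extend ` J)"
    unfolding base_change_def be using bp.span_superset[of "ac_extend ` J"] by (intro Inter_lower) simp
  then have fs: "f \<in> bp.span (ac_extend ` J)" using f by (auto simp: piece_def)
  have lh: "Vector_Spaces.linear kscale kscale (hom_part i)"
    by (rule bp_linearI) (simp_all add: hom_part_add hom_part_kscale)
  have "hom_part i f \<in> hom_part i ` bp.span (ac_extend ` J)" using fs by blast
  then have "hom_part i f \<in> bp.span (hom_part i ` ac_extend ` J)" by (simp only: bb.linear_span_image[OF lh])
  moreover have sub: "hom_part i ` ac_extend ` J \<subseteq> ac_extend ` piece J i"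
  proof clarify
    fix x assume "x \<in> J"
    then have "hom_part i x \<in> piece J i" using J hom_part_forms by (auto simp: graded_ideal_def piece_def)
    then show "hom_part i (ac_extend x) \<in> ac_extend ` piece J i" by (metis ac_extend_simps(5) imageI)
  qed
  ultimately have "hom_part i f \<in> bp.span (ac_extend ` piece J i)" using bp.span_mono[OF sub] by blast
  moreover have "hom_part i f = f" using f hom_part_of_form[of f i i] by (simp add: piece_def)
  ultimately show "f \<in> bp.span (ac_extend ` piece J i)" by simp
qed

text \<open>This direction carries the lower bound that defines extremality from the base change
  down to J. R_1 times the extended piece lies in the K-span of R_1 J_i.\<close>

lemma rdim_base_change:
  fixes J :: "'a::field bipoly set"
  assumes J: "graded_ideal J" and G: "is_ideal (base_change J)"
  shows "rdim (base_change J) i \<le> rdim J i"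
proof -
  have id: "is_ideal J" using J by (simp add: graded_ideal_def)
  let ?V = "piece J i"
  have lm: "Vector_Spaces.linear kscale kscale (\<lambda>f. r * f)" for r :: "'a alg_closure bipoly"
    by (rule bp_linearI) (simp_all add: algebra_simps kscale_mult)
  have m: "bimonom p q * a \<in> bp.span (ac_extend ` R1_mult ?V)" if "p + q = 1" "a \<in> piece (base_change J) i" for p q a
  proof -
    have "bimonom p q * a \<in> (\<lambda>f. bimonom p q * f) ` bp.span (ac_extend ` ?V)" using piece_base_change[OF J] that(2) by blast
    then have "bimonom p q * a \<in> bp.span ((\<lambda>f. bimonom p q * f) ` ac_extend ` ?V)" by (simp only: bb.linear_span_image[OF lm])
    moreover have sub: "(\<lambda>f. bimonom p q * f) ` ac_extend ` ?V \<subseteq> ac_extend ` R1_mult ?V"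
    proof clarify
      fix x assume "x \<in> ?V"
      then have "bimonom p q * x \<in> R1_mult ?V"
        unfolding R1_mult_def using bimonom_forms[OF that(1)] by (intro bp.span_base) blast
      then show "bimonom p q * ac_extend x \<in> ac_extend ` R1_mult ?V" by (metis ac_extend_simps(4) imageI)
    qed
    ultimately show ?thesis using bp.span_mono[OF sub] by blast
  qed
  have le: "R1_mult (piece (base_change J) i) \<subseteq> bp.span (ac_extend ` R1_mult ?V)"
    proof -
    have "bimonom 1 0 * a + bimonom 0 1 * b \<in> bp.span (ac_extend ` R1_mult ?V)"
      if "a \<in> piece (base_change J) i" "b \<in> piece (base_change J) i" for a b
      by (rule bp.span_add[OF m[OF _ that(1)] m[OF _ that(2)]]) simp_all
    then show ?thesis unfolding R1_mult_eq[OF subspace_piece[OF G]] by blast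
  qed
  have fR: "bp.fin_dim (R1_mult ?V)" by (rule fin_dim_R1_mult[OF subspace_piece[OF id] fin_dim_piece])
  have "bp.fin_dim (bp.span (ac_extend ` R1_mult ?V))"
  proof -
    obtain C where "finite C" "R1_mult ?V \<subseteq> bp.span C" using fR unfolding bp.fin_dim_def by blast
    then have "finite (ac_extend ` C)" "bp.span (ac_extend ` R1_mult ?V) \<subseteq> bp.span (ac_extend ` C)"
      using bp.span_minimal[OF ac_extend_span bp.subspace_span] by auto
    then show ?thesis unfolding bp.fin_dim_def by blast
  qed
  from bp.dim_mono_fd[OF le this] have "bp.dim (R1_mult (piece (base_change J) i)) \<le> bp.dim (R1_mult ?V)"
    using dim_ac_extend_le[OF fR] by (rule order_trans)
  then show ?thesis by (simp add: rdim_def)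
qed


theorem proposition2p7:
  fixes I :: "'k::field bipoly set" and H :: "nat \<Rightarrow> nat" and \<mu> :: nat and e :: "nat \<Rightarrow> int"
  assumes "graded_ideal I" and "I \<noteq> {0}" and "I \<noteq> UNIV"
    and "H = hilbert I"
    and "\<mu> = init_deg H"
    and "e = hdiff H"
  shows "
    ((\<exists>i. H i < i + 1) \<and> \<mu> \<ge> 1 \<and> (\<forall>i<\<mu>. H i = i + 1) \<and> H \<mu> \<le> \<mu> \<and>
      (\<forall>i\<ge>\<mu>. H (i + 1) \<le> H i)) \<and>
    int (nu I \<mu>) = e \<mu> + 1 \<and>
    (\<forall>i\<le>\<mu>. beta I i = 0) \<and>
    (\<forall>i<\<mu>. tau (piece I i) = 0) \<and>
    (\<forall>i\<ge>\<mu>.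
      e (i + 1) \<ge> int (nu I (i + 1)) \<and> int (nu I (i + 1)) \<ge> pos_part (e (i + 1) - e i) \<and>
      e i \<ge> int (beta I (i + 1)) \<and> int (beta I (i + 1)) \<ge> pos_part (e i - e (i + 1)) \<and>
      tau (piece I i) = e (i + 1) + 1 - int (nu I (i + 1)) \<and>
      tau (piece I i) = e i + 1 - int (beta I (i + 1)) \<and>
      tau (piece I i) = tau (piece I (i - 1)) + int (nu I i) - int (beta I (i + 1)) \<and>
      1 \<le> tau (piece I i) \<and> tau (piece I i) \<le> 1 + min (e i) (e (i + 1))) \<and>
    (\<exists>U N0.
      (\<forall>N\<ge>N0. openin (GH_zariski TYPE('k) N H) U \<and>
               GH_zariski TYPE('k) N H closure_of U = GH H) \<and>
      (\<forall>J\<in>U. extremal_invariants J H) \<and>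
      (\<forall>J::'k bipoly set. J \<in> GH H \<and> base_change J \<in> U \<longrightarrow> extremal_invariants J H))"
proof (intro conjI)
  note inv = ideal_invariants[OF assms]
  show "\<exists>i. H i < i + 1" "\<mu> \<ge> 1" "\<forall>i<\<mu>. H i = i + 1" "H \<mu> \<le> \<mu>" "\<forall>i\<ge>\<mu>. H (i + 1) \<le> H i"
    using inv(1) by blast+
  show "int (nu I \<mu>) = e \<mu> + 1" by (rule inv(2))
  show "\<forall>i\<le>\<mu>. beta I i = 0" by (rule inv(3))
  show "\<forall>i<\<mu>. tau (piece I i) = 0" by (rule inv(4))
  show "\<forall>i\<ge>\<mu>.
      e (i + 1) \<ge> int (nu I (i + 1)) \<and> int (nu I (i + 1)) \<ge> pos_part (e (i + 1) - e i) \<and>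
      e i \<ge> int (beta I (i + 1)) \<and> int (beta I (i + 1)) \<ge> pos_part (e i - e (i + 1)) \<and>
      tau (piece I i) = e (i + 1) + 1 - int (nu I (i + 1)) \<and>
      tau (piece I i) = e i + 1 - int (beta I (i + 1)) \<and>
      tau (piece I i) = tau (piece I (i - 1)) + int (nu I i) - int (beta I (i + 1)) \<and>
      1 \<le> tau (piece I i) \<and> tau (piece I i) \<le> 1 + min (e i) (e (i + 1))" by (rule inv(5))
  obtain N1 where N1: "\<And>i. i \<ge> N1 \<Longrightarrow> pdim I (Suc i) = pdim I i + 1"
    using hilbert_stable[OF assms(1,2)] by blast
  define N0 where "N0 = Suc N1"
  have e0: "hdiff H i = 0" if "i \<ge> N0" for i
    using hdiff_pdim[of i I] N1[of "i - 1"] that assms(4) by (cases i) (auto simp: N0_def)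
  have GHp: "graded_ideal J" "J \<noteq> {0}" "J \<noteq> UNIV" "hilbert J = H" if "J \<in> GH H" for J :: "'k bipoly set"
    using that hilbert_proper[OF assms(1-3), of J] assms(4) by (auto simp: GH_def graded_ideal_def)
  have GHP: "graded_ideal J" "J \<noteq> {0}" "J \<noteq> UNIV" "hilbert J = H" if "J \<in> GH H" for J :: "'k alg_closure bipoly set"
    using that hilbert_proper[OF assms(1-3), of J] assms(4) by (auto simp: GH_def graded_ideal_def)
  define U where "U = {J :: 'k alg_closure bipoly set. J \<in> GH H \<and> extremal_invariants J H}"
  \<comment> \<open>The extremal value of \<tau> plus dim J_i, read as a rank.\<close>
  define r where "r i = nat (1 + min (hdiff H i) (hdiff H (i + 1)) + int (i + 1 - H i))" for i
  define W where "W i = {J :: 'k alg_closure bipoly set. J \<in> GH H \<and> r i \<le> bp.dim (R1_mult (piece J i))}" for i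
  have cond: "1 + min (hdiff H i) (hdiff H (i + 1)) \<le> tau (piece J i) \<longleftrightarrow> r i \<le> bp.dim (R1_mult (piece J i))"
    if "J \<in> GH H" for J :: "'k alg_closure bipoly set" and i
    unfolding tau_def GH_dim[OF that] r_def by linarith
  \<comment> \<open>Finitely many degrees describe \<open>U\<close>, without reference to N; it is
    open as soon as the Pluecker coordinates reach degree N0.\<close>
  have U: "U = GH H \<inter> (\<Inter>i\<in>{init_deg H..N0}. W i)"
  proof
    show "U \<subseteq> GH H \<inter> (\<Inter>i\<in>{init_deg H..N0}. W i)"
    proof
      fix J assume J: "J \<in> U"
      then have G: "J \<in> GH H" by (simp add: U_def)
      have "1 + min (hdiff H i) (hdiff H (i + 1)) \<le> tau (piece J i)" if "i \<ge> init_deg H" for i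
        using J extremal_iff[OF GHP[OF G]] that by (simp add: U_def)
      then show "J \<in> GH H \<inter> (\<Inter>i\<in>{init_deg H..N0}. W i)" using G cond[OF G] by (simp add: W_def)
    qed
    show "GH H \<inter> (\<Inter>i\<in>{init_deg H..N0}. W i) \<subseteq> U"
    proof
      fix J assume J: "J \<in> GH H \<inter> (\<Inter>i\<in>{init_deg H..N0}. W i)"
      then have G: "J \<in> GH H" by simp
      have "1 + min (hdiff H i) (hdiff H (i + 1)) \<le> tau (piece J i)" if i: "i \<ge> init_deg H" for i
      proof (cases "i \<le> N0")
        case True
        then have "J \<in> W i" using J i by simp
        then show ?thesis using cond[OF G] by (simp add: W_def)
      next
        case False
        have "1 \<le> tau (piece J i)"
          using ideal_invariants(5)[OF GHP(1-3)[OF G] GHP(4)[OF G, symmetric] refl refl] i by blast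
        then show ?thesis using e0[of i] e0[of "i + 1"] False by simp
      qed
      then have "extremal_invariants J H" using extremal_iff[OF GHP[OF G]] by blast
      then show "J \<in> U" using G by (simp add: U_def)
    qed
  qed
  have opn: "openin (GH_zariski TYPE('k) N H) U" if N: "N \<ge> N0" for N
  proof -
    have "openin (GH_zariski TYPE('k) N H) (W i)" if "i \<in> {init_deg H..N0}" for i
      unfolding W_def by (rule rank_condition_open) (use that N in auto)
    moreover have "openin (GH_zariski TYPE('k) N H) (GH H)"
      using openin_topspace[of "GH_zariski TYPE('k) N H"] by (simp add: topspace_GH_zariski)
    ultimately show ?thesis
      \<comment> \<open>An empty index set is treated apart, because the intersection over it is the
        whole type and not G(H).\<close>
      unfolding U by (cases "{init_deg H..N0} = {}") (auto intro!: openin_Int openin_INT2 simp del: atLeastatMost_empty_iff2)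
  qed
  have cls: "GH_zariski TYPE('k) N H closure_of U = GH H" for N
  proof
    show "GH_zariski TYPE('k) N H closure_of U \<subseteq> GH H"
      using closure_of_subset_topspace[of "GH_zariski TYPE('k) N H" U] by (simp add: topspace_GH_zariski)
    show "GH H \<subseteq> GH_zariski TYPE('k) N H closure_of U"
    proof
      fix J :: "'k alg_closure bipoly set" assume G: "J \<in> GH H"
      note p = GHP[OF G]
      obtain Jt :: "'k alg_closure \<Rightarrow> 'k alg_closure bipoly set" where
        Jt: "\<forall>\<^sub>F t in cofinite. graded_ideal (Jt t) \<and> hilbert (Jt t) = hilbert J \<and> extremal_invariants (Jt t) (hilbert J)"
        and bs: "\<forall>i. \<exists>bs. (\<forall>r. poly_curve (\<lambda>t. bs t r)) \<and> is_basis (bp.dim (piece J i)) (bs 0) (piece J i) \<and>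
          (\<forall>\<^sub>F t in cofinite. is_basis (bp.dim (piece J i)) (bs t) (piece (Jt t) i))"
        using deformation[OF p(1-3)] by blast
      have JU: "\<forall>\<^sub>F t in cofinite. Jt t \<in> U"
        using Jt by (rule eventually_mono) (auto simp: U_def GH_def p(4))
      then have JG: "\<forall>\<^sub>F t in cofinite. Jt t \<in> GH H" by (rule eventually_mono) (simp add: U_def)
      show "J \<in> GH_zariski TYPE('k) N H closure_of U"
        unfolding in_closure_of topspace_GH_zariski
      proof (intro conjI allI impI G)
        fix T assume T: "J \<in> T \<and> openin (GH_zariski TYPE('k) N H) T"
        then have gt: "generate_topology_on {principal_open N H (P :: 'k plucker_poly) | P. multihomogeneous N H P} T"
          by (simp add: GH_zariski_def openin_topology_generated_by)
        have "\<forall>\<^sub>F t in cofinite. Jt t \<in> T"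
          by (rule generic_in_open[OF G JG bs[rule_format, unfolded GH_dim[OF G]] gt]) (use T in blast)
        with JU have "\<forall>\<^sub>F t in cofinite. Jt t \<in> U \<and> Jt t \<in> T" by eventually_elim simp
        \<comment> \<open>As K is infinite, a property of almost all parameters holds for at least
          one.\<close>
        moreover have "cofinite \<noteq> (bot :: 'k alg_closure filter)" by (simp add: infinite_alg_closed)
        ultimately show "\<exists>y. y \<in> U \<and> y \<in> T" using eventually_happens' by blast
      qed
    qed
  qed
  \<comment> \<open>J and its base change both have Hilbert function H, so only the dimensions of
    R_1 times their pieces are to be compared.\<close>
  have ext: "extremal_invariants J H" if J: "J \<in> GH H" and bJ: "base_change J \<in> U" for J :: "'k bipoly set"
  proof -
    have G: "base_change J \<in> GH H" using bJ by (simp add: U_def)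
    have p: "pdim (base_change J) i = pdim J i" for i
      using hilbert_pdim[of "base_change J" i] hilbert_pdim[of J i] GHP(4)[OF G] GHp(4)[OF J] by simp
    have "1 + min (hdiff H i) (hdiff H (i + 1)) \<le> tau (piece J i)" if i: "i \<ge> init_deg H" for i
    proof -
      have "1 + min (hdiff H i) (hdiff H (i + 1)) \<le> tau (piece (base_change J) i)"
        using bJ extremal_iff[OF GHP[OF G]] i by (simp add: U_def)
      also have "\<dots> \<le> tau (piece J i)"
        using rdim_base_change[OF GHp(1)[OF J] GH_ideal[OF G], of i] by (simp add: tau_pdim p)
      finally show ?thesis .
    qed
    then show ?thesis using extremal_iff[OF GHp[OF J]] by blast
  qed
  show "\<exists>U N0.
      (\<forall>N\<ge>N0. openin (GH_zariski TYPE('k) N H) U \<and>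
               GH_zariski TYPE('k) N H closure_of U = GH H) \<and>
      (\<forall>J\<in>U. extremal_invariants J H) \<and>
      (\<forall>J::'k bipoly set. J \<in> GH H \<and> base_change J \<in> U \<longrightarrow> extremal_invariants J H)"
    using opn cls ext by (intro exI[of _ U] exI[of _ N0]) (auto simp: U_def)
qed

end
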